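(* Let $k$ be a perfect field with $\operatorname{char}k\neq2$ and let $A$ be a $G_k$-group isomorphic to $D_8$. Let $u,v,w\in k^*$ and $z\in k$ be such that $K_1=k(\sqrt u)$, $K_2=k(\sqrt v)$, $uv\equiv1-z^2u\pmod{k^{*2}}$ and $K=k\big(\sqrt v,\sqrt{w(1+z\sqrt u)/2},\sqrt{w(1-z\sqrt u)/2}\big)$. Then $A$ is isomorphic as a $G_k$-group to a subgroup of $\operatorname{GL}_2(\overline k)$ stable under the $G_k$-action if and only if the quaternion class $(-v,w)$ is trivial in $\operatorname{Br}_2(k)$.
   Context: $G_k=\operatorname{Gal}(\overline k/k)$; $G_k$ acts on $\operatorname{GL}_2(\overline k)$ entrywise. A $G_k$-group is a finite group with an action of $G_k$ by group automorphisms factoring through a finite quotient; if $\rho:G_k\to\operatorname{Aut}(A)$ is the action, $K$ is the fixed field of $\ker\rho$. For $A\simeq D_8$: $K_1$ is the fixed field of the kernel of the induced action on $A/Z(A)$ ($\simeq V_4$, the abelianization), and $K_2$ that of the induced action on the unique cyclic subgroup of order 4 of $A$. $(a,b)\in\operatorname{Br}_2(k)$ denotes the class of the quaternion algebra with $i^2=a$, $j^2=b$, $ij=-ji$. The congruence $x\equiv y\pmod{k^{*2}}$ means $y\neq0$ and $x/y\in k^{*2}$. Such $u,v,w,z$ always exist. *)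

theory Defs
  imports
    "HOL-Algebra.Algebraic_Closure_Type"
    "HOL-Algebra.Elementary_Groups"
    "HOL-Algebra.Bij"
    "HOL-Algebra.QuotRing"
    "HOL-Algebra.Generated_Fields"
    "HOL-Algebra.Embedded_Algebras"
    "HOL-Algebra.Module"
    "HOL-Analysis.Cartesian_Space"
begin

text \<open>
  The base field \<open>k\<close> is a type \<open>'a\<close> of class \<open>field\<close>, and its algebraic closure is the type
  \<open>'a alg_closure\<close>, with embedding \<open>to_ac\<close>.
\<close>

subsection \<open>Fields and the absolute Galois group\<close>

text \<open>Every irreducible polynomial over \<open>k\<close> is separable, i.e. has only simple roots in
  the algebraic closure.\<close>
definition perfect_field :: "'a::field itself \<Rightarrow> bool" where
  "perfect_field _ \<longleftrightarrow>
     (\<forall>p :: 'a poly. Factorial_Ring.irreducible p \<longrightarrow> rsquarefree (map_poly to_ac p))"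

definition sq_cong :: "'a::field \<Rightarrow> 'a \<Rightarrow> bool" where
  "sq_cong x y \<longleftrightarrow> y \<noteq> 0 \<and> (\<exists>t. t \<noteq> 0 \<and> x / y = t\<^sup>2)"

abbreviation kbar :: "'a::field alg_closure ring" where
  "kbar \<equiv> ring_of_type_algebra"

abbreviation base_field :: "'a::field alg_closure set" where
  "base_field \<equiv> range to_ac"

definition adjoin :: "'a::field alg_closure set \<Rightarrow> 'a alg_closure set" where
  "adjoin S = generate_field kbar (base_field \<union> S)"

text \<open>Some square root. The fields \<open>k(\<surd>u)\<close>, \<open>k(\<surd>v)\<close> and
  \<open>k(\<surd>v, \<surd>(w(1 + z\<surd>u)/2), \<surd>(w(1 - z\<surd>u)/2))\<close> do not depend on the choices made.\<close>
definition ac_sqrt :: "'a::field alg_closure \<Rightarrow> 'a alg_closure" where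
  "ac_sqrt x = (SOME y. y\<^sup>2 = x)"

definition abs_gal :: "('a::field alg_closure \<Rightarrow> 'a alg_closure) monoid" where
  "abs_gal = \<lparr>carrier = {\<sigma> \<in> ring_iso kbar kbar. \<forall>c. \<sigma> (to_ac c) = to_ac c},
              monoid.mult = (\<circ>), one = id\<rparr>"

definition fixed_field ::
    "('a::field alg_closure \<Rightarrow> 'a alg_closure) set \<Rightarrow> 'a alg_closure set" where
  "fixed_field N = {x. \<forall>\<sigma>\<in>N. \<sigma> x = x}"

text \<open>Finite normal extensions of \<open>k\<close> inside the algebraic closure. Normality is stability
  under the absolute Galois group; over a perfect field these are the finite Galois extensions.\<close>
definition finite_normal_ext :: "'a::field alg_closure set \<Rightarrow> bool" where
  "finite_normal_ext L \<longleftrightarrow>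
     subfield L kbar \<and> base_field \<subseteq> L \<and> ring.finite_dimension kbar base_field L \<and>
     (\<forall>\<sigma>\<in>carrier abs_gal. \<sigma> ` L = L)"


subsection \<open>Finite groups with Galois action\<close>

type_synonym ('a, 'g) gal_action = "('a alg_closure \<Rightarrow> 'a alg_closure) \<Rightarrow> 'g \<Rightarrow> 'g"

text \<open>The last clause says that the action factors through the finite quotient \<open>Gal(L/k)\<close> of the
  absolute Galois group, for some finite Galois extension \<open>L\<close>, i.e. that it is continuous.
  The finiteness of the image alone would be automatic.\<close>
definition gal_group :: "('g, 'm) monoid_scheme \<Rightarrow> ('a::field, 'g) gal_action \<Rightarrow> bool" where
  "gal_group A \<rho> \<longleftrightarrow>
     group A \<and> finite (carrier A) \<and> \<rho> \<in> hom abs_gal (AutoGroup A) \<and>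
     (\<exists>L. finite_normal_ext L \<and>
        (\<forall>\<sigma>\<in>carrier abs_gal. (\<forall>x\<in>L. \<sigma> x = x) \<longrightarrow> \<sigma> \<in> kernel abs_gal (AutoGroup A) \<rho>))"

definition action_field ::
    "('g, 'm) monoid_scheme \<Rightarrow> ('a::field, 'g) gal_action \<Rightarrow> 'a alg_closure set" where
  "action_field A \<rho> = fixed_field (kernel abs_gal (AutoGroup A) \<rho>)"

definition restrict_action ::
    "'g set \<Rightarrow> ('a::field, 'g) gal_action \<Rightarrow> ('a, 'g) gal_action" where
  "restrict_action H \<rho> = (\<lambda>\<sigma>. restrict (\<rho> \<sigma>) H)"

definition quotient_action ::
    "('g, 'm) monoid_scheme \<Rightarrow> 'g set \<Rightarrow> ('a::field, 'g) gal_action \<Rightarrow> ('a, 'g set) gal_action" where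
  "quotient_action A N \<rho> = (\<lambda>\<sigma>. \<lambda>C\<in>carrier (A Mod N). \<rho> \<sigma> ` C)"

definition gal_isomorphic ::
    "('g, 'm) monoid_scheme \<Rightarrow> ('a::field, 'g) gal_action \<Rightarrow>
     ('h, 'n) monoid_scheme \<Rightarrow> ('a, 'h) gal_action \<Rightarrow> bool" where
  "gal_isomorphic A \<rho> B \<tau> \<longleftrightarrow>
     (\<exists>\<phi>\<in>iso A B. \<forall>\<sigma>\<in>carrier abs_gal. \<forall>a\<in>carrier A. \<phi> (\<rho> \<sigma> a) = \<tau> \<sigma> (\<phi> a))"

definition center :: "('g, 'm) monoid_scheme \<Rightarrow> 'g set" where
  "center A = {c \<in> carrier A. \<forall>x\<in>carrier A. c \<otimes>\<^bsub>A\<^esub> x = x \<otimes>\<^bsub>A\<^esub> c}"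

text \<open>The pair \<open>(i, e)\<close> stands for \<open>r\<^sup>i s\<^sup>e\<close>, where \<open>r\<^sup>4 = s\<^sup>2 = 1\<close> and \<open>s r = r\<^sup>-\<^sup>1 s\<close>.\<close>
definition D8 :: "(int \<times> int) monoid" where
  "D8 = \<lparr>carrier = {0..<4} \<times> {0..<2},
         monoid.mult = (\<lambda>(i, e) (j, f). ((if e = 0 then i + j else i - j) mod 4, (e + f) mod 2)),
         one = (0, 0)\<rparr>"

lemma group_D8: "group D8"
proof (rule groupI)
  show "x \<otimes>\<^bsub>D8\<^esub> y \<otimes>\<^bsub>D8\<^esub> z = x \<otimes>\<^bsub>D8\<^esub> (y \<otimes>\<^bsub>D8\<^esub> z)"
    if "x \<in> carrier D8" "y \<in> carrier D8" "z \<in> carrier D8" for x y z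
  proof -
    have "snd x \<in> {0, 1}" "snd y \<in> {0, 1}" using that by (auto simp: D8_def)
    then show ?thesis
      by (cases x; cases y; cases z) (auto simp: D8_def mod_simps algebra_simps)
  qed
next
  fix x assume "x \<in> carrier D8"
  then show "\<exists>y\<in>carrier D8. y \<otimes>\<^bsub>D8\<^esub> x = \<one>\<^bsub>D8\<^esub>"
    by (intro bexI[of _ "if snd x = 0 then ((- fst x) mod 4, 0) else x"])
       (auto simp: D8_def mod_simps)
qed (auto simp: D8_def)

lemma order_D8: "Coset.order D8 = 8"
  by (simp add: Coset.order_def D8_def)

text \<open>Used only for groups with exactly one cyclic subgroup of order 4, such as dihedral groups of
  order 8 (\<open>ex1_cyclic4\<close>).\<close>
definition cyclic4 :: "('g, 'm) monoid_scheme \<Rightarrow> 'g set" where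
  "cyclic4 A = (THE C. subgroup C A \<and> cyclic_group (A\<lparr>carrier := C\<rparr>) \<and> card C = 4)"

lemma ex1_cyclic4:
  fixes A :: "('g, 'm) monoid_scheme"
  assumes "group A" and "A \<cong> D8"
  shows "\<exists>!C. subgroup C A \<and> cyclic_group (A\<lparr>carrier := C\<rparr>) \<and> card C = 4"
proof -
  interpret A: group A by fact
  interpret D: group D8 by (rule group_D8)
  from assms obtain \<phi> where phi: "\<phi> \<in> iso A D8" by (auto simp: is_iso_def)
  then interpret h: group_hom A D8 \<phi>
    by (intro group_hom.intro group_hom_axioms.intro assms group_D8) (auto simp: iso_def)
  have bij: "bij_betw \<phi> (carrier A) (carrier D8)" using phi by (auto simp: iso_def)
  have inj: "a = b" if "\<phi> a = \<phi> b" "a \<in> carrier A" "b \<in> carrier A" for a b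
    using bij that by (auto simp: bij_betw_def inj_on_def)
  define C where "C = {a \<in> carrier A. snd (\<phi> a) = 0}"
  have C_img: "\<phi> ` C = {0..<4} \<times> {0}"
  proof -
    have "\<phi> ` C = {p \<in> carrier D8. snd p = 0}"
      unfolding C_def bij_betw_imp_surj_on[OF bij, symmetric] by auto
    also have "\<dots> = {0..<4} \<times> {0}" by (auto simp: D8_def)
    finally show ?thesis .
  qed
  have "inj_on \<phi> C" using inj by (auto simp: inj_on_def C_def)
  then have card_C: "card C = 4"
    using card_image[of \<phi> C] by (simp add: C_img card_cartesian_product)
  then have fin_C: "finite C" by (metis card.infinite zero_neq_numeral)
  have sub_C: "subgroup C A"
  proof (rule A.subgroupI)
    show "C \<noteq> {}" using card_C by auto
    show "inv\<^bsub>A\<^esub> a \<in> C" if "a \<in> C" for a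
    proof -
      have a: "a \<in> carrier A" "\<phi> a \<in> carrier D8" "snd (\<phi> a) = 0"
        using that by (auto simp: C_def)
      have b: "\<phi> (inv\<^bsub>A\<^esub> a) \<in> carrier D8" using a by simp
      have "\<phi> (inv\<^bsub>A\<^esub> a) \<otimes>\<^bsub>D8\<^esub> \<phi> a = \<one>\<^bsub>D8\<^esub>"
        using a by (metis A.inv_closed A.l_inv h.hom_mult h.hom_one)
      with a b have "snd (\<phi> (inv\<^bsub>A\<^esub> a)) = 0"
        by (cases "\<phi> a"; cases "\<phi> (inv\<^bsub>A\<^esub> a)") (auto simp: D8_def)
      then show ?thesis using a by (auto simp: C_def)
    qed
    show "a \<otimes>\<^bsub>A\<^esub> b \<in> C" if "a \<in> C" "b \<in> C" for a b
      using that by (cases "\<phi> a"; cases "\<phi> b") (auto simp: C_def D8_def)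
  qed (auto simp: C_def)
  have cyc: "cyclic_group (A\<lparr>carrier := S\<rparr>) \<longleftrightarrow> (\<exists>x\<in>S. S = range (\<lambda>n::int. x [^]\<^bsub>A\<^esub> n))"
    if "subgroup S A" for S
  proof -
    interpret S: group "A\<lparr>carrier := S\<rparr>" using that by (rule subgroup.subgroup_is_group) fact
    show ?thesis
      using A.int_pow_consistent[OF that] by (auto simp: S.cyclic_group)
  qed
  show ?thesis
  proof (rule ex1I[of _ C])
    have "(1, 0) \<in> \<phi> ` C" by (simp add: C_img)
    then obtain x where x: "x \<in> C" "\<phi> x = (1, 0)" by force
    have xc: "x \<in> carrier A" using x by (simp add: C_def)
    have pow: "\<phi> (x [^]\<^bsub>A\<^esub> n) = (int n mod 4, 0)" for n :: nat
    proof (induction n)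
      case 0 then show ?case by (simp add: D8_def)
    next
      case (Suc n)
      have "\<phi> (x [^]\<^bsub>A\<^esub> Suc n) = \<phi> (x [^]\<^bsub>A\<^esub> n) \<otimes>\<^bsub>D8\<^esub> (1, 0)"
        using xc x by simp
      then show ?case using Suc by (simp add: D8_def mod_simps add.commute)
    qed
    have "C = range (\<lambda>n::int. x [^]\<^bsub>A\<^esub> n)"
    proof
      show "range (\<lambda>n::int. x [^]\<^bsub>A\<^esub> n) \<subseteq> C"
        using A.subgroup_int_pow_closed[OF sub_C x(1)] by auto
      show "C \<subseteq> range (\<lambda>n::int. x [^]\<^bsub>A\<^esub> n)"
      proof
        fix c assume c: "c \<in> C"
        then have "\<phi> c \<in> {0..<4} \<times> {0}" using C_img by blast
        then obtain i where i: "\<phi> c = (i, 0)" "0 \<le> i" "i < 4" by auto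
        have "\<phi> (x [^]\<^bsub>A\<^esub> nat i) = \<phi> c" using i pow[of "nat i"] by (simp del: int_pow_int)
        then have "c = x [^]\<^bsub>A\<^esub> nat i"
          using inj c xc by (simp add: C_def)
        then show "c \<in> range (\<lambda>n::int. x [^]\<^bsub>A\<^esub> n)"
          by (metis int_pow_int rangeI)
      qed
    qed
    then show "subgroup C A \<and> cyclic_group (A\<lparr>carrier := C\<rparr>) \<and> card C = 4"
      using sub_C card_C cyc[OF sub_C] x(1) by blast
  next
    fix S assume S: "subgroup S A \<and> cyclic_group (A\<lparr>carrier := S\<rparr>) \<and> card S = 4"
    then obtain x where x: "x \<in> S" "S = range (\<lambda>n::int. x [^]\<^bsub>A\<^esub> n)" using cyc by blast
    have xc: "x \<in> carrier A" using x S by (meson subgroup.mem_carrier)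
    have "x \<in> C"
    proof (rule ccontr)
      assume "x \<notin> C"
      have "\<phi> x \<in> carrier D8" using xc by simp
      then have "\<phi> x \<otimes>\<^bsub>D8\<^esub> \<phi> x = \<one>\<^bsub>D8\<^esub>"
        using xc \<open>x \<notin> C\<close> by (cases "\<phi> x") (auto simp: C_def D8_def)
      then have xx: "x \<otimes>\<^bsub>A\<^esub> x = \<one>\<^bsub>A\<^esub>"
        using inj xc by (metis A.m_closed A.one_closed h.hom_mult h.hom_one)
      have "x [^]\<^bsub>A\<^esub> n \<in> {\<one>\<^bsub>A\<^esub>, x}" for n :: int
      proof -
        have two: "x [^]\<^bsub>A\<^esub> (2::int) = \<one>\<^bsub>A\<^esub>"
          using xx xc by (metis A.int_pow_mult A.int_pow_1 one_add_one)
        have "x [^]\<^bsub>A\<^esub> n = x [^]\<^bsub>A\<^esub> (2 * (n div 2) + n mod 2)" by simp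
        also have "\<dots> = (x [^]\<^bsub>A\<^esub> (2::int)) [^]\<^bsub>A\<^esub> (n div 2) \<otimes>\<^bsub>A\<^esub> x [^]\<^bsub>A\<^esub> (n mod 2)"
          using xc by (simp only: A.int_pow_mult A.int_pow_pow)
        also have "\<dots> = x [^]\<^bsub>A\<^esub> (n mod 2)" using xc by (simp add: two)
        finally have e: "x [^]\<^bsub>A\<^esub> n = x [^]\<^bsub>A\<^esub> (n mod 2)" .
        have "n mod 2 = 0 \<or> n mod 2 = 1" by auto
        with e show ?thesis using xc by (auto simp: A.int_pow_1)
      qed
      then have "S \<subseteq> {\<one>\<^bsub>A\<^esub>, x}" using x by auto
      then have "card S \<le> card {\<one>\<^bsub>A\<^esub>, x}" by (intro card_mono) auto
      also have "\<dots> \<le> 2" by (simp add: card_insert_if)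
      finally show False using S by simp
    qed
    then have "S \<subseteq> C" using x A.subgroup_int_pow_closed[OF sub_C] by auto
    then show "S = C" using card_subset_eq[OF fin_C] S card_C by simp
  qed
qed

definition GL2 :: "('b::field ^ 2 ^ 2) monoid" where
  "GL2 = \<lparr>carrier = {M. invertible M}, monoid.mult = (**), one = mat 1\<rparr>"

definition gal_stable :: "('a::field alg_closure ^ 2 ^ 2) set \<Rightarrow> bool" where
  "gal_stable H \<longleftrightarrow> (\<forall>\<sigma>\<in>carrier abs_gal. \<forall>M\<in>H. map_matrix \<sigma> M \<in> H)"


subsection \<open>Quaternion algebras and Brauer equivalence\<close>

text \<open>An algebra over \<open>k\<close>, not necessarily commutative, is a record of type
  \<open>('a, 'b) module\<close>, i.e. a ring together with a scalar multiplication.\<close>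

definition base_alg :: "('a::field, 'a) module" where
  "base_alg = \<lparr>carrier = UNIV, monoid.mult = (*), one = 1, ring.zero = 0, add = (+), module.smult = (*)\<rparr>"

text \<open>\<open>(x0, x1, x2, x3)\<close> stands for \<open>x0 + x1 i + x2 j + x3 ij\<close>,
  where \<open>i\<^sup>2 = a\<close>, \<open>j\<^sup>2 = b\<close> and \<open>ij = -ji\<close>.\<close>
definition quaternion_alg :: "'a::field \<Rightarrow> 'a \<Rightarrow> ('a, 'a \<times> 'a \<times> 'a \<times> 'a) module" where
  "quaternion_alg a b =
     \<lparr>carrier = UNIV,
      monoid.mult = (\<lambda>(x0, x1, x2, x3) (y0, y1, y2, y3).
        (x0 * y0 + a * x1 * y1 + b * x2 * y2 - a * b * x3 * y3,
         x0 * y1 + x1 * y0 - b * x2 * y3 + b * x3 * y2,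
         x0 * y2 + x2 * y0 + a * x1 * y3 - a * x3 * y1,
         x0 * y3 + x3 * y0 + x1 * y2 - x2 * y1)),
      one = (1, 0, 0, 0),
      ring.zero = (0, 0, 0, 0),
      add = (\<lambda>(x0, x1, x2, x3) (y0, y1, y2, y3). (x0 + y0, x1 + y1, x2 + y2, x3 + y3)),
      module.smult = (\<lambda>c (x0, x1, x2, x3). (c * x0, c * x1, c * x2, c * x3))\<rparr>"

lemma ring_quaternion_alg: "ring (quaternion_alg a b)"
proof (rule ringI)
  show "abelian_group (quaternion_alg a b)"
  proof (rule abelian_groupI)
    fix x assume "x \<in> carrier (quaternion_alg a b)"
    show "\<exists>y\<in>carrier (quaternion_alg a b). y \<oplus>\<^bsub>quaternion_alg a b\<^esub> x = \<zero>\<^bsub>quaternion_alg a b\<^esub>"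
      by (rule bexI[of _ "case x of (x0, x1, x2, x3) \<Rightarrow> (- x0, - x1, - x2, - x3)"])
         (auto simp: quaternion_alg_def split: prod.splits)
  qed (auto simp: quaternion_alg_def)
  show "Group.monoid (quaternion_alg a b)"
    by (rule monoidI) (auto simp: quaternion_alg_def algebra_simps)
qed (auto simp: quaternion_alg_def algebra_simps)

lemma quaternion_alg_relations:
  defines "i \<equiv> (0, 1, 0, 0)" and "j \<equiv> (0, 0, 1, 0)"
  shows "i \<otimes>\<^bsub>quaternion_alg a b\<^esub> i = a \<odot>\<^bsub>quaternion_alg a b\<^esub> \<one>\<^bsub>quaternion_alg a b\<^esub>"
    and "j \<otimes>\<^bsub>quaternion_alg a b\<^esub> j = b \<odot>\<^bsub>quaternion_alg a b\<^esub> \<one>\<^bsub>quaternion_alg a b\<^esub>"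
    and "i \<otimes>\<^bsub>quaternion_alg a b\<^esub> j = (0, 0, 0, 1)"
    and "j \<otimes>\<^bsub>quaternion_alg a b\<^esub> i = (0, 0, 0, - 1)"
  by (simp_all add: quaternion_alg_def i_def j_def)

text \<open>The algebra of \<open>n \<times> n\<close> matrices over an algebra \<open>B\<close>.\<close>
definition mat_alg :: "nat \<Rightarrow> ('a, 'b) module \<Rightarrow> ('a, nat \<times> nat \<Rightarrow> 'b) module" where
  "mat_alg n B =
     \<lparr>carrier = {..<n} \<times> {..<n} \<rightarrow>\<^sub>E carrier B,
      monoid.mult = (\<lambda>M N. \<lambda>(i, j)\<in>{..<n} \<times> {..<n}. \<Oplus>\<^bsub>B\<^esub>l\<in>{..<n}. M (i, l) \<otimes>\<^bsub>B\<^esub> N (l, j)),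
      one = (\<lambda>(i, j)\<in>{..<n} \<times> {..<n}. if i = j then \<one>\<^bsub>B\<^esub> else \<zero>\<^bsub>B\<^esub>),
      ring.zero = (\<lambda>_\<in>{..<n} \<times> {..<n}. \<zero>\<^bsub>B\<^esub>),
      add = (\<lambda>M N. \<lambda>p\<in>{..<n} \<times> {..<n}. M p \<oplus>\<^bsub>B\<^esub> N p),
      module.smult = (\<lambda>c M. \<lambda>p\<in>{..<n} \<times> {..<n}. c \<odot>\<^bsub>B\<^esub> M p)\<rparr>"

definition alg_isomorphic :: "('a, 'b) module \<Rightarrow> ('a, 'c) module \<Rightarrow> bool" where
  "alg_isomorphic B C \<longleftrightarrow>
     (\<exists>h\<in>ring_iso B C. \<forall>c. \<forall>x\<in>carrier B. h (c \<odot>\<^bsub>B\<^esub> x) = c \<odot>\<^bsub>C\<^esub> h x)"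

definition brauer_equivalent :: "('a, 'b) module \<Rightarrow> ('a, 'c) module \<Rightarrow> bool" where
  "brauer_equivalent B C \<longleftrightarrow> (\<exists>m>0. \<exists>n>0. alg_isomorphic (mat_alg m B) (mat_alg n C))"

text \<open>The neutral element of the Brauer group, and hence of its 2-torsion subgroup, is the class
  of \<open>k\<close> itself.\<close>
definition trivial_brauer_class :: "('a::field, 'b) module \<Rightarrow> bool" where
  "trivial_brauer_class B \<longleftrightarrow> brauer_equivalent B (base_alg :: ('a, 'a) module)"

end

theory Submission
  imports Defs
begin

text \<open>
  Write \<open>\<alpha>\<close>, \<open>\<beta>\<close> for the square roots of \<open>w (1 \<plusminus> z \<surd>u) / 2\<close>, so that \<open>\<alpha>\<^sup>2 + \<beta>\<^sup>2 = w\<close> and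
  \<open>\<alpha> \<beta>\<close> is a multiple of \<open>\<surd>u \<surd>v\<close> by an element of \<open>k\<close>. By the Galois correspondence, the action
  on \<open>\<surd>u\<close>, \<open>\<surd>v\<close>, \<open>\<alpha>\<close>, \<open>\<beta>\<close> determines the action on the generators \<open>r\<close>, \<open>s\<close> of \<open>A\<close>, up to a
  suitable choice of the generators. In an equivariant embedding of \<open>A\<close> into the invertible matrices
  the images \<open>R\<close>, \<open>S\<close> of the generators satisfy \<open>R\<^sup>2 = - 1\<close>, since the square of \<open>R\<close> commutes with
  everything. Then \<open>I = \<surd>v R\<close> and \<open>J = \<alpha> S + \<beta> R S\<close> are Galois invariant, hence have entries in \<open>k\<close>,
  and satisfy \<open>I\<^sup>2 = - v\<close>, \<open>J\<^sup>2 = w\<close>, \<open>I J = - J I\<close>. Conversely, \<open>R = I / \<surd>v\<close> and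
  \<open>S = (\<alpha> J - \<beta> R J) / w\<close> recover an embedding from such \<open>I\<close> and \<open>J\<close>. Matrices \<open>I\<close>, \<open>J\<close> of this
  kind exist exactly if the quaternion algebra splits.
\<close>

text \<open>The hypotheses name fixed fields: they tell which elements of \<open>abs_gal\<close> act
  trivially on A, on A modulo its center and on the cyclic subgroup, but not how the others act. An
  automorphism of D8 sends r to r or its inverse and s to r^m s. The sign and the parity of m are
  characters, seen on \<surd>v and \<surd>u. The high binary digit of m is not a character: its
  composition law has a carry term. The sign in \<sigma> \<alpha> = +-\<alpha> or +-\<beta> obeys a
  law with the same carry term, because \<alpha> \<beta> is a multiple of \<surd>u \<surd>v over k.
  So the two differ by a character, which the hypothesis on K forces to be a combination of sign and
  parity. These combinations are exactly the changes of the high digit caused by replacing r by its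
  inverse, or s by r s.

  On the Brauer side, triviality is given as an isomorphism of matrix algebras of unknown sizes. A
  dimension count extracts an isotropic vector of the norm form from it, in place of structure
  theory for simple algebras.\<close>

subsection \<open>Two by two matrices\<close>

text \<open>A matrix type whose ring structure is that of the type class \<^class>\<open>ring_1\<close>: on
  \<open>'b ^ 2 ^ 2\<close> the multiplication of the type class is componentwise.\<close>
datatype 'b mat2 = Mat2 (m11: 'b) (m12: 'b) (m21: 'b) (m22: 'b)

instantiation mat2 :: (field) ring_1
begin

definition "0 = Mat2 0 0 0 0"
definition "1 = Mat2 1 0 0 1"
definition "A + B = Mat2 (m11 A + m11 B) (m12 A + m12 B) (m21 A + m21 B) (m22 A + m22 B)"
definition "A - B = Mat2 (m11 A - m11 B) (m12 A - m12 B) (m21 A - m21 B) (m22 A - m22 B)"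
definition "- A = Mat2 (- m11 A) (- m12 A) (- m21 A) (- m22 A)"
definition "A * B = Mat2 (m11 A * m11 B + m12 A * m21 B) (m11 A * m12 B + m12 A * m22 B)
                        (m21 A * m11 B + m22 A * m21 B) (m21 A * m12 B + m22 A * m22 B)"

instance
proof
  fix A B C :: "'a mat2"
  show "A * B * C = A * (B * C)" by (simp add: times_mat2_def algebra_simps)
  show "(A + B) * C = A * C + B * C" "A * (B + C) = A * B + A * C"
    by (simp_all add: times_mat2_def plus_mat2_def algebra_simps)
qed (simp_all add: zero_mat2_def one_mat2_def plus_mat2_def minus_mat2_def uminus_mat2_def times_mat2_def
  add.assoc add.commute)

end

lemmas mat2_defs = zero_mat2_def one_mat2_def plus_mat2_def minus_mat2_def uminus_mat2_def times_mat2_def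

text \<open>Scalars as matrices turn the later linear algebra into rewriting in a noncommutative
  ring: scalars are moved to the left and sorted there.\<close>

definition scal :: "'b::field \<Rightarrow> 'b mat2" where
  "scal c = Mat2 c 0 0 c"

lemma scal_simps:
  "scal 0 = 0" "scal 1 = 1" "scal (c + d) = scal c + scal d" "scal (c - d) = scal c - scal d"
  "scal (- c) = - scal c"
  by (simp_all add: scal_def mat2_defs)

lemma scal_mult: "scal (c * d) = scal c * scal d"
  by (simp add: scal_def mat2_defs)

lemma scal_commute: "M * scal c = scal c * M"
  by (simp add: scal_def mat2_defs)

lemma scal_left_commute: "scal c * (scal d * M) = scal d * (scal c * M)"
  by (metis mult.assoc scal_commute)

lemma scal_inject [simp]: "scal c = scal d \<longleftrightarrow> c = d"
  and scal_eq_0_iff [simp]: "scal c = 0 \<longleftrightarrow> c = 0"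
  by (simp_all add: scal_def zero_mat2_def)

lemma scal_mult_eq_0_iff: "scal c * M = 0 \<longleftrightarrow> c = 0 \<or> M = 0"
  by (cases M) (auto simp: scal_def mat2_defs)

text \<open>Images of the generators i and j of the quaternion algebra (a, b) among the 2 by 2
  matrices. The existence of such a pair is the condition at which both sides of the theorem
  meet.\<close>

definition quat_pair :: "'b::field \<Rightarrow> 'b \<Rightarrow> 'b mat2 \<Rightarrow> 'b mat2 \<Rightarrow> bool" where
  "quat_pair a b I J \<longleftrightarrow> I * I = scal a \<and> J * J = scal b \<and> J * I = - (I * J)"

subsection \<open>Underdetermined linear systems\<close>

definition linear_fun :: "(('i \<Rightarrow> 'b::field) \<Rightarrow> 'b) \<Rightarrow> bool" where
  "linear_fun F \<longleftrightarrow> (\<forall>x y. F (\<lambda>i. x i + y i) = F x + F y) \<and> (\<forall>c x. F (\<lambda>i. c * x i) = c * F x)"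

lemma linear_fun_add: "linear_fun F \<Longrightarrow> F (\<lambda>i. x i + y i) = F x + F y"
  and linear_fun_scale: "linear_fun F \<Longrightarrow> F (\<lambda>i. c * x i) = c * F x"
  by (simp_all add: linear_fun_def)

text \<open>\<open>linear_fun\<close> concerns all functions on a possibly infinite index set, where
  unit vectors do not span. Finite support is what allows coordinates to be removed one at a
  time.\<close>

lemma linear_fun_vanishes:
  assumes F: "linear_fun F" and "finite A" and "\<And>i. i \<in> A \<Longrightarrow> F (\<lambda>j. if j = i then 1 else 0) = 0"
    and "\<And>i. i \<notin> A \<Longrightarrow> x i = 0"
  shows "F x = 0"
  using assms(2-)
proof (induction A arbitrary: x)
  case empty
  \<comment> \<open>Homogeneity with factor 0 gives the value 0 at the zero vector.\<close>
  then have "x = (\<lambda>i. 0 * x i)" by auto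
  then have "F x = 0 * F x" using F unfolding linear_fun_def by metis
  then show ?case by simp
next
  case (insert p A)
  define d where "d = (\<lambda>j. if j = p then 1 else 0 :: 'b)"
  have x: "x = (\<lambda>i. (x(p := 0)) i + (\<lambda>i. x p * d i) i)" by (auto simp: d_def)
  have "F x = F (x(p := 0)) + F (\<lambda>i. x p * d i)"
    by (subst x) (rule linear_fun_add[OF F])
  also have "F (x(p := 0)) = 0" 
  proof (rule insert.IH)
    show "F (\<lambda>j. if j = i then 1 else 0) = 0" if "i \<in> A" for i
      by (rule insert.prems(1)) (use that in simp)
    show "(x(p := 0)) i = 0" if "i \<notin> A" for i
      using insert.prems(2)[of i] that by simp
  qed
  also have "F (\<lambda>i. x p * d i) = x p * F d" by (rule linear_fun_scale[OF F])
  also have "F d = 0" using insert.prems(1)[of p] by (simp add: d_def)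
  finally show ?case by simp
qed

text \<open>Gaussian elimination, by induction on the equations. If the new functional vanishes on
  all unit vectors of \<open>A\<close>, it imposes nothing; otherwise a pivot \<open>p\<close>
  eliminates one equation and one unknown.\<close>

lemma underdetermined_system:
  fixes F :: "'j \<Rightarrow> ('i \<Rightarrow> 'b::field) \<Rightarrow> 'b"
  assumes "finite B" "finite A" "card B < card A" "\<And>j. j \<in> B \<Longrightarrow> linear_fun (F j)"
  shows "\<exists>x. (\<exists>i. x i \<noteq> 0) \<and> (\<forall>i. i \<notin> A \<longrightarrow> x i = 0) \<and> (\<forall>j\<in>B. F j x = 0)"
  using assms
proof (induction B arbitrary: A F)
  case empty
  then obtain p where "p \<in> A" by fastforce
  then show ?case by (intro exI[of _ "\<lambda>i. if i = p then 1 else 0"]) auto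
next
  case (insert k B)
  let ?d = "\<lambda>p j. if j = p then 1 else 0 :: 'b"
  have lk: "linear_fun (F k)" by (rule insert.prems(3)) simp
  show ?case
  proof (cases "\<forall>p\<in>A. F k (?d p) = 0")
    case True
    have "\<exists>x. (\<exists>i. x i \<noteq> 0) \<and> (\<forall>i. i \<notin> A \<longrightarrow> x i = 0) \<and> (\<forall>j\<in>B. F j x = 0)"
    proof (rule insert.IH)
      show "finite A" "card B < card A" using insert.prems(1,2) insert.hyps by simp_all
      show "linear_fun (F j)" if "j \<in> B" for j by (rule insert.prems(3)) (use that in simp)
    qed
    then obtain x where x: "\<exists>i. x i \<noteq> 0" "\<forall>i. i \<notin> A \<longrightarrow> x i = 0" "\<forall>j\<in>B. F j x = 0" by blast
    have "F k x = 0"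
      by (rule linear_fun_vanishes[OF lk insert.prems(1)]) (use True x(2) in simp_all)
    with x(3) have "\<forall>j\<in>insert k B. F j x = 0" by blast
    with x(1,2) show ?thesis by meson
  next
    case False
    then obtain p where p: "p \<in> A" "F k (?d p) \<noteq> 0" by meson
    define c where "c x = F k x / F k (?d p)" for x
    \<comment> \<open>\<open>G j\<close> is \<open>F j\<close> after projection to the kernel of
      \<open>F k\<close> along the unit vector at \<open>p\<close>, so the projection of a common
      zero of the \<open>G j\<close> is a common zero of all the \<open>F j\<close>.\<close>
    define G where "G j x = F j (\<lambda>i. x i + (- c x) * ?d p i)" for j x
    have FG: "G j x = F j x - c x * F j (?d p)" if "linear_fun (F j)" for j x
    proof -
      have "F j (\<lambda>i. x i + (- c x) * ?d p i) = F j x + F j (\<lambda>i. (- c x) * ?d p i)"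
        by (rule linear_fun_add[OF that])
      also have "F j (\<lambda>i. (- c x) * ?d p i) = (- c x) * F j (?d p)"
        by (rule linear_fun_scale[OF that])
      finally show ?thesis by (simp add: G_def)
    qed
    have c: "c (\<lambda>i. x i + y i) = c x + c y" "c (\<lambda>i. a * x i) = a * c x" for x y a
      unfolding c_def linear_fun_add[OF lk] linear_fun_scale[OF lk] by (simp_all add: add_divide_distrib)
    have lG: "linear_fun (G j)" if "j \<in> B" for j
    proof -
      have lj: "linear_fun (F j)" by (rule insert.prems(3)) (use that in simp)
      have "G j (\<lambda>i. x i + y i) = G j x + G j y" for x y
        unfolding FG[OF lj] c linear_fun_add[OF lj] by (simp add: algebra_simps)
      moreover have "G j (\<lambda>i. a * x i) = a * G j x" for a x
        unfolding FG[OF lj] c linear_fun_scale[OF lj] by (simp add: algebra_simps)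
      ultimately show ?thesis unfolding linear_fun_def by blast
    qed
    have "\<exists>x. (\<exists>i. x i \<noteq> 0) \<and> (\<forall>i. i \<notin> A - {p} \<longrightarrow> x i = 0) \<and> (\<forall>j\<in>B. G j x = 0)"
    proof (rule insert.IH)
      show "finite (A - {p})" "card B < card (A - {p})"
        using insert.prems(1,2) insert.hyps p(1) by simp_all
    qed (rule lG)
    then obtain x where x: "\<exists>i. x i \<noteq> 0" "\<forall>i. i \<notin> A - {p} \<longrightarrow> x i = 0" "\<forall>j\<in>B. G j x = 0" by blast
    define y where "y = (\<lambda>i. x i + (- c x) * ?d p i)"
    have "\<exists>i. y i \<noteq> 0"
    proof -
      \<comment> \<open>The projection changes the coordinate at \<open>p\<close> only, where
        \<open>x\<close> vanishes, so a nonzero coordinate survives.\<close>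
      obtain i where "x i \<noteq> 0" using x by blast
      moreover from this have "i \<noteq> p" using x(2) by blast
      ultimately show ?thesis by (intro exI[of _ i]) (simp add: y_def)
    qed
    moreover have "y i = 0" if "i \<notin> A" for i
    proof -
      have "i \<noteq> p" "x i = 0" using that x(2) p(1) by blast+
      then show ?thesis by (simp add: y_def)
    qed
    moreover have "\<forall>j\<in>insert k B. F j y = 0"
    proof -
      have Gy: "F j y = G j x" for j unfolding y_def G_def ..
      have "F k y = 0" unfolding Gy FG[OF lk] unfolding c_def using p(2) by simp
      moreover have "\<forall>j\<in>B. F j y = 0" unfolding Gy using x(3) .
      ultimately show ?thesis by blast
    qed
    ultimately show ?thesis by meson
  qed
qed

lemma two_neq_0:
  assumes "CHAR('a::field) \<noteq> 2"
  shows "(2 :: 'a) \<noteq> 0"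
proof
  assume "(2 :: 'a) = 0"
  then have d: "CHAR('a) dvd 2" using of_nat_eq_0_iff_char_dvd[of 2, where 'a = 'a] by simp
  then have "CHAR('a) \<le> 2" by (rule dvd_imp_le) simp
  moreover have "CHAR('a) \<noteq> 0" using d by (metis dvd_0_left zero_neq_numeral)
  moreover have "CHAR('a) \<noteq> 1" by simp
  ultimately show False using assms by linarith
qed

subsection \<open>Splitting of quaternion algebras\<close>

definition mat2_entry :: "'b mat2 \<Rightarrow> nat \<Rightarrow> nat \<Rightarrow> 'b" where
  "mat2_entry M i j = (if i = 0 then if j = 0 then m11 M else m12 M
                       else if j = 0 then m21 M else m22 M)"

lemma mat2_entry_eqI:
  assumes "\<And>i j. i < 2 \<Longrightarrow> j < 2 \<Longrightarrow> mat2_entry M i j = mat2_entry N i j"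
  shows "M = N"
  using assms[of 0 0] assms[of 0 1] assms[of 1 0] assms[of 1 1]
  by (simp add: mat2_entry_def mat2.expand)

lemma mat2_entry_mult: "mat2_entry (M * N) i j = (\<Sum>l<2. mat2_entry M i l * mat2_entry N l j)"
  by (simp add: mat2_entry_def times_mat2_def numeral_2_eq_2)

lemma base_alg_simps:
  "carrier base_alg = UNIV" "x \<otimes>\<^bsub>base_alg\<^esub> y = x * y" "x \<oplus>\<^bsub>base_alg\<^esub> y = x + y"
  "\<one>\<^bsub>base_alg\<^esub> = 1" "\<zero>\<^bsub>base_alg\<^esub> = 0" "c \<odot>\<^bsub>base_alg\<^esub> x = c * x"
  by (simp_all add: base_alg_def)

lemma ring_base_alg: "ring (base_alg :: ('a::field, 'a) module)"
proof (rule ringI)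
  show "abelian_group (base_alg :: ('a, 'a) module)"
  proof (rule abelian_groupI)
    fix x :: 'a assume "x \<in> carrier base_alg"
    show "\<exists>y\<in>carrier base_alg. y \<oplus>\<^bsub>base_alg\<^esub> x = \<zero>\<^bsub>base_alg\<^esub>"
      by (rule bexI[of _ "- x"]) (auto simp: base_alg_def)
  qed (auto simp: base_alg_def)
  show "Group.monoid (base_alg :: ('a, 'a) module)"
    by (rule monoidI) (auto simp: base_alg_def)
qed (auto simp: base_alg_def algebra_simps)

lemma finsum_base_alg:
  assumes "finite A"
  shows "finsum (base_alg :: ('a::field, 'a) module) f A = sum f A"
proof -
  interpret ring "base_alg :: ('a, 'a) module" by (rule ring_base_alg)
  have "finsum base_alg f A = sum f A" using assms
    by (induction A) (simp_all add: base_alg_simps)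
  then show ?thesis .
qed

section \<open>From a pair of generators to an isomorphism with the matrix algebra\<close>

context
  fixes a b :: "'a::field" and I J :: "'a mat2"
  assumes char2: "CHAR('a) \<noteq> 2" and a: "a \<noteq> 0" and b: "b \<noteq> 0" and IJ: "quat_pair a b I J"
begin

definition quat_emb :: "'a \<times> 'a \<times> 'a \<times> 'a \<Rightarrow> 'a mat2" where
  "quat_emb = (\<lambda>(x0, x1, x2, x3). scal x0 + scal x1 * I + scal x2 * J + scal x3 * (I * J))"

lemma quat_rules:
  "I * I = scal a" "J * J = scal b" "J * I = - (I * J)"
  "I * (I * M) = scal a * M" "J * (J * M) = scal b * M" "J * (I * M) = - (I * (J * M))"
  "I * scal c = scal c * I" "J * scal c = scal c * J"
  "I * (scal c * M) = scal c * (I * M)" "J * (scal c * M) = scal c * (J * M)"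
proof -
  show *: "I * I = scal a" "J * J = scal b" "J * I = - (I * J)"
    using IJ by (auto simp: quat_pair_def)
  show "I * (I * M) = scal a * M" "J * (J * M) = scal b * M" "J * (I * M) = - (I * (J * M))"
    using * by (simp_all flip: mult.assoc)
  show "I * scal c = scal c * I" "J * scal c = scal c * J" by (rule scal_commute)+
  then show "I * (scal c * M) = scal c * (I * M)" "J * (scal c * M) = scal c * (J * M)"
    by (simp_all flip: mult.assoc)
qed

lemma quat_emb_mult: "quat_emb (x \<otimes>\<^bsub>quaternion_alg a b\<^esub> y) = quat_emb x * quat_emb y"
  \<comment> \<open>Instantiated at a scalar matrix, \<open>scal_commute\<close> permutes two
    scalars and acts as an ordered rewrite rule; with \<open>scal_left_commute\<close> it sorts all
    scalars.\<close>
  by (cases x; cases y)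
    (simp add: quat_emb_def quaternion_alg_def scal_simps scal_mult algebra_simps quat_rules
      scal_commute[of "scal c" for c] scal_left_commute)

text \<open>Up to a factor, conjugation by \<open>I\<close> fixes the span of 1 and \<open>I\<close>
  and negates its product with \<open>J\<close>; conjugation by \<open>J\<close> then separates 1
  from \<open>I\<close>. Both separations divide by 2.\<close>

lemma quat_emb_0: "quat_emb x = 0 \<longleftrightarrow> x = (0, 0, 0, 0)"
proof
  assume z: "quat_emb x = 0"
  obtain x0 x1 x2 x3 where x: "x = (x0, x1, x2, x3)" by (cases x)
  have two: "(2 :: 'a) \<noteq> 0" using char2 by (rule two_neq_0)
  have half: "y0 = 0 \<and> y1 = 0" if "scal y0 + scal y1 * I = 0" for y0 y1
  proof -
    have "0 = J * (scal y0 + scal y1 * I) * J" by (simp add: that)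
    also have "\<dots> = scal b * (scal y0 - scal y1 * I)"
      by (simp add: algebra_simps quat_rules scal_commute[of "scal c" for c] scal_left_commute)
    finally have "scal y0 = scal y1 * I" using b by (simp add: scal_mult_eq_0_iff)
    with that have "scal y0 + scal y0 = 0" by simp
    then have "2 * y0 = 0" by (simp flip: scal_simps)
    then have "y0 = 0" using two by simp
    then have "scal y1 * I = 0" using that by (simp add: scal_simps)
    moreover have "I \<noteq> 0" using a quat_rules(1) by force
    ultimately show ?thesis using \<open>y0 = 0\<close> by (simp add: scal_mult_eq_0_iff)
  qed
  define P where "P = scal x0 + scal x1 * I"
  define Q where "Q = scal x2 + scal x3 * I"
  have e: "quat_emb x = P + Q * J" by (simp add: x quat_emb_def P_def Q_def algebra_simps)
  have "I * quat_emb x * I = scal a * (P - Q * J)"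
    by (simp add: e P_def Q_def algebra_simps quat_rules scal_commute[of "scal c" for c] scal_left_commute)
  then have "P = Q * J" using z a by (simp add: scal_mult_eq_0_iff)
  then have "P + P = 0" using z e by simp
  then have "scal 2 * P = 0" by (simp add: scal_def mat2_defs)
  then have "P = 0" using two by (simp add: scal_mult_eq_0_iff)
  then have "Q * J = 0" using \<open>P = Q * J\<close> by simp
  then have "Q * J * J = 0" by simp
  then have "scal b * Q = 0" by (simp add: mult.assoc quat_rules scal_commute)
  then have "Q = 0" using b by (simp add: scal_mult_eq_0_iff)
  show "x = (0, 0, 0, 0)" using half[of x0 x1] half[of x2 x3] \<open>P = 0\<close> \<open>Q = 0\<close>
    by (simp add: P_def Q_def x)
qed (simp add: quat_emb_def scal_simps)

lemma quat_emb_inj: "quat_emb x = quat_emb y \<Longrightarrow> x = y"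
proof -
  obtain x0 x1 x2 x3 y0 y1 y2 y3 where xy: "x = (x0, x1, x2, x3)" "y = (y0, y1, y2, y3)"
    by (cases x; cases y)
  assume "quat_emb x = quat_emb y"
  then have "quat_emb (x0 - y0, x1 - y1, x2 - y2, x3 - y3) = 0"
    by (simp add: xy quat_emb_def scal_simps algebra_simps)
  then show "x = y" using xy by (simp add: quat_emb_0)
qed

text \<open>A dimension count: four coordinates and a coefficient of \<open>M\<close> are five
  unknowns for four entry equations. Injectivity excludes the coefficient 0, so it can be divided
  out.\<close>

lemma quat_emb_surj: "\<exists>x. quat_emb x = M"
proof -
  define F where "F = (\<lambda>(i, j) x. mat2_entry (quat_emb (x 0, x 1, x 2, x 3) - scal (x (4::nat)) * M) i j)"
  have "\<exists>x. (\<exists>i. x i \<noteq> 0) \<and> (\<forall>i. i \<notin> {..<5} \<longrightarrow> x i = 0) \<and> (\<forall>j\<in>{..<2} \<times> {..<2}. F j x = 0)"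
  proof (rule underdetermined_system)
    show "linear_fun (F j)" for j
      by (cases j) (simp add: F_def linear_fun_def mat2_entry_def quat_emb_def mat2_defs scal_def algebra_simps)
  qed (auto simp: card_cartesian_product)
  then obtain x where x: "\<exists>i. x i \<noteq> 0" "\<forall>i. i \<notin> {..<5} \<longrightarrow> x i = 0"
    "\<forall>j\<in>{..<2} \<times> {..<2}. F j x = 0" by blast
  have "quat_emb (x 0, x 1, x 2, x 3) - scal (x 4) * M = 0"
    using x(3) by (intro mat2_entry_eqI) (auto simp: F_def mat2_entry_def zero_mat2_def)
  then have e: "quat_emb (x 0, x 1, x 2, x 3) = scal (x 4) * M" by simp
  have x4: "x 4 \<noteq> 0"
  proof
    assume "x 4 = 0"
    then have "quat_emb (x 0, x 1, x 2, x 3) = 0" using e by (simp add: scal_simps)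
    then have "x 0 = 0" "x 1 = 0" "x 2 = 0" "x 3 = 0" by (auto simp: quat_emb_0)
    moreover obtain i where "x i \<noteq> 0" "i < 5" using x(1,2) by auto
    moreover have "i \<in> {0, 1, 2, 3, 4}" using \<open>i < 5\<close> by auto
    ultimately show False using \<open>x 4 = 0\<close> by auto
  qed
  have "quat_emb (x 0 / x 4, x 1 / x 4, x 2 / x 4, x 3 / x 4)
      = scal (inverse (x 4)) * quat_emb (x 0, x 1, x 2, x 3)"
    by (simp add: quat_emb_def divide_inverse scal_mult algebra_simps
      scal_commute[of "scal c" for c] scal_left_commute)
  also have "\<dots> = M" unfolding e using x4 by (simp add: scal_simps flip: mult.assoc scal_mult)
  finally show ?thesis by blast
qed

text \<open>The sizes 1 and 2 witness Brauer equivalence: 1 by 1 matrices are the algebra itself,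
  and \<open>quat_emb\<close> identifies it with the 2 by 2 matrices over k.\<close>

lemma quat_pair_imp_trivial: "trivial_brauer_class (quaternion_alg a b)"
proof -
  let ?Q = "quaternion_alg a b"
  let ?M = "mat_alg 1 ?Q" and ?N = "mat_alg 2 (base_alg :: ('a, 'a) module)"
  interpret Q: ring ?Q by (rule ring_quaternion_alg)
  have carrier_Q: "carrier ?Q = UNIV" by (simp add: quaternion_alg_def)
  define h where "h A = (\<lambda>(i, j)\<in>{..<2} \<times> {..<2}. mat2_entry (quat_emb (A (0, 0))) i j)"
    for A :: "nat \<times> nat \<Rightarrow> 'a \<times> 'a \<times> 'a \<times> 'a"
  have hI: "h A = h B \<longleftrightarrow> A (0, 0) = B (0, 0)" for A B
  proof
    assume "h A = h B"
    have "quat_emb (A (0, 0)) = quat_emb (B (0, 0))"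
    proof (rule mat2_entry_eqI)
      fix i j :: nat assume "i < 2" "j < 2"
      then show "mat2_entry (quat_emb (A (0, 0))) i j = mat2_entry (quat_emb (B (0, 0))) i j"
        using fun_cong[OF \<open>h A = h B\<close>, of "(i, j)"] by (simp add: h_def)
    qed
    then show "A (0, 0) = B (0, 0)" by (rule quat_emb_inj)
  qed (simp add: h_def)
  have add: "quat_emb (x \<oplus>\<^bsub>?Q\<^esub> y) = quat_emb x + quat_emb y" for x y
    by (cases x; cases y) (simp add: quat_emb_def quaternion_alg_def scal_simps algebra_simps)
  have one: "quat_emb \<one>\<^bsub>?Q\<^esub> = 1"
    by (simp add: quat_emb_def quaternion_alg_def scal_simps)
  have smult: "quat_emb (c \<odot>\<^bsub>?Q\<^esub> x) = scal c * quat_emb x" for c x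
    by (cases x) (simp add: quat_emb_def quaternion_alg_def scal_mult algebra_simps
      scal_commute[of "scal c" for c] scal_left_commute)
  have hom: "h \<in> ring_hom ?M ?N"
  proof (rule ring_hom_memI)
    fix A B assume "A \<in> carrier ?M" "B \<in> carrier ?M"
    have "(A \<otimes>\<^bsub>?M\<^esub> B) (0, 0) = A (0, 0) \<otimes>\<^bsub>?Q\<^esub> B (0, 0)"
      by (simp add: mat_alg_def lessThan_Suc carrier_Q)
    then show "h (A \<otimes>\<^bsub>?M\<^esub> B) = h A \<otimes>\<^bsub>?N\<^esub> h B"
      by (auto simp: h_def quat_emb_mult mat2_entry_mult mat_alg_def finsum_base_alg base_alg_simps
          intro!: restrict_ext)
    have "(A \<oplus>\<^bsub>?M\<^esub> B) (0, 0) = A (0, 0) \<oplus>\<^bsub>?Q\<^esub> B (0, 0)"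
      by (simp add: mat_alg_def)
    then show "h (A \<oplus>\<^bsub>?M\<^esub> B) = h A \<oplus>\<^bsub>?N\<^esub> h B"
      by (auto simp: h_def add mat_alg_def base_alg_simps mat2_entry_def plus_mat2_def intro!: restrict_ext)
  next
    have "\<one>\<^bsub>?M\<^esub> (0, 0) = \<one>\<^bsub>?Q\<^esub>" by (simp add: mat_alg_def)
    then show "h \<one>\<^bsub>?M\<^esub> = \<one>\<^bsub>?N\<^esub>"
      by (auto simp: h_def one mat_alg_def base_alg_simps mat2_entry_def one_mat2_def intro!: restrict_ext)
  qed (auto simp: h_def mat_alg_def base_alg_simps)
  have bij: "bij_betw h (carrier ?M) (carrier ?N)"
  proof (rule bij_betw_imageI)
    show "inj_on h (carrier ?M)"
    proof (rule inj_onI)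
      fix A B assume AB: "A \<in> carrier ?M" "B \<in> carrier ?M" "h A = h B"
      have "A (0, 0) = B (0, 0)" using AB(3) hI by blast
      then show "A = B" using AB(1,2) by (intro PiE_ext[of A "{..<1} \<times> {..<1}"]) (auto simp: mat_alg_def)
    qed
    show "h ` carrier ?M = carrier ?N"
    proof
      show "h ` carrier ?M \<subseteq> carrier ?N"
        using ring_hom_closed[OF hom] by blast
      show "carrier ?N \<subseteq> h ` carrier ?M"
      proof
        fix C assume C: "C \<in> carrier ?N"
        obtain x where x: "quat_emb x = Mat2 (C (0, 0)) (C (0, 1)) (C (1, 0)) (C (1, 1))"
          using quat_emb_surj by blast
        have "h (\<lambda>_\<in>{..<1} \<times> {..<1}. x) = C"
        proof (rule PiE_ext)
          show "C \<in> {..<2} \<times> {..<2} \<rightarrow>\<^sub>E UNIV" using C by (simp add: mat_alg_def base_alg_simps)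
          fix p :: "nat \<times> nat" assume "p \<in> {..<2} \<times> {..<2}"
          then show "h (\<lambda>_\<in>{..<1} \<times> {..<1}. x) p = C p"
            by (auto simp: h_def x mat2_entry_def less_2_cases_iff)
        qed (auto simp: h_def)
        moreover have "(\<lambda>_\<in>{..<1} \<times> {..<1}. x) \<in> carrier ?M" by (auto simp: mat_alg_def carrier_Q)
        ultimately show "C \<in> h ` carrier ?M" by blast
      qed
    qed
  qed
  have "h (c \<odot>\<^bsub>?M\<^esub> A) = c \<odot>\<^bsub>?N\<^esub> h A" for c A
  proof -
    have "(c \<odot>\<^bsub>?M\<^esub> A) (0, 0) = c \<odot>\<^bsub>?Q\<^esub> A (0, 0)" by (simp add: mat_alg_def)
    then show ?thesis
      by (auto simp: h_def smult mat_alg_def base_alg_simps mat2_entry_def scal_def times_mat2_def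
          intro!: restrict_ext)
  qed
  with hom bij have "alg_isomorphic ?M ?N"
    unfolding alg_isomorphic_def ring_iso_def by blast
  then show ?thesis
    unfolding trivial_brauer_class_def brauer_equivalent_def
    by (intro exI[of _ 1] exI[of _ 2] conjI) auto
qed

end

text \<open>If a is a square, a diagonal and an antidiagonal matrix will do. Otherwise isotropy
  makes b a quotient of two norms from k(\<surd>a), hence the norm of some \<gamma> = c + d
  \<surd>a. In the basis 1, \<surd>a of this field, I is multiplication by \<surd>a, and J is
  conjugation followed by multiplication by \<gamma>.\<close>

lemma quat_pair_of_isotropic:
  fixes a b :: "'a::field"
  assumes a: "a \<noteq> 0" and b: "b \<noteq> 0"
    and nz: "\<not> (x0 = 0 \<and> x1 = 0 \<and> x2 = 0 \<and> x3 = 0)"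
    and N: "x0\<^sup>2 - a * x1\<^sup>2 - b * x2\<^sup>2 + a * b * x3\<^sup>2 = 0"
  shows "\<exists>I J. quat_pair a b I J"
proof (cases "\<exists>e. a = e\<^sup>2")
  case True
  then obtain e where "a = e\<^sup>2" by blast
  then have "quat_pair a b (Mat2 e 0 0 (- e)) (Mat2 0 b 1 0)"
    by (simp add: quat_pair_def mat2_defs scal_def power2_eq_square)
  then show ?thesis by blast
next
  case False
  define t where "t = x2\<^sup>2 - a * x3\<^sup>2"
  have Nt: "x0\<^sup>2 - a * x1\<^sup>2 = b * t" using N by (simp add: t_def algebra_simps)
  \<comment> \<open>\<open>t\<close> is the norm of x2 + x3 \<surd>a. As \<open>a\<close> is not a
    square, norm 0 means element 0, and then x0 + x1 \<surd>a has norm 0 as well.\<close>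
  have t: "t \<noteq> 0"
  proof
    assume "t = 0"
    have "x3 = 0"
    proof (rule ccontr)
      assume "x3 \<noteq> 0"
      then have "a = (x2 / x3)\<^sup>2" using \<open>t = 0\<close> by (simp add: t_def field_simps)
      then show False using False by blast
    qed
    moreover from this have "x2 = 0" using \<open>t = 0\<close> by (simp add: t_def)
    moreover have "x1 = 0"
    proof (rule ccontr)
      assume "x1 \<noteq> 0"
      then have "a = (x0 / x1)\<^sup>2" using Nt \<open>t = 0\<close> by (simp add: field_simps)
      then show False using False by blast
    qed
    moreover from this have "x0 = 0" using Nt \<open>t = 0\<close> by simp
    ultimately show False using nz by simp
  qed
  \<comment> \<open>c + d \<surd>a is (x0 + x1 \<surd>a) (x2 + x3 \<surd>a) / t, that is, x0 + x1
    \<surd>a divided by the conjugate of x2 + x3 \<surd>a.\<close>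
  define c where "c = (x0 * x2 + a * x1 * x3) / t"
  define d where "d = (x0 * x3 + x1 * x2) / t"
  have "c\<^sup>2 - a * d\<^sup>2 = ((x0 * x2 + a * x1 * x3)\<^sup>2 - a * (x0 * x3 + x1 * x2)\<^sup>2) / t\<^sup>2"
    by (simp add: c_def d_def power_divide diff_divide_distrib)
  also have "(x0 * x2 + a * x1 * x3)\<^sup>2 - a * (x0 * x3 + x1 * x2)\<^sup>2 = (x0\<^sup>2 - a * x1\<^sup>2) * t"
    by (simp add: t_def power2_eq_square algebra_simps)
  also have "\<dots> / t\<^sup>2 = b" using t unfolding Nt by (simp add: power2_eq_square)
  finally have "c\<^sup>2 - a * d\<^sup>2 = b" .
  then have bcd: "b = c * c - a * d * d" by (auto simp: power2_eq_square mult.assoc)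
  have "quat_pair a b (Mat2 0 a 1 0) (Mat2 c (- a * d) d (- c))"
    by (simp add: quat_pair_def mat2_defs scal_def bcd algebra_simps)
  then show ?thesis by blast
qed

section \<open>A trivial class forces an isotropic norm form\<close>

definition quat_norm :: "'a::field \<Rightarrow> 'a \<Rightarrow> 'a \<times> 'a \<times> 'a \<times> 'a \<Rightarrow> 'a" where
  "quat_norm a b = (\<lambda>(x0, x1, x2, x3). x0\<^sup>2 - a * x1\<^sup>2 - b * x2\<^sup>2 + a * b * x3\<^sup>2)"

text \<open>The product of the conjugate of \<open>x\<close> with \<open>x\<close> is
  \<open>quat_norm\<close>, so multiplying x y = 0 by the conjugate from the left leaves the norm of
  \<open>x\<close> times \<open>y\<close>.\<close>

lemma quat_no_zero_divisors:
  assumes aniso: "\<And>x. quat_norm a b x = 0 \<Longrightarrow> x = (0, 0, 0, 0)"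
    and z: "x \<otimes>\<^bsub>quaternion_alg a b\<^esub> y = (0, 0, 0, 0)" and y: "y \<noteq> (0, 0, 0, 0)"
  shows "x = (0, 0, 0, 0)"
proof (rule aniso, rule ccontr)
  obtain x0 x1 x2 x3 y0 y1 y2 y3 where xy: "x = (x0, x1, x2, x3)" "y = (y0, y1, y2, y3)"
    by (cases x; cases y)
  assume N: "quat_norm a b x \<noteq> 0"
  let ?e0 = "x0 * y0 + a * x1 * y1 + b * x2 * y2 - a * b * x3 * y3"
  let ?e1 = "x0 * y1 + x1 * y0 - b * x2 * y3 + b * x3 * y2"
  let ?e2 = "x0 * y2 + x2 * y0 + a * x1 * y3 - a * x3 * y1"
  let ?e3 = "x0 * y3 + x3 * y0 + x1 * y2 - x2 * y1"
  have e: "?e0 = 0" "?e1 = 0" "?e2 = 0" "?e3 = 0"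
    using z by (simp_all add: xy quaternion_alg_def)
  \<comment> \<open>The right-hand sides are the coordinates of the conjugate of \<open>x\<close>
    times the product x y.\<close>
  have "quat_norm a b x * y0 = x0 * ?e0 - a * x1 * ?e1 - b * x2 * ?e2 + a * b * x3 * ?e3"
    "quat_norm a b x * y1 = x0 * ?e1 - x1 * ?e0 + b * x2 * ?e3 - b * x3 * ?e2"
    "quat_norm a b x * y2 = x0 * ?e2 - x2 * ?e0 - a * x1 * ?e3 + a * x3 * ?e1"
    "quat_norm a b x * y3 = x0 * ?e3 - x3 * ?e0 - x1 * ?e2 + x2 * ?e1"
    by (simp_all add: xy quat_norm_def power2_eq_square algebra_simps)
  then have "y = (0, 0, 0, 0)" using N unfolding e xy by simp
  with y show False by blast
qed

definition quat_coord :: "nat \<Rightarrow> 'a \<times> 'a \<times> 'a \<times> 'a \<Rightarrow> 'a" where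
  "quat_coord s = (\<lambda>(x0, x1, x2, x3). if s = 0 then x0 else if s = 1 then x1 else if s = 2 then x2 else x3)"

lemma quat_coord_eqI:
  assumes "\<And>s. s < 4 \<Longrightarrow> quat_coord s x = quat_coord s y"
  shows "x = y"
  using assms[of 0] assms[of 1] assms[of 2] assms[of 3]
  by (cases x; cases y) (simp add: quat_coord_def)

lemma quat_coord_linear:
  "quat_coord s (x \<oplus>\<^bsub>quaternion_alg a b\<^esub> y) = quat_coord s x + quat_coord s y"
  "quat_coord s (c \<odot>\<^bsub>quaternion_alg a b\<^esub> x) = c * quat_coord s x"
  "quat_coord s (0, 0, 0, 0) = 0"
  by (cases x; cases y; simp add: quat_coord_def quaternion_alg_def)+

text \<open>If the norm form is anisotropic, then left multiplication by the matrices supported on one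
  column embeds a space of dimension \<open>4 * m\<close> in a column of the matrix algebra of size \<open>n\<close>.
  This contradicts \<open>n ^ 2 = 4 * m ^ 2\<close>.\<close>
lemma trivial_imp_isotropic:
  fixes a b :: "'a::field"
  assumes "trivial_brauer_class (quaternion_alg a b)"
  shows "\<exists>x. quat_norm a b x = 0 \<and> x \<noteq> (0, 0, 0, 0)"
proof (rule ccontr)
  assume "\<not> ?thesis"
  then have aniso: "quat_norm a b x = 0 \<Longrightarrow> x = (0, 0, 0, 0)" for x by blast
  let ?Q = "quaternion_alg a b"
  interpret Q: ring ?Q by (rule ring_quaternion_alg)
  have carrier_Q: "carrier ?Q = UNIV" and zero_Q: "\<zero>\<^bsub>?Q\<^esub> = (0, 0, 0, 0)"
    by (simp_all add: quaternion_alg_def)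
  obtain m n h where m: "m > 0" and
    h: "h \<in> ring_iso (mat_alg m ?Q) (mat_alg n (base_alg :: ('a, 'a) module))" and
    smult: "\<And>c A. A \<in> carrier (mat_alg m ?Q) \<Longrightarrow>
      h (c \<odot>\<^bsub>mat_alg m ?Q\<^esub> A) = c \<odot>\<^bsub>mat_alg n (base_alg :: ('a, 'a) module)\<^esub> h A"
    using assms unfolding trivial_brauer_class_def brauer_equivalent_def alg_isomorphic_def by blast
  define M where "M = mat_alg m ?Q"
  define N where "N = mat_alg n (base_alg :: ('a, 'a) module)"
  have bij: "bij_betw h (carrier M) (carrier N)" and hom: "h \<in> ring_hom M N"
    using h by (auto simp: M_def N_def ring_iso_def)
  have carrier_M: "carrier M = {..<m} \<times> {..<m} \<rightarrow>\<^sub>E UNIV" by (simp add: M_def mat_alg_def carrier_Q)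
  have carrier_N: "carrier N = {..<n} \<times> {..<n} \<rightarrow>\<^sub>E UNIV" by (simp add: N_def mat_alg_def base_alg_simps)
  have addM: "A \<oplus>\<^bsub>M\<^esub> B = (\<lambda>p\<in>{..<m} \<times> {..<m}. A p \<oplus>\<^bsub>?Q\<^esub> B p)" for A B
    by (simp add: M_def mat_alg_def)
  have smultM: "c \<odot>\<^bsub>M\<^esub> A = (\<lambda>p\<in>{..<m} \<times> {..<m}. c \<odot>\<^bsub>?Q\<^esub> A p)" for c A
    by (simp add: M_def mat_alg_def)
  have addN: "A \<oplus>\<^bsub>N\<^esub> B = (\<lambda>p\<in>{..<n} \<times> {..<n}. A p + B p)" for A B
    by (simp add: N_def mat_alg_def base_alg_simps)
  have smultN: "c \<odot>\<^bsub>N\<^esub> A = (\<lambda>p\<in>{..<n} \<times> {..<n}. c * A p)" for c A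
    by (simp add: N_def mat_alg_def base_alg_simps)
  have h_closed: "h A \<in> carrier N" if "A \<in> carrier M" for A
    using ring_hom_closed[OF hom that] .
  have h_add: "h (A \<oplus>\<^bsub>M\<^esub> B) = h A \<oplus>\<^bsub>N\<^esub> h B" if "A \<in> carrier M" "B \<in> carrier M" for A B
    using ring_hom_add[OF hom that] .
  have h_mult: "h (A \<otimes>\<^bsub>M\<^esub> B) = h A \<otimes>\<^bsub>N\<^esub> h B" if "A \<in> carrier M" "B \<in> carrier M" for A B
    using ring_hom_mult[OF hom that] .
  have h_smult: "h (c \<odot>\<^bsub>M\<^esub> A) = c \<odot>\<^bsub>N\<^esub> h A" if "A \<in> carrier M" for c A
    using smult that by (simp add: M_def N_def)
  have h_inj: "A = B" if "h A = h B" "A \<in> carrier M" "B \<in> carrier M" for A B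
    using bij that by (auto simp: bij_betw_def inj_on_def)
  define g where "g = inv_into (carrier M) h"
  have g_closed: "g C \<in> carrier M" and hg: "h (g C) = C" if "C \<in> carrier N" for C
    using bij_betw_inv_into_right[OF bij that] inv_into_into[of C h "carrier M"] that
      bij_betw_imp_surj_on[OF bij] by (simp_all add: g_def)
  have addM_closed: "A \<oplus>\<^bsub>M\<^esub> B \<in> carrier M" and smultM_closed: "c \<odot>\<^bsub>M\<^esub> A \<in> carrier M" for A B c
    by (auto simp: addM smultM carrier_M)
  have addN_closed: "A \<oplus>\<^bsub>N\<^esub> B \<in> carrier N" and smultN_closed: "c \<odot>\<^bsub>N\<^esub> A \<in> carrier N" for A B c
    by (auto simp: addN smultN carrier_N)
  have g_add: "g (A \<oplus>\<^bsub>N\<^esub> B) = g A \<oplus>\<^bsub>M\<^esub> g B" if "A \<in> carrier N" "B \<in> carrier N" for A B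
    using that by (intro h_inj) (simp_all add: h_add hg g_closed addM_closed addN_closed)
  have g_smult: "g (c \<odot>\<^bsub>N\<^esub> A) = c \<odot>\<^bsub>M\<^esub> g A" if "A \<in> carrier N" for A c
    using that by (intro h_inj) (simp_all add: h_smult hg g_closed smultM_closed smultN_closed)
  \<comment> \<open>Zero is reached as 0 times \<open>A\<close>, so the argument rests on the
    injectivity of \<open>h\<close> and its compatibility with scalars.\<close>
  have h_zero: "A = (\<lambda>_\<in>{..<m} \<times> {..<m}. (0, 0, 0, 0))"
    if "A \<in> carrier M" "\<And>p. p \<in> {..<n} \<times> {..<n} \<Longrightarrow> h A p = 0" for A
  proof -
    have "h A \<in> {..<n} \<times> {..<n} \<rightarrow>\<^sub>E UNIV" using h_closed[OF that(1)] by (simp add: carrier_N)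
    then have "h A p = (0 \<odot>\<^bsub>N\<^esub> h A) p" for p
      using that(2)[of p] PiE_arb[of "h A" "{..<n} \<times> {..<n}" _ p] unfolding smultN
      by (cases "p \<in> {..<n} \<times> {..<n}") (simp_all del: mem_Sigma_iff)
    then have "h A = 0 \<odot>\<^bsub>N\<^esub> h A" by (rule ext)
    then have "A = 0 \<odot>\<^bsub>M\<^esub> A" using that(1) by (intro h_inj) (simp_all add: h_smult smultM_closed)
    moreover have "0 \<odot>\<^bsub>?Q\<^esub> x = (0, 0, 0, 0)" for x by (cases x) (simp add: quaternion_alg_def)
    ultimately show ?thesis by (simp add: smultM)
  qed
  \<comment> \<open>Were n^2 larger than 4 m^2, the linear map \<open>g\<close> would kill a nonzero
    matrix, against \<open>hg\<close>.\<close>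
  have "n * n \<le> m * m * 4"
  proof (rule ccontr)
    assume less: "\<not> n * n \<le> m * m * 4"
    define F where "F = (\<lambda>(p, s) x. quat_coord s (g (restrict x ({..<n} \<times> {..<n})) p))"
    let ?B = "({..<m} \<times> {..<m}) \<times> {..<4::nat}"
    have "\<exists>x. (\<exists>i. x i \<noteq> 0) \<and> (\<forall>i. i \<notin> {..<n} \<times> {..<n} \<longrightarrow> x i = 0) \<and> (\<forall>j\<in>?B. F j x = 0)"
    proof (rule underdetermined_system)
      show "card ?B < card ({..<n} \<times> {..<n})" using less by (simp add: card_cartesian_product)
      fix j assume "j \<in> ?B"
      then obtain p s where j: "j = (p, s)" "p \<in> {..<m} \<times> {..<m}" by blast
      show "linear_fun (F j)"
        unfolding linear_fun_def
      proof (intro conjI allI)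
        fix x y :: "nat \<times> nat \<Rightarrow> 'a" and c
        let ?r = "\<lambda>x. restrict x ({..<n} \<times> {..<n}) :: nat \<times> nat \<Rightarrow> 'a"
        have r: "?r x \<in> carrier N" for x by (simp add: carrier_N)
        have "?r (\<lambda>i. x i + y i) = ?r x \<oplus>\<^bsub>N\<^esub> ?r y" by (auto simp: addN fun_eq_iff)
        then show "F j (\<lambda>i. x i + y i) = F j x + F j y"
          using j(2) by (simp add: F_def j(1) g_add[OF r r] addM quat_coord_linear)
        have "?r (\<lambda>i. c * x i) = c \<odot>\<^bsub>N\<^esub> ?r x" by (auto simp: smultN fun_eq_iff)
        then show "F j (\<lambda>i. c * x i) = c * F j x"
          using j(2) by (simp add: F_def j(1) g_smult[OF r] smultM quat_coord_linear)
      qed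
    qed auto
    then obtain x i where x: "x i \<noteq> 0" "\<forall>i. i \<notin> {..<n} \<times> {..<n} \<longrightarrow> x i = 0" "\<forall>j\<in>?B. F j x = 0"
      by blast
    let ?x = "restrict x ({..<n} \<times> {..<n})"
    have xN: "?x \<in> carrier N" by (simp add: carrier_N)
    have gx0: "g ?x p = (0, 0, 0, 0)" if "p \<in> {..<m} \<times> {..<m}" for p
      using x(3) that by (intro quat_coord_eqI) (force simp: F_def quat_coord_linear)
    have "g ?x \<in> {..<m} \<times> {..<m} \<rightarrow>\<^sub>E UNIV" using g_closed[OF xN] by (simp add: carrier_M)
    then have "g ?x p = (0 \<odot>\<^bsub>M\<^esub> g ?x) p" for p
      using gx0[of p] PiE_arb[of "g ?x" "{..<m} \<times> {..<m}" _ p] unfolding smultM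
      by (cases "p \<in> {..<m} \<times> {..<m}") (simp_all add: quaternion_alg_def del: mem_Sigma_iff)
    then have "g ?x = 0 \<odot>\<^bsub>M\<^esub> g ?x" by (rule ext)
    then have "?x = 0 \<odot>\<^bsub>N\<^esub> ?x" using hg[OF xN] h_smult[OF g_closed[OF xN], of 0] by simp
    then have "?x i = (0 \<odot>\<^bsub>N\<^esub> ?x) i" by (rule fun_cong)
    moreover have "i \<in> {..<n} \<times> {..<n}" using x(1,2) by blast
    ultimately show False using x(1) by (simp add: smultN)
  qed
  moreover have "4 * m \<le> n"
  proof (rule ccontr)
    assume less: "\<not> 4 * m \<le> n"
    \<comment> \<open>The matrix unit below needs the index 0. Size 0 would make the target the zero
      ring, although m > 0.\<close>
    have n: "n > 0"
    proof (rule ccontr)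
      assume "\<not> n > 0"
      let ?A = "\<lambda>_\<in>{..<m} \<times> {..<m}. (1, 0, 0, 0) :: 'a \<times> 'a \<times> 'a \<times> 'a"
      have "?A = (\<lambda>_\<in>{..<m} \<times> {..<m}. (0, 0, 0, 0))"
        using \<open>\<not> n > 0\<close> by (intro h_zero) (auto simp: carrier_M)
      then show False using m by (auto dest!: fun_cong[of _ _ "(0, 0)"])
    qed
    \<comment> \<open>Right multiplication by the matrix unit \<open>E\<close> keeps column 0 only.
      With \<open>f\<close> the preimage of \<open>E\<close>, the product of \<open>S x\<close> and
      \<open>f\<close> vanishes as soon as the n entries in column 0 of \<open>h (S x)\<close>
      do.\<close>
    define E where "E = (\<lambda>(i, j)\<in>{..<n} \<times> {..<n}. if i = 0 \<and> j = 0 then 1 else 0 :: 'a)"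
    have EN: "E \<in> carrier N" by (simp add: E_def carrier_N)
    define f where "f = g E"
    have fM: "f \<in> carrier M" and hf: "h f = E" using g_closed[OF EN] hg[OF EN] by (simp_all add: f_def)
    have "\<exists>i0 j0. i0 < m \<and> j0 < m \<and> f (i0, j0) \<noteq> (0, 0, 0, 0)"
    proof (rule ccontr)
      assume nex: "\<not> ?thesis"
      have "f \<in> {..<m} \<times> {..<m} \<rightarrow>\<^sub>E UNIV" using fM by (simp add: carrier_M)
      then have "f p = (0 \<odot>\<^bsub>M\<^esub> f) p" for p
        using nex PiE_arb[of f "{..<m} \<times> {..<m}" _ p] unfolding smultM
        by (cases "p \<in> {..<m} \<times> {..<m}") (auto simp: quaternion_alg_def simp del: mem_Sigma_iff)
      then have "f = 0 \<odot>\<^bsub>M\<^esub> f" by (rule ext)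
      then have "E = 0 \<odot>\<^bsub>N\<^esub> E" using hf h_smult[OF fM, of 0] by simp
      then have "E (0, 0) = (0 \<odot>\<^bsub>N\<^esub> E) (0, 0)" by (rule fun_cong)
      then show False using n by (simp add: smultN E_def)
    qed
    then obtain i0 j0 where ij: "i0 < m" "j0 < m" "f (i0, j0) \<noteq> (0, 0, 0, 0)" by blast
    \<comment> \<open>\<open>f\<close> has a nonzero entry at (i0, j0). With \<open>S x\<close>
      supported on column i0, each entry in column j0 of the product with \<open>f\<close> is a
      single product of quaternions.\<close>
    define S where "S x = (\<lambda>(i, l)\<in>{..<m} \<times> {..<m}.
      if l = i0 then (x (i, 0), x (i, 1), x (i, 2), x (i, 3)) else (0, 0, 0, 0))"
      for x :: "nat \<times> nat \<Rightarrow> 'a"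
    have SM: "S x \<in> carrier M" for x by (simp add: S_def carrier_M)
    have S_add: "S (\<lambda>i. x i + y i) = S x \<oplus>\<^bsub>M\<^esub> S y" for x y
      by (auto simp: S_def addM quaternion_alg_def fun_eq_iff)
    have S_smult: "S (\<lambda>i. c * x i) = c \<odot>\<^bsub>M\<^esub> S x" for c x
      by (auto simp: S_def smultM quaternion_alg_def fun_eq_iff)
    have multN: "(A \<otimes>\<^bsub>N\<^esub> E) (i, j) = (if j = 0 then A (i, 0) else 0)" if "i < n" "j < n" for A i j
    proof -
      have "(A \<otimes>\<^bsub>N\<^esub> E) (i, j) = (\<Sum>l<n. A (i, l) * E (l, j))"
        using that by (simp add: N_def mat_alg_def finsum_base_alg base_alg_simps)
      also have "\<dots> = (\<Sum>l<n. if l = 0 then (if j = 0 then A (i, 0) else 0) else 0)"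
        using that by (intro sum.cong) (auto simp: E_def)
      finally show ?thesis using n by simp
    qed
    define F where "F j x = h (S x) (j, 0)" for j x
    have "\<exists>x. (\<exists>i. x i \<noteq> 0) \<and> (\<forall>i. i \<notin> {..<m} \<times> {..<4} \<longrightarrow> x i = 0) \<and> (\<forall>j\<in>{..<n}. F j x = 0)"
    proof (rule underdetermined_system)
      show "card {..<n} < card ({..<m} \<times> {..<4::nat})" using less by (simp add: card_cartesian_product)
      fix j assume "j \<in> {..<n}"
      then show "linear_fun (F j)"
        using n unfolding linear_fun_def F_def S_add S_smult h_add[OF SM SM] h_smult[OF SM]
        by (simp add: addN smultN)
    qed auto
    then obtain x i s where x: "x (i, s) \<noteq> 0" "\<forall>i. i \<notin> {..<m} \<times> {..<4} \<longrightarrow> x i = 0" "\<forall>j\<in>{..<n}. F j x = 0"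
      by auto
    have isb: "i < m" "s < 4" using x(1,2) by auto
    have multM: "(S x \<otimes>\<^bsub>M\<^esub> f) (i, j0) = (x (i, 0), x (i, 1), x (i, 2), x (i, 3)) \<otimes>\<^bsub>?Q\<^esub> f (i0, j0)"
    proof -
      have "(S x \<otimes>\<^bsub>M\<^esub> f) (i, j0) = (\<Oplus>\<^bsub>?Q\<^esub>l\<in>{..<m}. S x (i, l) \<otimes>\<^bsub>?Q\<^esub> f (l, j0))"
        using isb ij by (simp add: M_def mat_alg_def)
      also have "\<dots> = (\<Oplus>\<^bsub>?Q\<^esub>l\<in>{..<m}. if i0 = l then S x (i, i0) \<otimes>\<^bsub>?Q\<^esub> f (i0, j0) else \<zero>\<^bsub>?Q\<^esub>)"
        using isb by (intro Q.finsum_cong') (auto simp: carrier_Q S_def zero_Q quaternion_alg_def split: prod.splits)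
      also have "\<dots> = S x (i, i0) \<otimes>\<^bsub>?Q\<^esub> f (i0, j0)"
        using ij by (intro Q.finsum_singleton) (auto simp: carrier_Q)
      finally show ?thesis using isb ij by (simp add: S_def)
    qed
    have closed: "S x \<otimes>\<^bsub>M\<^esub> f \<in> carrier M"
      by (simp add: M_def mat_alg_def carrier_Q)
    have "S x \<otimes>\<^bsub>M\<^esub> f = (\<lambda>_\<in>{..<m} \<times> {..<m}. (0, 0, 0, 0))"
    proof (rule h_zero[OF closed])
      fix p assume "p \<in> {..<n} \<times> {..<n}"
      then show "h (S x \<otimes>\<^bsub>M\<^esub> f) p = 0"
        using x(3) by (cases p) (auto simp: h_mult[OF SM fM] hf multN F_def)
    qed
    then have "(x (i, 0), x (i, 1), x (i, 2), x (i, 3)) \<otimes>\<^bsub>?Q\<^esub> f (i0, j0) = (0, 0, 0, 0)"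
      using multM isb ij by simp
    then have "(x (i, 0), x (i, 1), x (i, 2), x (i, 3)) = (0, 0, 0, 0)"
      using quat_no_zero_divisors[OF aniso] ij(3) by blast
    moreover have "s \<in> {0, 1, 2, 3}" using isb by auto
    ultimately show False using x(1) by auto
  qed
  \<comment> \<open>The two bounds combine to 16 m^2 \<le> n^2 \<le> 4 m^2.\<close>
  then have "(4 * m) * (4 * m) \<le> n * n" by (intro mult_mono) auto
  ultimately have "4 * m * (4 * m) \<le> m * m * 4" by linarith
  then show False using m by simp
qed

text \<open>A cycle of implications: triviality gives an isotropic vector, this gives a pair, and a
  pair gives triviality.\<close>

theorem trivial_quaternion_iff:
  fixes a b :: "'a::field"
  assumes "CHAR('a) \<noteq> 2" "a \<noteq> 0" "b \<noteq> 0"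
  shows "trivial_brauer_class (quaternion_alg a b) \<longleftrightarrow> (\<exists>I J. quat_pair a b I J)"
proof
  assume "trivial_brauer_class (quaternion_alg a b)"
  then obtain x where "quat_norm a b x = 0" "x \<noteq> (0, 0, 0, 0)" using trivial_imp_isotropic by blast
  then show "\<exists>I J. quat_pair a b I J"
    using quat_pair_of_isotropic[OF assms(2,3)] by (cases x) (auto simp: quat_norm_def)
qed (use quat_pair_imp_trivial[OF assms] in blast)

subsection \<open>The Galois correspondence\<close>

lemma ring_of_type_algebra_simps:
  "carrier ring_of_type_algebra = UNIV" "x \<otimes>\<^bsub>ring_of_type_algebra\<^esub> y = x * y"
  "x \<oplus>\<^bsub>ring_of_type_algebra\<^esub> y = x + y" "\<one>\<^bsub>ring_of_type_algebra\<^esub> = 1"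
  "\<zero>\<^bsub>ring_of_type_algebra\<^esub> = 0"
  by (simp_all add: ring_of_type_algebra_def)

lemma abs_gal_iff:
  "\<sigma> \<in> carrier abs_gal \<longleftrightarrow> bij \<sigma> \<and> (\<forall>x y. \<sigma> (x + y) = \<sigma> x + \<sigma> y) \<and>
     (\<forall>x y. \<sigma> (x * y) = \<sigma> x * \<sigma> y) \<and> (\<forall>c. \<sigma> (to_ac c) = to_ac c)"
  (is "?L \<longleftrightarrow> ?R")
proof
  show "?L \<Longrightarrow> ?R"
    by (auto simp: abs_gal_def ring_iso_def ring_hom_def ring_of_type_algebra_def)
  assume R: ?R
  then have "\<sigma> 1 = 1" by (metis to_ac_1)
  with R show ?L
    by (auto simp: abs_gal_def ring_iso_def ring_hom_def ring_of_type_algebra_def)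
qed

context
  fixes \<sigma> :: "'a::field alg_closure \<Rightarrow> 'a alg_closure"
  assumes \<sigma>: "\<sigma> \<in> carrier abs_gal"
begin

lemma gal_bij: "bij \<sigma>"
  and gal_add: "\<sigma> (x + y) = \<sigma> x + \<sigma> y"
  and gal_mult: "\<sigma> (x * y) = \<sigma> x * \<sigma> y"
  and gal_to_ac: "\<sigma> (to_ac c) = to_ac c"
  using \<sigma> by (auto simp: abs_gal_iff)

lemma gal_0: "\<sigma> 0 = 0" and gal_1: "\<sigma> 1 = 1"
  using gal_to_ac[of 0] gal_to_ac[of 1] by simp_all

lemma gal_eq_0_iff: "\<sigma> x = 0 \<longleftrightarrow> x = 0"
  using gal_bij gal_0 by (metis bij_pointE)

lemma gal_uminus: "\<sigma> (- x) = - \<sigma> x"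
  using gal_add[of x "- x"] gal_0 by (simp add: eq_neg_iff_add_eq_0 add.commute)

lemma gal_diff: "\<sigma> (x - y) = \<sigma> x - \<sigma> y"
  using gal_add[of x "- y"] gal_uminus by simp

lemma gal_inverse: "\<sigma> (inverse x) = inverse (\<sigma> x)"
proof (cases "x = 0")
  case False
  then have "\<sigma> x * \<sigma> (inverse x) = 1" by (simp add: gal_1 flip: gal_mult)
  then show ?thesis by (rule inverse_unique[symmetric])
qed (simp add: gal_0)

lemma gal_divide: "\<sigma> (x / y) = \<sigma> x / \<sigma> y"
  by (simp add: divide_inverse gal_mult gal_inverse)

lemma gal_sum: "\<sigma> (\<Sum>i\<in>C. f i) = (\<Sum>i\<in>C. \<sigma> (f i))"
  by (induction C rule: infinite_finite_induct) (auto simp: gal_0 gal_add)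

lemma gal_poly: "\<sigma> (poly (map_poly to_ac p) x) = poly (map_poly to_ac p) (\<sigma> x)"
  by (induction p) (auto simp: map_poly_pCons gal_0 gal_add gal_mult gal_to_ac)

end

lemma gal_comp:
  assumes "\<sigma> \<in> carrier abs_gal" "\<tau> \<in> carrier abs_gal"
  shows "\<sigma> \<circ> \<tau> \<in> carrier abs_gal"
  using assms by (auto simp: abs_gal_iff intro: bij_comp)

lemma gal_inv:
  assumes "\<sigma> \<in> carrier abs_gal"
  shows "inv_into UNIV \<sigma> \<in> carrier abs_gal"
proof -
  have s: "surj \<sigma>" and i: "inj \<sigma>" using gal_bij[OF assms] by (auto simp: bij_def)
  have "inv_into UNIV \<sigma> (x + y) = inv_into UNIV \<sigma> x + inv_into UNIV \<sigma> y" for x y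
    using gal_add[OF assms] s i by (metis inv_f_f surj_f_inv_f)
  moreover have "inv_into UNIV \<sigma> (x * y) = inv_into UNIV \<sigma> x * inv_into UNIV \<sigma> y" for x y
    using gal_mult[OF assms] s i by (metis inv_f_f surj_f_inv_f)
  moreover have "inv_into UNIV \<sigma> (to_ac x) = to_ac x" for x
    using gal_to_ac[OF assms] i by (metis inv_f_f)
  ultimately show ?thesis using gal_bij[OF assms] by (auto simp: abs_gal_iff bij_imp_bij_inv)
qed

text \<open>Dedekind's argument. The characters are functions on the whole field but multiplicative
  on \<open>L\<close> only, hence the hypothesis that distinct ones differ at a point of
  \<open>L\<close>.\<close>

lemma characters_independent:
  fixes C :: "('b::field \<Rightarrow> 'b) set"
  assumes "finite C"
    and L: "1 \<in> L" "\<And>x y. x \<in> L \<Longrightarrow> y \<in> L \<Longrightarrow> x * y \<in> L"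
    and "\<And>f. f \<in> C \<Longrightarrow> f 1 = 1"
    and "\<And>f x y. f \<in> C \<Longrightarrow> x \<in> L \<Longrightarrow> y \<in> L \<Longrightarrow> f (x * y) = f x * f y"
    and "\<And>f g. f \<in> C \<Longrightarrow> g \<in> C \<Longrightarrow> f \<noteq> g \<Longrightarrow> \<exists>x\<in>L. f x \<noteq> g x"
    and "\<And>x. x \<in> L \<Longrightarrow> (\<Sum>f\<in>C. c f * f x) = 0"
    and "f \<in> C"
  shows "c f = 0"
  using assms(1,4-)
proof (induction C arbitrary: c f)
  case (insert g C)
  have z: "(\<Sum>f\<in>C. c f * f x) + c g * g x = 0" if "x \<in> L" for x
    using insert.prems(4)[OF that] insert.hyps by (simp add: add.commute)
  have "c f = 0" if f: "f \<in> C" for f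
  proof -
    have "f \<noteq> g" using f insert.hyps by auto
    then obtain y where y: "y \<in> L" "f y \<noteq> g y"
      using insert.prems(3)[of f g] f by auto
    \<comment> \<open>Subtracting \<open>g y\<close> times the relation at \<open>x\<close> from the
      relation at \<open>y * x\<close> cancels \<open>g\<close> and leaves a relation with these
      coefficients.\<close>
    have "c f * (f y - g y) = 0"
    proof (rule insert.IH[where c = "\<lambda>f. c f * (f y - g y)" and f = f])
      fix x assume x: "x \<in> L"
      have "(\<Sum>f\<in>C. c f * (f y - g y) * f x)
          = (\<Sum>f\<in>C. c f * f (y * x)) - g y * (\<Sum>f\<in>C. c f * f x)"
        unfolding sum_distrib_left sum_subtractf[symmetric] using x y insert.prems(2)
        by (intro sum.cong) (auto simp: algebra_simps)
      also have "\<dots> = - (c g * g (y * x)) + g y * (c g * g x)"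
      proof -
        have "(\<Sum>f\<in>C. c f * f (y * x)) = - (c g * g (y * x))" "(\<Sum>f\<in>C. c f * f x) = - (c g * g x)"
          using z[OF x] z[OF L(2)[OF y(1) x]] by (simp_all add: eq_neg_iff_add_eq_0)
        then show ?thesis by simp
      qed
      also have "\<dots> = 0" using insert.prems(2)[of g y x] x y by simp
      finally show "(\<Sum>f\<in>C. c f * (f y - g y) * f x) = 0" .
    next
      show "\<And>h. h \<in> C \<Longrightarrow> h 1 = 1" "\<And>h x y. h \<in> C \<Longrightarrow> x \<in> L \<Longrightarrow> y \<in> L \<Longrightarrow> h (x * y) = h x * h y"
        "\<And>h g. h \<in> C \<Longrightarrow> g \<in> C \<Longrightarrow> h \<noteq> g \<Longrightarrow> \<exists>x\<in>L. h x \<noteq> g x"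
        using insert.prems(1,2,3) by (meson insertI2)+
    qed (rule f)
    then show ?thesis using y by simp
  qed
  note cC = this
  have "c g = 0" using z[OF L(1)] insert.prems(1)[of g] cC by simp
  show ?case
  proof (cases "f = g")
    case False
    then have "f \<in> C" using insert.prems(5) by blast
    then show ?thesis by (rule cC)
  qed (simp add: \<open>c g = 0\<close>)
next
  case empty
  from empty.prems(5) show ?case by (rule emptyE)
qed

text \<open>Automorphisms over k are linear, so on a line extension they are determined by their
  values on the smaller space and on \<open>v\<close>, and \<open>v\<close> can only go to a root of
  a fixed polynomial over k.\<close>

lemma finitely_many_gal_values:
  fixes E :: "'a::field alg_closure set"
  assumes "ring.dimension kbar n base_field E"
  shows "\<exists>F. finite F \<and> F \<subseteq> carrier abs_gal \<and> (\<forall>\<tau>\<in>carrier abs_gal. \<exists>\<tau>'\<in>F. \<forall>x\<in>E. \<tau> x = \<tau>' x)"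
proof -
  interpret K: ring "kbar :: 'a alg_closure ring" by (rule ring_from_type_algebra)
  show ?thesis using assms
  proof (induction n "base_field :: 'a alg_closure set" E rule: K.dimension.induct)
    case zero_dim
    have "id \<in> carrier (abs_gal :: ('a alg_closure \<Rightarrow> _) monoid)" by (simp add: abs_gal_iff)
    then show ?case
      by (intro exI[of _ "{id}"]) (auto simp: ring_of_type_algebra_def gal_0)
  next
    case (Suc_dim v E n)
    then obtain F where F: "finite F"
      "\<And>\<tau>. \<tau> \<in> carrier abs_gal \<Longrightarrow> \<exists>\<tau>'\<in>F. \<forall>x\<in>E. \<tau> x = \<tau>' x"
      by blast
    obtain p :: "'a poly" where p: "p \<noteq> 0" "poly (map_poly to_ac p) v = 0"
      using alg_closure_algebraic .
    define Ob where "Ob = {y. poly (map_poly to_ac p) y = 0}"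
    have Ob: "finite Ob" unfolding Ob_def by (rule poly_roots_finite) (use p in \<open>simp add: map_poly_eq_0_iff\<close>)
    define P where "P f y \<tau> \<longleftrightarrow> \<tau> \<in> carrier abs_gal \<and> (\<forall>x\<in>E. \<tau> x = f x) \<and> \<tau> v = y"
      for f y and \<tau> :: "'a alg_closure \<Rightarrow> 'a alg_closure"
    \<comment> \<open>One automorphism is chosen for each realised pair of a restriction to
      \<open>E\<close> and a root.\<close>
    define F' where "F' = (\<lambda>(f, y). SOME \<tau>. P f y \<tau>) ` {(f, y) \<in> F \<times> Ob. \<exists>\<tau>. P f y \<tau>}"
    have "finite F'" unfolding F'_def using F(1) Ob by (intro finite_imageI) (rule finite_subset[of _ "F \<times> Ob"], auto)
    moreover have "F' \<subseteq> carrier abs_gal"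
    proof
      fix \<tau> assume "\<tau> \<in> F'"
      then obtain f y where "\<tau> = (SOME \<tau>. P f y \<tau>)" "\<exists>\<tau>. P f y \<tau>" by (auto simp: F'_def)
      then have "P f y \<tau>" using someI_ex by metis
      then show "\<tau> \<in> carrier abs_gal" by (simp add: P_def)
    qed
    moreover have "\<exists>\<tau>'\<in>F'. \<forall>x\<in>K.line_extension base_field v E. \<tau> x = \<tau>' x"
      if t: "\<tau> \<in> carrier abs_gal" for \<tau>
    proof -
      obtain f where f: "f \<in> F" "\<forall>x\<in>E. \<tau> x = f x" using F(2)[OF t] by blast
      have "\<tau> v \<in> Ob" using gal_poly[OF t, of p v] p gal_0[OF t] by (simp add: Ob_def)
      have ex: "P f (\<tau> v) \<tau>" using f t by (simp add: P_def)
      define \<tau>' where "\<tau>' = (SOME \<tau>'. P f (\<tau> v) \<tau>')"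
      have \<tau>': "P f (\<tau> v) \<tau>'" unfolding \<tau>'_def by (rule someI[where P = "P f (\<tau> v)"]) (rule ex)
      have "\<tau>' \<in> F'" unfolding F'_def \<tau>'_def using f \<open>\<tau> v \<in> Ob\<close> ex by force
      moreover have "\<tau> x = \<tau>' x" if x: "x \<in> K.line_extension base_field v E" for x
      proof -
        obtain c e where ce: "x = to_ac c * v + e" "e \<in> E"
          using x by (auto simp: K.line_extension_def set_add_def' r_coset_def ring_of_type_algebra_simps)
        show ?thesis using \<tau>' t f ce by (simp add: P_def gal_add gal_mult gal_to_ac)
      qed
      ultimately show ?thesis by blast
    qed
    ultimately show ?case by blast
  qed
qed

text \<open>If \<sigma> lay outside \<open>N\<close>, the restrictions to \<open>L\<close> of
  \<open>N\<close> and of \<sigma> \<open>N\<close> would be disjoint finite sets of characters. The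
  sum over the first is a trace with values in \<open>fixed_field N\<close>, hence unchanged by
  \<sigma>; so both sums agree, against the independence of characters.\<close>

lemma gal_closed:
  fixes L :: "'a::field alg_closure set"
  assumes L: "finite_normal_ext L"
    and N: "N \<subseteq> carrier abs_gal" "id \<in> N" "\<And>\<tau> \<tau>'. \<tau> \<in> N \<Longrightarrow> \<tau>' \<in> N \<Longrightarrow> \<tau> \<circ> \<tau>' \<in> N"
      "\<And>\<tau>. \<tau> \<in> N \<Longrightarrow> inv_into UNIV \<tau> \<in> N"
    and fix_L: "\<And>\<tau>. \<tau> \<in> carrier abs_gal \<Longrightarrow> \<forall>x\<in>L. \<tau> x = x \<Longrightarrow> \<tau> \<in> N"
    and s: "\<sigma> \<in> carrier abs_gal" "\<And>x. x \<in> fixed_field N \<Longrightarrow> \<sigma> x = x"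
  shows "\<sigma> \<in> N"
proof (rule ccontr)
  assume "\<sigma> \<notin> N"
  interpret K: field "kbar :: 'a alg_closure ring" by (rule field_from_type_algebra)
  have L1: "1 \<in> L" and Lmult: "\<And>x y. x \<in> L \<Longrightarrow> y \<in> L \<Longrightarrow> x * y \<in> L"
    using L subringE(3,6)[OF subfieldE(1), of L kbar]
    by (simp_all add: finite_normal_ext_def ring_of_type_algebra_simps)
  obtain F where F: "finite F"
    "\<And>\<tau>. \<tau> \<in> carrier abs_gal \<Longrightarrow> \<exists>\<tau>'\<in>F. \<forall>x\<in>L. \<tau> x = \<tau>' x"
    using finitely_many_gal_values L by (metis K.finite_dimension_def finite_normal_ext_def)
  define C where "C = (\<lambda>\<tau>. restrict \<tau> L) ` N"
  have C_gal: "\<exists>\<tau>\<in>N. f = restrict \<tau> L" if "f \<in> C" for f using that by (auto simp: C_def)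
  have fin: "finite C"
  proof (rule finite_subset)
    show "C \<subseteq> (\<lambda>\<tau>. restrict \<tau> L) ` F"
    proof
      fix f assume "f \<in> C"
      then obtain \<tau> where t: "\<tau> \<in> N" "f = restrict \<tau> L" using C_gal by blast
      then obtain \<tau>' where "\<tau>' \<in> F" "\<forall>x\<in>L. \<tau> x = \<tau>' x" using F(2) N(1) by blast
      with t show "f \<in> (\<lambda>\<tau>. restrict \<tau> L) ` F" by (auto intro!: image_eqI[of _ _ \<tau>'] restrict_ext)
    qed
  qed (use F in simp)
  define m where "m \<tau> f = restrict (\<tau> \<circ> f) L" for \<tau> f :: "'a alg_closure \<Rightarrow> 'a alg_closure"
  have inj: "inj_on (m \<tau>) C" if "\<tau> \<in> carrier abs_gal" for \<tau>
  proof (rule inj_onI)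
    fix f g assume fg: "f \<in> C" "g \<in> C" "m \<tau> f = m \<tau> g"
    have "f x = g x" for x
    proof (cases "x \<in> L")
      case True
      then have "\<tau> (f x) = \<tau> (g x)" using fun_cong[OF fg(3), of x] by (simp add: m_def)
      then show ?thesis using gal_bij[OF that] by (auto simp: bij_def inj_def)
    qed (use C_gal[OF fg(1)] C_gal[OF fg(2)] in auto)
    then show "f = g" by auto
  qed
  have sum_m: "(\<Sum>f\<in>m \<tau> ` C. f x) = \<tau> (\<Sum>f\<in>C. f x)"
    if "\<tau> \<in> carrier abs_gal" "x \<in> L" for \<tau> x
    using that by (subst sum.reindex[OF inj]) (auto simp: gal_sum m_def)
  \<comment> \<open>Left translation by an element of \<open>N\<close> maps the finite set
    \<open>C\<close> injectively to itself, so it permutes the summands.\<close>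
  have T_fixed: "(\<Sum>f\<in>C. f x) \<in> fixed_field N" if x: "x \<in> L" for x
  proof -
    have "\<tau> (\<Sum>f\<in>C. f x) = (\<Sum>f\<in>C. f x)" if t: "\<tau> \<in> N" for \<tau>
    proof -
      have "m \<tau> ` C \<subseteq> C"
      proof
        fix g assume "g \<in> m \<tau> ` C"
        then obtain \<tau>' where "\<tau>' \<in> N" "g = restrict (\<tau> \<circ> restrict \<tau>' L) L"
          using C_gal by (auto simp: m_def)
        then have "g = restrict (\<tau> \<circ> \<tau>') L" by (auto simp: fun_eq_iff)
        then show "g \<in> C" using N(3)[OF t \<open>\<tau>' \<in> N\<close>] by (auto simp: C_def)
      qed
      then have "m \<tau> ` C = C" using endo_inj_surj[OF fin] inj t N(1) by blast
      then show ?thesis using sum_m[of \<tau> x] t N(1) x by auto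
    qed
    then show ?thesis by (simp add: fixed_field_def)
  qed
  have disj: "m \<sigma> ` C \<inter> C = {}"
  proof (rule ccontr)
    assume "m \<sigma> ` C \<inter> C \<noteq> {}"
    then obtain f where f: "f \<in> C" "m \<sigma> f \<in> C" by blast
    then obtain \<tau> \<tau>' where t: "\<tau> \<in> N" "f = restrict \<tau> L" "\<tau>' \<in> N" "m \<sigma> f = restrict \<tau>' L"
      using C_gal by meson
    have b: "bij \<tau>" "bij \<tau>'" using t N(1) gal_bij by blast+
    have "\<sigma> (\<tau> x) = \<tau>' x" if "x \<in> L" for x
      using fun_cong[OF t(4), of x] t(2) that by (simp add: m_def)
    then have "\<forall>x\<in>L. (inv_into UNIV \<tau>' \<circ> (\<sigma> \<circ> \<tau>)) x = x"
      using b by (simp add: bij_is_inj)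
    moreover have "inv_into UNIV \<tau>' \<circ> (\<sigma> \<circ> \<tau>) \<in> carrier abs_gal"
      using gal_comp[OF gal_inv gal_comp[OF s(1)]] t N(1) by blast
    ultimately have "inv_into UNIV \<tau>' \<circ> (\<sigma> \<circ> \<tau>) \<in> N" using fix_L by blast
    then have "\<tau>' \<circ> ((inv_into UNIV \<tau>' \<circ> (\<sigma> \<circ> \<tau>)) \<circ> inv_into UNIV \<tau>) \<in> N"
      using N(3)[OF t(3) N(3)[OF _ N(4)[OF t(1)]]] by blast
    moreover have "\<tau>' \<circ> ((inv_into UNIV \<tau>' \<circ> (\<sigma> \<circ> \<tau>)) \<circ> inv_into UNIV \<tau>) = \<sigma>"
      using b by (auto simp: fun_eq_iff bij_is_surj surj_f_inv_f)
    ultimately show False using \<open>\<sigma> \<notin> N\<close> by simp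
  qed
  let ?Y = "C \<union> m \<sigma> ` C"
  \<comment> \<open>The relation says that the trace and its image under \<sigma> agree. The
    identity occurs in it with coefficient 1, which independence would make 0.\<close>
  let ?c = "\<lambda>f. if f \<in> C then 1 else - 1 :: 'a alg_closure"
  have Y_gal: "\<exists>\<tau>\<in>carrier abs_gal. f = restrict \<tau> L" if f: "f \<in> ?Y" for f
  proof -
    consider "f \<in> C" | g where "g \<in> C" "f = m \<sigma> g" using f by blast
    then show ?thesis
    proof cases
      case 2
      then obtain \<tau> where t: "\<tau> \<in> N" "g = restrict \<tau> L" using C_gal by blast
      then have "f = restrict (\<sigma> \<circ> \<tau>) L" using 2 by (auto simp: m_def fun_eq_iff)
      then show ?thesis using gal_comp[OF s(1), of \<tau>] t N(1) by blast
    qed (use C_gal N(1) in blast)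
  qed
  have idC: "restrict id L \<in> C" using N(2) by (auto simp: C_def)
  have "?c (restrict id L) = 0"
  proof (rule characters_independent[where C = ?Y and L = L and c = ?c and f = "restrict id L"])
    show "(\<Sum>f\<in>?Y. ?c f * f x) = 0" if x: "x \<in> L" for x
    proof -
      have "(\<Sum>f\<in>?Y. ?c f * f x) = (\<Sum>f\<in>C. ?c f * f x) + (\<Sum>f\<in>m \<sigma> ` C. ?c f * f x)"
        using fin disj by (intro sum.union_disjoint) auto
      also have "(\<Sum>f\<in>C. ?c f * f x) = (\<Sum>f\<in>C. f x)" by (intro sum.cong) auto
      also have "(\<Sum>f\<in>m \<sigma> ` C. ?c f * f x) = (\<Sum>f\<in>m \<sigma> ` C. - f x)"
        using disj by (intro sum.cong) auto
      also have "\<dots> = - \<sigma> (\<Sum>f\<in>C. f x)" using sum_m[OF s(1) x] by (simp add: sum_negf)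
      finally show ?thesis using s(2)[OF T_fixed[OF x]] by simp
    qed
    show "f 1 = 1" if f: "f \<in> ?Y" for f
    proof -
      obtain \<tau> where "\<tau> \<in> carrier abs_gal" "f = restrict \<tau> L" using Y_gal[OF f] by blast
      then show ?thesis using L1 by (simp add: gal_1)
    qed
    show "f (x * y) = f x * f y" if f: "f \<in> ?Y" and "x \<in> L" "y \<in> L" for f x y
    proof -
      obtain \<tau> where "\<tau> \<in> carrier abs_gal" "f = restrict \<tau> L" using Y_gal[OF f] by blast
      then show ?thesis using that Lmult by (simp add: gal_mult)
    qed
    show "\<exists>x\<in>L. f x \<noteq> g x" if f: "f \<in> ?Y" and g: "g \<in> ?Y" and "f \<noteq> g" for f g
    proof (rule ccontr)
      assume n: "\<not> ?thesis"
      obtain \<tau> \<tau>' where "f = restrict \<tau> L" "g = restrict \<tau>' L"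
        using Y_gal[OF f] Y_gal[OF g] by blast
      then have "f x = g x" for x
        using n by (cases "x \<in> L") auto
      with that show False by blast
    qed
  qed (use fin L1 Lmult idC in auto)
  with idC show False by simp
qed

subsection \<open>Extending partial homomorphisms\<close>

text \<open>The graph of a \<open>k\<close>-algebra homomorphism from a subring of the algebraic closure to the
  algebraic closure.\<close>
definition partial_hom :: "('a::field alg_closure \<times> 'a alg_closure) set \<Rightarrow> bool" where
  "partial_hom S \<longleftrightarrow> (\<forall>c. (to_ac c, to_ac c) \<in> S) \<and>
     (\<forall>x y x' y'. (x, y) \<in> S \<longrightarrow> (x', y') \<in> S \<longrightarrow> (x + x', y + y') \<in> S \<and> (x * x', y * y') \<in> S) \<and>
     (\<forall>y. (0, y) \<in> S \<longrightarrow> y = 0)"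

text \<open>\<open>q\<close> arises from \<open>p\<close> by applying the homomorphism with graph
  \<open>S\<close> to the coefficients. As a relation this confines the coefficients of
  \<open>p\<close> to the domain of \<open>S\<close> without a separate type for that
  subring.\<close>

definition rel_poly :: "('b \<times> 'b) set \<Rightarrow> 'b::comm_ring_1 poly \<Rightarrow> 'b poly \<Rightarrow> bool" where
  "rel_poly S p q \<longleftrightarrow> (\<forall>i. (Polynomial.coeff p i, Polynomial.coeff q i) \<in> S)"

text \<open>Factors X of an annihilating polynomial can be cancelled because \<open>x\<close> is not
  0.\<close>

lemma algebraic_nonzero_const:
  fixes x :: "'a::field alg_closure"
  assumes "x \<noteq> 0"
  shows "\<exists>p :: 'a poly. Polynomial.coeff p 0 \<noteq> 0 \<and> poly (map_poly to_ac p) x = 0"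
proof -
  obtain p :: "'a poly" where "p \<noteq> 0" "poly (map_poly to_ac p) x = 0"
    using alg_closure_algebraic .
  then show ?thesis
  proof (induction p)
    case (pCons c p)
    show ?case
    proof (cases "c = 0")
      case True
      with pCons assms show ?thesis by (auto simp: map_poly_pCons)
    next
      case False
      with pCons show ?thesis by (intro exI[of _ "pCons c p"]) auto
    qed
  qed auto
qed

context
  fixes S :: "('a::field alg_closure \<times> 'a alg_closure) set"
  assumes S: "partial_hom S"
begin

lemma partial_hom_const: "(to_ac c, to_ac c) \<in> S"
  and partial_hom_add: "(x, y) \<in> S \<Longrightarrow> (x', y') \<in> S \<Longrightarrow> (x + x', y + y') \<in> S"
  and partial_hom_mult: "(x, y) \<in> S \<Longrightarrow> (x', y') \<in> S \<Longrightarrow> (x * x', y * y') \<in> S"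
  and partial_hom_0: "(0, y) \<in> S \<Longrightarrow> y = 0"
  using S by (auto simp: partial_hom_def)

lemma partial_hom_diff:
  assumes "(x, y) \<in> S" "(x', y') \<in> S"
  shows "(x - x', y - y') \<in> S"
  using partial_hom_add[OF assms(1) partial_hom_mult[OF partial_hom_const[of "- 1"] assms(2)]]
  by simp

lemma partial_hom_zero: "(0, 0) \<in> S"
  using partial_hom_const[of 0] by simp

lemma partial_hom_sum: "(\<And>i. i \<in> I \<Longrightarrow> (f i, g i) \<in> S) \<Longrightarrow> (sum f I, sum g I) \<in> S"
  by (induction I rule: infinite_finite_induct) (auto simp: partial_hom_zero partial_hom_add)

lemma partial_hom_unique: "(x, y) \<in> S \<Longrightarrow> (x, y') \<in> S \<Longrightarrow> y = y'"
  using partial_hom_0 partial_hom_diff[of x y x y'] by fastforce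

lemma rel_poly_diff: "rel_poly S p q \<Longrightarrow> rel_poly S p' q' \<Longrightarrow> rel_poly S (p - p') (q - q')"
  and rel_poly_add: "rel_poly S p q \<Longrightarrow> rel_poly S p' q' \<Longrightarrow> rel_poly S (p + p') (q + q')"
  and rel_poly_mult: "rel_poly S p q \<Longrightarrow> rel_poly S p' q' \<Longrightarrow> rel_poly S (p * p') (q * q')"
  by (auto simp: rel_poly_def coeff_mult partial_hom_diff partial_hom_add partial_hom_mult
           intro!: partial_hom_sum)

lemma rel_poly_monom: "(a, b) \<in> S \<Longrightarrow> rel_poly S (Polynomial.monom a n) (Polynomial.monom b n)"
  by (auto simp: rel_poly_def coeff_monom partial_hom_zero)

lemma rel_poly_base: "rel_poly S (map_poly to_ac p) (map_poly to_ac p)"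
  by (auto simp: rel_poly_def coeff_map_poly partial_hom_const)

lemma rel_poly_0: "rel_poly S 0 q \<Longrightarrow> q = 0"
  by (auto simp: rel_poly_def partial_hom_0 intro: poly_eqI)

lemma rel_poly_eval:
  assumes "rel_poly S p q" "(x, y) \<in> S"
  shows "(poly p x, poly q y) \<in> S"
  using assms(1)
proof (induction p arbitrary: q)
  case 0
  then show ?case using rel_poly_0 partial_hom_zero by fastforce
next
  case (pCons a p)
  obtain b q' where q: "q = pCons b q'" by (cases q)
  have "(a, b) \<in> S" "rel_poly S p q'"
    using pCons.prems unfolding q rel_poly_def by (metis coeff_pCons_0, metis coeff_pCons_Suc)
  then show ?case using pCons.IH assms(2) by (simp add: q partial_hom_add partial_hom_mult)
qed

text \<open>The definition of \<open>partial_hom\<close> asks for single values only; injectivity is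
  due to algebraicity. If \<open>x\<close> went to 0, applying the homomorphism to p(x) = 0 would
  send 0 to the nonzero constant term of \<open>p\<close>.\<close>

lemma partial_hom_inj_0:
  assumes "(x, 0) \<in> S"
  shows "x = 0"
proof (rule ccontr)
  assume "x \<noteq> 0"
  then obtain p :: "'a poly" where p: "Polynomial.coeff p 0 \<noteq> 0" "poly (map_poly to_ac p) x = 0"
    using algebraic_nonzero_const by blast
  have "(0, to_ac (Polynomial.coeff p 0)) \<in> S"
    using rel_poly_eval[OF rel_poly_base assms, of p] p(2)
    by (simp add: poly_0_coeff_0 coeff_map_poly)
  then show False using partial_hom_0 p(1) by fastforce
qed

lemma rel_poly_degree:
  assumes "rel_poly S p q"
  shows "Polynomial.degree q = Polynomial.degree p"
proof -
  have "Polynomial.coeff p i = 0 \<longleftrightarrow> Polynomial.coeff q i = 0" for i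
    using assms partial_hom_0 partial_hom_inj_0 unfolding rel_poly_def by metis
  then show ?thesis by (simp add: Polynomial.degree_def)
qed

text \<open>The extension sends \<open>x\<close> to a root \<open>y\<close> of the polynomial that corresponds to the minimal
  polynomial of \<open>x\<close> over the domain of \<open>S\<close>.\<close>
lemma partial_hom_extend: "\<exists>S' y. partial_hom S' \<and> S \<subseteq> S' \<and> (x, y) \<in> S'"
proof -
  define P where "P d \<longleftrightarrow> (\<exists>p q. rel_poly S p q \<and> p \<noteq> 0 \<and> poly p x = 0 \<and> Polynomial.degree p = d)"
    for d
  obtain p0 :: "'a poly" where "p0 \<noteq> 0" "poly (map_poly to_ac p0) x = 0"
    using alg_closure_algebraic .
  then have "P (Polynomial.degree (map_poly to_ac p0))"
    unfolding P_def using rel_poly_base by (metis map_poly_eq_0_iff to_ac_0 to_ac_eq_0_iff)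
  then obtain d where d: "P d" "\<And>d'. d' < d \<Longrightarrow> \<not> P d'"
    using exists_least_iff[of P] by metis
  then obtain p q where pq: "rel_poly S p q" "p \<noteq> 0" "poly p x = 0" "Polynomial.degree p = d"
    by (auto simp: P_def)
  have d_pos: "d > 0"
  proof (rule ccontr)
    assume "\<not> d > 0"
    then obtain c where "p = [:c:]" using pq(4) by (metis degree_eq_zeroE gr0I)
    with pq show False by simp
  qed
  have deg_q: "Polynomial.degree q = d" using rel_poly_degree pq by auto
  then obtain y where y: "poly q y = 0" using alg_closed_imp_poly_has_root d_pos by blast
  define a where "a = Polynomial.coeff p d"
  define b where "b = Polynomial.coeff q d"
  have b: "b \<noteq> 0" using deg_q d_pos unfolding b_def by (metis degree_0 leading_coeff_0_iff less_numeral_extra(3))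
  have ab: "(a, b) \<in> S" using pq by (simp add: rel_poly_def a_def b_def)
  \<comment> \<open>The extension is well defined: relations satisfied by \<open>x\<close> over the
    domain of \<open>S\<close> carry over to \<open>y\<close>.\<close>
  have key: "poly g y = 0" if "rel_poly S f g" "poly f x = 0" for f g
    using that
  proof (induction "Polynomial.degree f" arbitrary: f g rule: less_induct)
    case less
    show ?case
    proof (cases "f = 0")
      case True
      then have "g = 0" using less.prems(1) rel_poly_0 by blast
      then show ?thesis by simp
    next
      case False
      define n where "n = Polynomial.degree f"
      have n: "d \<le> n" using d(2)[of n] less.prems False unfolding P_def n_def using not_less by blast
      \<comment> \<open>Pseudo-division: \<open>partial_hom\<close> provides no inverses, so
        \<open>f\<close> is multiplied by the leading coefficient of \<open>p\<close> before its top
        term is cancelled. The corresponding factor \<open>b\<close> is nonzero and can be removed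
        at the end.\<close>
      define f' where "f' = Polynomial.monom a 0 * f - Polynomial.monom (Polynomial.coeff f n) (n - d) * p"
      define g' where "g' = Polynomial.monom b 0 * g - Polynomial.monom (Polynomial.coeff g n) (n - d) * q"
      have r: "rel_poly S f' g'" unfolding f'_def g'_def
        using less.prems pq ab by (intro rel_poly_diff rel_poly_mult rel_poly_monom) (auto simp: rel_poly_def)
      have "Polynomial.coeff f' i = 0" if "i \<ge> n" for i
      proof (cases "i = n")
        case True
        then show ?thesis using n by (simp add: f'_def coeff_monom_mult a_def)
      next
        case False
        with that have "i > n" by simp
        then have "Polynomial.coeff f i = 0" "Polynomial.coeff p (i - (n - d)) = 0"
          using n pq(4) by (auto simp: n_def intro!: coeff_eq_0)
        then show ?thesis by (simp add: f'_def coeff_monom_mult)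
      qed
      then have "Polynomial.degree f' \<le> n - 1" by (intro degree_le) auto
      then have "Polynomial.degree f' < Polynomial.degree f" using n d_pos by (simp add: n_def)
      moreover have "poly f' x = 0" using less.prems pq by (simp add: f'_def)
      ultimately have "poly g' y = 0" using less.hyps r by blast
      then show ?thesis using y b by (simp add: g'_def poly_monom)
    qed
  qed
  define S' where "S' = {(poly f x, poly g y) | f g. rel_poly S f g}"
  have const: "rel_poly S [:s:] [:t:]" if "(s, t) \<in> S" for s t
    using that by (auto simp: rel_poly_def coeff_pCons partial_hom_zero split: nat.split)
  have sub: "S \<subseteq> S'"
  proof
    fix st assume "st \<in> S"
    then obtain s t where "st = (s, t)" "(s, t) \<in> S" by (cases st) auto
    then show "st \<in> S'" unfolding S'_def using const by force
  qed
  moreover have "(x, y) \<in> S'"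
  proof -
    have "rel_poly S (Polynomial.monom 1 1) (Polynomial.monom 1 1)"
      using rel_poly_monom partial_hom_const[of 1] by simp
    then show ?thesis unfolding S'_def by (force simp: poly_monom)
  qed
  moreover have "partial_hom S'"
    unfolding partial_hom_def
  proof (intro conjI allI impI)
    show "(to_ac c, to_ac c) \<in> S'" for c using sub partial_hom_const by blast
    fix s t s' t' assume "(s, t) \<in> S'" "(s', t') \<in> S'"
    then obtain f g f' g' where *: "rel_poly S f g" "rel_poly S f' g'"
      "s = poly f x" "t = poly g y" "s' = poly f' x" "t' = poly g' y"
      by (auto simp: S'_def)
    show "(s + s', t + t') \<in> S'" unfolding S'_def using rel_poly_add[OF *(1,2)] *(3-)
      by (force simp flip: poly_add)
    show "(s * s', t * t') \<in> S'" unfolding S'_def using rel_poly_mult[OF *(1,2)] *(3-)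
      by (force simp flip: poly_mult)
  next
    fix t assume "(0, t) \<in> S'"
    then show "t = 0" using key by (auto simp: S'_def)
  qed
  ultimately show ?thesis by blast
qed

end

text \<open>Zorn's lemma gives a maximal partial homomorphism, and \<open>partial_hom_extend\<close>
  makes it total. It is onto because it maps the finite root set of each nonzero polynomial over k
  injectively to itself.\<close>

lemma partial_hom_extends_to_gal:
  assumes S: "partial_hom (S :: ('a::field alg_closure \<times> 'a alg_closure) set)"
  shows "\<exists>\<sigma>\<in>carrier abs_gal. \<forall>x y. (x, y) \<in> S \<longrightarrow> \<sigma> x = y"
proof -
  define A where "A = {T. partial_hom T \<and> S \<subseteq> T}"
  have "\<exists>M\<in>A. \<forall>T\<in>A. M \<subseteq> T \<longrightarrow> T = M"
  proof (rule subset_Zorn_nonempty)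
    show "A \<noteq> {}" using S by (auto simp: A_def)
    fix C assume C: "C \<noteq> {}" "subset.chain A C"
    have "partial_hom (\<Union>C)"
      unfolding partial_hom_def
    proof (intro conjI allI impI)
      show "(to_ac c, to_ac c) \<in> \<Union>C" for c
      proof -
        obtain T where "T \<in> C" using C by blast
        then have "partial_hom T" using C by (auto simp: subset_chain_def A_def)
        then show ?thesis using partial_hom_const \<open>T \<in> C\<close> by blast
      qed
      fix x y x' y' assume "(x, y) \<in> \<Union>C" "(x', y') \<in> \<Union>C"
      then obtain T T' where T: "T \<in> C" "(x, y) \<in> T" "T' \<in> C" "(x', y') \<in> T'" by blast
      then have "T \<subseteq> T' \<or> T' \<subseteq> T" using C by (auto simp: subset_chain_def)
      then obtain U where U: "U \<in> C" "(x, y) \<in> U" "(x', y') \<in> U" using T by blast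
      then have "partial_hom U" using C by (auto simp: subset_chain_def A_def)
      then show "(x + x', y + y') \<in> \<Union>C" "(x * x', y * y') \<in> \<Union>C"
        using U partial_hom_add partial_hom_mult by blast+
    next
      fix y assume "(0, y) \<in> \<Union>C"
      then show "y = 0" using C by (auto simp: subset_chain_def A_def partial_hom_def)
    qed
    moreover obtain T where "T \<in> C" using C by blast
    then have "T \<in> A" using C by (auto simp: subset_chain_def)
    then have "S \<subseteq> T" by (simp add: A_def)
    then have "S \<subseteq> \<Union>C" using \<open>T \<in> C\<close> by blast
    ultimately show "\<Union>C \<in> A" by (simp add: A_def)
  qed
  then obtain M where M: "partial_hom M" "S \<subseteq> M"
    and max: "\<And>T. partial_hom T \<Longrightarrow> M \<subseteq> T \<Longrightarrow> T = M"
    by (auto simp: A_def)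
  have total: "\<exists>y. (x, y) \<in> M" for x
    using partial_hom_extend[OF M(1), of x] max by blast
  define \<sigma> where "\<sigma> x = (THE y. (x, y) \<in> M)" for x
  have \<sigma>: "\<sigma> x = y" if "(x, y) \<in> M" for x y
    unfolding \<sigma>_def using that partial_hom_unique[OF M(1)] by blast
  have \<sigma>_in: "(x, \<sigma> x) \<in> M" for x using total[of x] \<sigma> by blast
  have add: "\<sigma> (x + y) = \<sigma> x + \<sigma> y" and mult: "\<sigma> (x * y) = \<sigma> x * \<sigma> y"
    and base: "\<sigma> (to_ac c) = to_ac c" for x y c
    using partial_hom_add[OF M(1) \<sigma>_in \<sigma>_in] partial_hom_mult[OF M(1) \<sigma>_in \<sigma>_in]
      partial_hom_const[OF M(1)] \<sigma> by blast+
  have inj: "inj \<sigma>"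
  proof (rule injI)
    fix x y assume "\<sigma> x = \<sigma> y"
    then have "(x - y, 0) \<in> M" using partial_hom_diff[OF M(1) \<sigma>_in \<sigma>_in, of x y] by simp
    then show "x = y" using partial_hom_inj_0[OF M(1)] by fastforce
  qed
  have "y \<in> range \<sigma>" for y
  proof -
    obtain p :: "'a poly" where p: "p \<noteq> 0" "poly (map_poly to_ac p) y = 0"
      using alg_closure_algebraic .
    define R where "R = {y. poly (map_poly to_ac p) y = 0}"
    have "finite R" unfolding R_def
      by (rule poly_roots_finite) (use p in \<open>simp add: map_poly_eq_0_iff\<close>)
    moreover have "\<sigma> ` R \<subseteq> R"
    proof
      fix z assume "z \<in> \<sigma> ` R"
      then obtain x where x: "z = \<sigma> x" "poly (map_poly to_ac p) x = 0" by (auto simp: R_def)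
      have "(0, poly (map_poly to_ac p) z) \<in> M"
        using rel_poly_eval[OF M(1) rel_poly_base[OF M(1)] \<sigma>_in, of p x] x by simp
      then show "z \<in> R" using partial_hom_0[OF M(1)] by (simp add: R_def)
    qed
    ultimately have "\<sigma> ` R = R" using inj by (intro endo_inj_surj) (auto intro: inj_on_subset)
    then show ?thesis using p by (auto simp: R_def)
  qed
  then have "bij \<sigma>" using inj by (auto simp: bij_def)
  then have "\<sigma> \<in> carrier abs_gal" using add mult base by (auto simp: abs_gal_iff)
  then show ?thesis using \<sigma> M(2) by blast
qed

section \<open>Galois invariants over a perfect field\<close>

lemma map_poly_to_ac_add: "map_poly to_ac (p + q) = map_poly to_ac p + map_poly to_ac q"
  and map_poly_to_ac_mult: "map_poly to_ac (p * q) = map_poly to_ac p * map_poly to_ac q"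
  by (auto intro!: poly_eqI simp: coeff_map_poly coeff_mult to_ac_sum)

lemma minimal_polynomial:
  fixes x :: "'a::field alg_closure"
  obtains p :: "'a poly" where "Factorial_Ring.irreducible p" "poly (map_poly to_ac p) x = 0"
    "\<And>f. poly (map_poly to_ac f) x = 0 \<Longrightarrow> p dvd f"
proof -
  define P where "P d \<longleftrightarrow> (\<exists>p :: 'a poly. p \<noteq> 0 \<and> poly (map_poly to_ac p) x = 0 \<and> Polynomial.degree p = d)"
    for d
  obtain p0 :: "'a poly" where "p0 \<noteq> 0" "poly (map_poly to_ac p0) x = 0"
    using alg_closure_algebraic .
  then have "P (Polynomial.degree p0)" by (auto simp: P_def)
  then obtain d where d: "P d" "\<And>d'. d' < d \<Longrightarrow> \<not> P d'"
    using exists_least_iff[of P] by metis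
  then obtain p :: "'a poly" where p: "p \<noteq> 0" "poly (map_poly to_ac p) x = 0" "Polynomial.degree p = d"
    by (auto simp: P_def)
  have min: "f = 0" if "poly (map_poly to_ac f) x = 0" "Polynomial.degree f < d" for f
    using d(2)[OF that(2)] that(1) by (auto simp: P_def)
  show thesis
  proof (rule that)
    show dvd: "p dvd f" if f: "poly (map_poly to_ac f) x = 0" for f
    proof -
      have "f mod p = 0"
      proof (rule ccontr)
        assume nz: "f mod p \<noteq> 0"
        have "map_poly to_ac f = map_poly to_ac (f div p) * map_poly to_ac p + map_poly to_ac (f mod p)"
          by (simp flip: map_poly_to_ac_add map_poly_to_ac_mult)
        then have "poly (map_poly to_ac (f mod p)) x = 0" using f p by simp
        then show False using min nz degree_mod_less[OF p(1), of f] p(3) by blast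
      qed
      then show ?thesis by (simp add: mod_eq_0_iff_dvd)
    qed
    show "Factorial_Ring.irreducible p"
    proof (rule Factorial_Ring.irreducibleI)
      show "\<not> p dvd 1" using p is_unit_iff_degree[of p] by (auto elim!: degree_eq_zeroE simp: map_poly_pCons)
      fix a b assume ab: "p = a * b"
      then have nz: "a \<noteq> 0" "b \<noteq> 0" using p by auto
      have deg: "d = Polynomial.degree a + Polynomial.degree b" using ab nz p by (simp add: degree_mult_eq)
      have "poly (map_poly to_ac a) x = 0 \<or> poly (map_poly to_ac b) x = 0"
        using p(2) by (simp add: ab map_poly_to_ac_mult)
      then have "Polynomial.degree a = 0 \<or> Polynomial.degree b = 0"
        using min[of a] min[of b] nz deg by fastforce
      then show "a dvd 1 \<or> b dvd 1" using is_unit_iff_degree nz by blast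
    qed (use p in auto)
  qed (use p in auto)
qed

text \<open>For each root \<open>y\<close> of the minimal polynomial, f(x) -> f(y) is a well-defined
  homomorphism and extends to an automorphism, so \<open>y\<close> equals \<open>x\<close>.
  Separability then leaves only degree 1.\<close>

lemma gal_fixed_in_base:
  fixes x :: "'a::field alg_closure"
  assumes perfect: "perfect_field TYPE('a)"
    and fixed: "\<And>\<sigma>. \<sigma> \<in> carrier abs_gal \<Longrightarrow> \<sigma> x = x"
  shows "x \<in> base_field"
proof -
  obtain p :: "'a poly" where p: "Factorial_Ring.irreducible p" "poly (map_poly to_ac p) x = 0"
    and dvd: "\<And>f. poly (map_poly to_ac f) x = 0 \<Longrightarrow> p dvd f"
    by (rule minimal_polynomial[of x]) blast
  define P where "P = map_poly to_ac p"
  have P: "P \<noteq> 0" "poly P x = 0" using p by (auto simp: P_def map_poly_eq_0_iff)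
  obtain Q where Q: "P = [:- x, 1:] * Q" using P by (metis dvdE poly_eq_0_iff_dvd)
  have "Q \<noteq> 0" using P Q by auto
  have deg: "Polynomial.degree p = Suc (Polynomial.degree Q)"
  proof -
    have "Polynomial.degree P = Suc (Polynomial.degree Q)"
      using degree_mult_eq[of "[:- x, 1:]" Q] \<open>Q \<noteq> 0\<close> unfolding Q by (simp del: mult_pCons_left)
    moreover have "Polynomial.degree P = Polynomial.degree p"
      unfolding P_def by (rule degree_map_poly) simp
    ultimately show ?thesis by simp
  qed
  have unique: "y = x" if y: "poly P y = 0" for y
  proof -
    define S where "S = {(poly (map_poly to_ac f) x, poly (map_poly to_ac f) y) | f. True}"
    have "partial_hom S"
      unfolding partial_hom_def
    proof (intro conjI allI impI)
      show "(to_ac c, to_ac c) \<in> S" for c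
        unfolding S_def by (force intro: exI[of _ "[:c:]"] simp: map_poly_pCons)
      fix s t s' t' assume "(s, t) \<in> S" "(s', t') \<in> S"
      then show "(s + s', t + t') \<in> S" "(s * s', t * t') \<in> S"
        unfolding S_def by (auto simp flip: poly_add poly_mult map_poly_to_ac_add map_poly_to_ac_mult)
    next
      fix t assume "(0, t) \<in> S"
      then obtain f where f: "poly (map_poly to_ac f) x = 0" "t = poly (map_poly to_ac f) y"
        by (auto simp: S_def)
      obtain g where "f = p * g" using dvd[OF f(1)] by (elim dvdE)
      then show "t = 0" using f(2) y by (simp add: P_def map_poly_to_ac_mult)
    qed
    moreover have "(x, y) \<in> S"
      unfolding S_def by (force intro: exI[of _ "[:0, 1:]"] simp: map_poly_pCons)
    ultimately show ?thesis using partial_hom_extends_to_gal fixed by metis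
  qed
  have "Polynomial.degree Q = 0"
  proof (rule ccontr)
    assume "Polynomial.degree Q \<noteq> 0"
    \<comment> \<open>A root of the cofactor \<open>Q\<close> would again be \<open>x\<close>, hence
      a double root of \<open>P\<close>.\<close>
    then obtain y where y: "poly Q y = 0" using alg_closed_imp_poly_has_root by blast
    then have "y = x" using unique Q by simp
    with y have "order x Q \<noteq> 0" using \<open>Q \<noteq> 0\<close> by (simp add: order_root)
    moreover have "order x P = order x [:- x, 1:] + order x Q"
      using P Q by (metis order_mult)
    moreover have "order x [:- x, 1:] = 1" using order_power_n_n[of x 1] by simp
    moreover have "rsquarefree P" using perfect p by (simp add: perfect_field_def P_def)
    ultimately show False unfolding rsquarefree_def by (metis One_nat_def add_cancel_left_right one_neq_zero add_is_0)
  qed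
  then obtain c0 c1 where c: "p = [:c0, c1:]" "c1 \<noteq> 0"
    using deg by (metis One_nat_def degree_eq_zeroE degree_pCons_eq_if old.nat.inject pCons_cases zero_neq_one degree_0 pCons_eq_0_iff)
  then have "to_ac c0 + x * to_ac c1 = 0" using p(2) by (simp add: map_poly_pCons)
  then have "x = to_ac (- c0 / c1)"
    using c(2) by (simp add: field_simps eq_neg_iff_add_eq_0)
  then show ?thesis by blast
qed

subsection \<open>The automorphisms of the dihedral group\<close>

text \<open>The automorphism of the dihedral group that sends \<open>r\<close> to its inverse if \<open>V\<close> holds, and to
  itself otherwise, and that sends \<open>s\<close> to \<open>r\<^sup>m s\<close>, where \<open>U\<close> and \<open>W\<close> are the binary digits
  of \<open>m\<close>.\<close>
definition d8_aut :: "bool \<Rightarrow> bool \<Rightarrow> bool \<Rightarrow> int \<times> int \<Rightarrow> int \<times> int" where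
  "d8_aut V U W = (\<lambda>(i, e). (((if V then - i else i) + e * (of_bool U + 2 * of_bool W)) mod 4, e))"

lemma carrier_D8: "carrier D8 = {(0, 0), (1, 0), (2, 0), (3, 0), (0, 1), (1, 1), (2, 1), (3, 1)}"
proof -
  have "{0..<4::int} = {0, 1, 2, 3}" "{0..<2::int} = {0, 1}" by auto
  then show ?thesis by (auto simp: D8_def)
qed

lemma D8_mult: "(i, e) \<otimes>\<^bsub>D8\<^esub> (j, f) = ((if e = 0 then i + j else i - j) mod 4, (e + f) mod 2)"
  by (simp add: D8_def)

lemma D8_one: "\<one>\<^bsub>D8\<^esub> = (0, 0)"
  by (simp add: D8_def)

lemma d8_aut_closed: "p \<in> carrier D8 \<Longrightarrow> d8_aut V U W p \<in> carrier D8"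
  by (cases p) (auto simp: d8_aut_def D8_def)

lemma d8_aut_eq_iff:
  "(\<forall>p\<in>carrier D8. d8_aut V U W p = d8_aut V' U' W' p) \<longleftrightarrow> V = V' \<and> U = U' \<and> W = W'"
proof
  assume "\<forall>p\<in>carrier D8. d8_aut V U W p = d8_aut V' U' W' p"
  then have "d8_aut V U W (1, 0) = d8_aut V' U' W' (1, 0)" "d8_aut V U W (0, 1) = d8_aut V' U' W' (0, 1)"
    by (simp_all add: carrier_D8)
  then show "V = V' \<and> U = U' \<and> W = W'"
    by (cases V; cases V'; cases U; cases U'; cases W; cases W') (simp_all add: d8_aut_def)
qed simp

text \<open>The exponents combine to m + m' or m - m' modulo 4. The term
  \<open>U' \<and> (U \<noteq> V)\<close> collects the carry from the low digits and, if
  \<open>V\<close> holds, the correction in -m' = m' + 2 U' modulo 4.\<close>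

lemma d8_aut_comp:
  assumes "p \<in> carrier D8"
  shows "d8_aut V U W (d8_aut V' U' W' p)
       = d8_aut (V \<noteq> V') (U \<noteq> U') ((W \<noteq> W') \<noteq> (U' \<and> (U \<noteq> V))) p"
proof -
  obtain i e where p: "p = (i, e)" by (cases p)
  define M where "M = (of_bool U + 2 * of_bool W :: int)"
  define M' where "M' = (of_bool U' + 2 * of_bool W' :: int)"
  define M'' where "M'' = (of_bool (U \<noteq> U') + 2 * of_bool ((W \<noteq> W') \<noteq> (U' \<and> (U \<noteq> V))) :: int)"
  have digits: "((if V then - M' else M') + M) mod 4 = M'' mod 4"
    unfolding M_def M'_def M''_def by (cases V; cases U; cases U'; cases W; cases W') simp_all
  have aut: "d8_aut V U W (i, e) = (((if V then - i else i) + e * M) mod 4, e)"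
    "d8_aut V' U' W' (i, e) = (((if V' then - i else i) + e * M') mod 4, e)"
    "d8_aut (V \<noteq> V') (U \<noteq> U') ((W \<noteq> W') \<noteq> (U' \<and> (U \<noteq> V))) (i, e)
      = (((if V \<noteq> V' then - i else i) + e * M'') mod 4, e)" for i e
    by (simp_all only: d8_aut_def prod.case M_def M'_def M''_def)
  let ?x = "(if V' then - i else i) + e * M'"
  have "((if V then - (x mod 4) else x mod 4) + y) mod 4 = ((if V then - x else x) + y) mod 4" for x y :: int
    by (cases V) (simp_all add: mod_simps)
  then have "((if V then - (?x mod 4) else ?x mod 4) + e * M) mod 4 = ((if V then - ?x else ?x) + e * M) mod 4" .
  also have "(if V then - ?x else ?x) + e * M
      = (if V \<noteq> V' then - i else i) + e * ((if V then - M' else M') + M)"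
    by (cases V; cases V') (simp_all add: algebra_simps)
  also have "\<dots> mod 4 = ((if V \<noteq> V' then - i else i) + e * M'') mod 4"
    by (intro mod_add_cong mod_mult_cong refl digits)
  finally show ?thesis by (simp only: p aut)
qed

lemma d8_aut_id: "p \<in> carrier D8 \<Longrightarrow> d8_aut False False False p = p"
  by (auto simp: d8_aut_def carrier_D8)

text \<open>The third digit solves \<open>d8_aut_comp\<close> for the identity.\<close>

lemma d8_aut_inverse:
  assumes "p \<in> carrier D8"
  shows "d8_aut V U ((W \<noteq> U) \<noteq> (V \<and> U)) (d8_aut V U W p) = p"
proof -
  have "d8_aut V U ((W \<noteq> U) \<noteq> (V \<and> U)) (d8_aut V U W p) = d8_aut False False False p"
    using d8_aut_comp[OF assms, of V U "(W \<noteq> U) \<noteq> (V \<and> U)" V U W] by (cases U; cases V; simp)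
  then show ?thesis by (simp add: d8_aut_id assms)
qed

lemma d8_aut_iso: "d8_aut V U W \<in> iso D8 D8"
proof (rule isoI)
  show "d8_aut V U W \<in> hom D8 D8"
  proof (rule homI)
    fix p q assume "p \<in> carrier D8" "q \<in> carrier D8"
    moreover obtain i e j f where "p = (i, e)" "q = (j, f)" by (cases p; cases q)
    ultimately have pq: "p = (i, e)" "q = (j, f)" "e = 0 \<or> e = 1" "f = 0 \<or> f = 1" by (auto simp: carrier_D8)
    define M where "M = (of_bool U + 2 * of_bool W :: int)"
    have aut: "d8_aut V U W (i, e) = (((if V then - i else i) + e * M) mod 4, e)" for i e
      by (simp only: d8_aut_def prod.case M_def)
    show "d8_aut V U W (p \<otimes>\<^bsub>D8\<^esub> q) = d8_aut V U W p \<otimes>\<^bsub>D8\<^esub> d8_aut V U W q"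
      using pq(3,4) unfolding pq(1,2) D8_mult aut
      by (elim disjE; cases V) (simp_all add: mod_simps, (simp_all add: algebra_simps)?)
  qed (rule d8_aut_closed)
  show "bij_betw (d8_aut V U W) (carrier D8) (carrier D8)"
  proof (rule bij_betw_byWitness)
    show "\<forall>p\<in>carrier D8. d8_aut V U ((W \<noteq> U) \<noteq> (V \<and> U)) (d8_aut V U W p) = p"
      using d8_aut_inverse by blast
    have e: "((((W \<noteq> U) \<noteq> (V \<and> U)) \<noteq> U) \<noteq> (V \<and> U)) = W" by auto
    show "\<forall>p\<in>carrier D8. d8_aut V U W (d8_aut V U ((W \<noteq> U) \<noteq> (V \<and> U)) p) = p"
      using d8_aut_inverse[of _ V U "(W \<noteq> U) \<noteq> (V \<and> U)"] unfolding e by blast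
  qed (auto simp: d8_aut_closed)
qed

text \<open>The image of r has a nontrivial square, so it is r or its inverse. The image of s is not
  a power of r, as it would then commute with the image of r. These two values determine
  \<open>g\<close>.\<close>

lemma d8_automorphism:
  assumes g: "g \<in> hom D8 D8" and inj: "inj_on g (carrier D8)"
  shows "\<exists>V U W. \<forall>p\<in>carrier D8. g p = d8_aut V U W p"
proof -
  have mult: "g (p \<otimes>\<^bsub>D8\<^esub> q) = g p \<otimes>\<^bsub>D8\<^esub> g q" if "p \<in> carrier D8" "q \<in> carrier D8" for p q
    using g that by (simp add: hom_mult)
  have ne: "g p \<noteq> g q" if "p \<in> carrier D8" "q \<in> carrier D8" "p \<noteq> q" for p q
    using inj that by (auto simp: inj_on_def)
  have closed: "g p \<in> carrier D8" if "p \<in> carrier D8" for p using g that by (rule hom_in_carrier)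
  have g2: "g (2, 0) = g (1, 0) \<otimes>\<^bsub>D8\<^esub> g (1, 0)" and g3: "g (3, 0) = g (2, 0) \<otimes>\<^bsub>D8\<^esub> g (1, 0)"
    and h1: "g (1, 1) = g (1, 0) \<otimes>\<^bsub>D8\<^esub> g (0, 1)" and h2: "g (2, 1) = g (2, 0) \<otimes>\<^bsub>D8\<^esub> g (0, 1)"
    and h3: "g (3, 1) = g (3, 0) \<otimes>\<^bsub>D8\<^esub> g (0, 1)"
    and sr: "g (3, 1) = g (0, 1) \<otimes>\<^bsub>D8\<^esub> g (1, 0)"
    and e: "g (0, 0) = g (0, 0) \<otimes>\<^bsub>D8\<^esub> g (0, 0)"
    using mult[of "(1, 0)" "(1, 0)"] mult[of "(2, 0)" "(1, 0)"] 
      mult[of "(1, 0)" "(0, 1)"] mult[of "(2, 0)" "(0, 1)"] mult[of "(3, 0)" "(0, 1)"]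
      mult[of "(0, 1)" "(1, 0)"] mult[of "(0, 0)" "(0, 0)"]
    by (simp_all add: D8_mult carrier_D8)
  have g00: "g (0, 0) = (0, 0)"
    using closed[of "(0, 0)"] e by (auto simp: carrier_D8 D8_mult)
  have g10: "g (1, 0) = (1, 0) \<or> g (1, 0) = (3, 0)"
    using closed[of "(1, 0)"] g2 g00 ne[of "(2, 0)" "(0, 0)"] by (auto simp: carrier_D8 D8_mult)
  have "snd (g (0, 1)) = 1"
  proof (rule ccontr)
    assume "snd (g (0, 1)) \<noteq> 1"
    then have "snd (g (0, 1)) = 0" using closed[of "(0, 1)"] by (auto simp: carrier_D8)
    then have "g (3, 1) = g (1, 1)"
      using g10 sr h1 by (cases "g (0, 1)") (auto simp: D8_mult add.commute)
    then show False using ne[of "(3, 1)" "(1, 1)"] by (simp add: carrier_D8)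
  qed
  then obtain m where m: "g (0, 1) = (m, 1)" by (cases "g (0, 1)") auto
  then have m_cases: "m = 0 \<or> m = 1 \<or> m = 2 \<or> m = 3" using closed[of "(0, 1)"] by (auto simp: carrier_D8)
  have "g p = d8_aut (g (1, 0) = (3, 0)) (m = 1 \<or> m = 3) (m = 2 \<or> m = 3) p" if "p \<in> carrier D8" for p
  proof -
    have p: "p = (0, 0) \<or> p = (1, 0) \<or> p = (2, 0) \<or> p = (3, 0) \<or> p = (0, 1) \<or> p = (1, 1) \<or> p = (2, 1) \<or> p = (3, 1)"
      using that by (auto simp: carrier_D8)
    have d: "g (2, 0) = (2, 0)" "g (2, 1) = ((2 + m) mod 4, 1)"
      using g10 g2 h2 by (auto simp: D8_mult m)
    consider "g (1, 0) = (1, 0)" "g (3, 0) = (3, 0)" "g (1, 1) = ((1 + m) mod 4, 1)" "g (3, 1) = ((3 + m) mod 4, 1)"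
      | "g (1, 0) = (3, 0)" "g (3, 0) = (1, 0)" "g (1, 1) = ((3 + m) mod 4, 1)" "g (3, 1) = ((1 + m) mod 4, 1)"
      using g10 g3 h1 h3 by (auto simp: D8_mult m d(1))
    then show ?thesis
      by cases (use p m_cases in \<open>elim disjE; simp add: d8_aut_def g00 m d\<close>)+
  qed
  then show ?thesis by blast
qed

subsection \<open>Galois actions on dihedral groups\<close>

lemma mem_kernel_AutoGroup:
  "\<sigma> \<in> kernel abs_gal (AutoGroup A) \<rho> \<longleftrightarrow> \<sigma> \<in> carrier abs_gal \<and> \<rho> \<sigma> = (\<lambda>x\<in>carrier A. x)"
  by (simp add: kernel_def AutoGroup_def BijGroup_def)

lemma gal_fixes_adjoin_iff:
  assumes "\<sigma> \<in> carrier abs_gal"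
  shows "(\<forall>x\<in>adjoin S. \<sigma> x = x) \<longleftrightarrow> (\<forall>x\<in>S. \<sigma> x = x)"
proof
  assume "\<forall>x\<in>adjoin S. \<sigma> x = x"
  then show "\<forall>x\<in>S. \<sigma> x = x" by (auto simp: adjoin_def generate_field.incl)
next
  assume S: "\<forall>x\<in>S. \<sigma> x = x"
  interpret K: field "kbar :: 'a alg_closure ring" by (rule field_from_type_algebra)
  have "\<sigma> x = x" if "x \<in> generate_field kbar (base_field \<union> S)" for x
    using that
  proof (induction rule: generate_field.induct)
    case one
    then show ?case using gal_1[OF assms] by (simp add: ring_of_type_algebra_simps)
  next
    case (incl h)
    then show ?case using S gal_to_ac[OF assms] by auto
  next
    case (a_inv h)
    have "\<ominus>\<^bsub>kbar\<^esub> h = - h"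
      by (rule K.minus_equality) (simp_all add: ring_of_type_algebra_simps)
    then show ?case using a_inv gal_uminus[OF assms] by simp
  next
    case (m_inv h)
    then have "h \<noteq> 0" by (simp add: ring_of_type_algebra_simps)
    then have "inv\<^bsub>kbar\<^esub> h = inverse h"
      by (intro K.comm_inv_char) (simp_all add: ring_of_type_algebra_simps)
    then show ?case using m_inv gal_inverse[OF assms] by simp
  next
    case (eng_add h1 h2)
    then show ?case using gal_add[OF assms] by (simp add: ring_of_type_algebra_simps)
  next
    case (eng_mult h1 h2)
    then show ?case using gal_mult[OF assms] by (simp add: ring_of_type_algebra_simps)
  qed
  then show "\<forall>x\<in>adjoin S. \<sigma> x = x" by (simp add: adjoin_def)
qed

lemma cyclic_subgroup_generator:
  assumes "group A" "subgroup C A" "cyclic_group (A\<lparr>carrier := C\<rparr>)"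
  shows "\<exists>x\<in>C. C = range (\<lambda>n::int. x [^]\<^bsub>A\<^esub> n)"
proof -
  interpret A: group A by fact
  interpret S: group "A\<lparr>carrier := C\<rparr>" using assms(2) by (rule subgroup.subgroup_is_group) fact
  show ?thesis
    using assms(3) A.int_pow_consistent[OF assms(2)] by (auto simp: S.cyclic_group)
qed

text \<open>The predicates are the digits of \<rho> \<sigma> read through \<theta>. Another choice
  of \<theta> keeps \<open>U\<close> and \<open>V\<close> but can change \<open>W\<close>, which is
  why \<theta> is a parameter.\<close>

locale d8_action =
  fixes A :: "('g, 'm) monoid_scheme" and \<rho> :: "('a::field, 'g) gal_action"
    and \<theta> :: "'g \<Rightarrow> int \<times> int"
    and U V W :: "('a alg_closure \<Rightarrow> 'a alg_closure) \<Rightarrow> bool"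
  assumes gal_group: "gal_group A \<rho>"
    and \<theta>: "\<theta> \<in> iso A D8"
    and action: "\<And>\<sigma> a. \<sigma> \<in> carrier abs_gal \<Longrightarrow> a \<in> carrier A \<Longrightarrow>
      \<theta> (\<rho> \<sigma> a) = d8_aut (V \<sigma>) (U \<sigma>) (W \<sigma>) (\<theta> a)"
begin

lemma group_A: "group A"
  using gal_group by (simp add: gal_group_def)

sublocale A: group A by (rule group_A)
sublocale D: group D8 by (rule group_D8)
sublocale \<theta>: group_hom A D8 \<theta>
  using \<theta> by unfold_locales (auto simp: iso_def)

lemma \<theta>_bij: "bij_betw \<theta> (carrier A) (carrier D8)"
  using \<theta> by (simp add: iso_def)

lemma \<theta>_inj: "\<theta> a = \<theta> b \<Longrightarrow> a \<in> carrier A \<Longrightarrow> b \<in> carrier A \<Longrightarrow> a = b"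
  using \<theta>_bij by (auto simp: bij_betw_def inj_on_def)

lemma \<theta>_surj: "p \<in> carrier D8 \<Longrightarrow> \<exists>a\<in>carrier A. \<theta> a = p"
  unfolding bij_betw_imp_surj_on[OF \<theta>_bij, symmetric] by blast

lemma \<rho>_auto:
  assumes "\<sigma> \<in> carrier abs_gal"
  shows "\<rho> \<sigma> \<in> hom A A" and "\<rho> \<sigma> \<in> extensional (carrier A)"
proof -
  have "\<rho> \<in> hom abs_gal (AutoGroup A)" using gal_group by (simp add: gal_group_def)
  then have "\<rho> \<sigma> \<in> carrier (AutoGroup A)" using assms by (rule hom_in_carrier)
  then show "\<rho> \<sigma> \<in> hom A A" "\<rho> \<sigma> \<in> extensional (carrier A)"
    by (auto simp: AutoGroup_def auto_def Bij_def)
qed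

lemma \<rho>_closed: "\<sigma> \<in> carrier abs_gal \<Longrightarrow> a \<in> carrier A \<Longrightarrow> \<rho> \<sigma> a \<in> carrier A"
  using \<rho>_auto(1) hom_in_carrier by fast

lemma \<rho>_comp:
  assumes "\<sigma> \<in> carrier abs_gal" "\<tau> \<in> carrier abs_gal" "a \<in> carrier A"
  shows "\<rho> (\<sigma> \<circ> \<tau>) a = \<rho> \<sigma> (\<rho> \<tau> a)"
proof -
  have hom: "\<rho> \<in> hom abs_gal (AutoGroup A)" using gal_group by (simp add: gal_group_def)
  have "\<rho> \<sigma> \<in> Bij (carrier A)" "\<rho> \<tau> \<in> Bij (carrier A)"
    using hom_in_carrier[OF hom assms(1)] hom_in_carrier[OF hom assms(2)]
    by (auto simp: AutoGroup_def auto_def)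
  moreover have "\<sigma> \<otimes>\<^bsub>abs_gal\<^esub> \<tau> = \<sigma> \<circ> \<tau>" by (simp add: abs_gal_def)
  ultimately show ?thesis
    using hom_mult[OF hom assms(1,2)] assms(3)
    by (simp add: AutoGroup_def BijGroup_def compose_def)
qed

text \<open>An automorphism determines its digits by \<open>d8_aut_eq_iff\<close>, so
  \<open>d8_aut_comp\<close> transfers to \<sigma>. Thus \<open>U\<close> and \<open>V\<close> are
  characters, and \<open>W\<close> is one only up to the carry.\<close>

lemma comp:
  assumes "\<sigma> \<in> carrier abs_gal" "\<tau> \<in> carrier abs_gal"
  shows V_comp: "V (\<sigma> \<circ> \<tau>) \<longleftrightarrow> V \<sigma> \<noteq> V \<tau>" and U_comp: "U (\<sigma> \<circ> \<tau>) \<longleftrightarrow> U \<sigma> \<noteq> U \<tau>"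
    and W_comp: "W (\<sigma> \<circ> \<tau>) \<longleftrightarrow> (W \<sigma> \<noteq> W \<tau>) \<noteq> (U \<tau> \<and> (U \<sigma> \<noteq> V \<sigma>))"
proof -
  have "d8_aut (V (\<sigma> \<circ> \<tau>)) (U (\<sigma> \<circ> \<tau>)) (W (\<sigma> \<circ> \<tau>)) p
      = d8_aut (V \<sigma> \<noteq> V \<tau>) (U \<sigma> \<noteq> U \<tau>) ((W \<sigma> \<noteq> W \<tau>) \<noteq> (U \<tau> \<and> (U \<sigma> \<noteq> V \<sigma>))) p"
    if p: "p \<in> carrier D8" for p
  proof -
    obtain a where a: "a \<in> carrier A" "\<theta> a = p" using \<theta>_surj p by blast
    have "d8_aut (V (\<sigma> \<circ> \<tau>)) (U (\<sigma> \<circ> \<tau>)) (W (\<sigma> \<circ> \<tau>)) p = \<theta> (\<rho> (\<sigma> \<circ> \<tau>) a)"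
      using action[OF gal_comp[OF assms] a(1)] a(2) by simp
    also have "\<dots> = d8_aut (V \<sigma>) (U \<sigma>) (W \<sigma>) (d8_aut (V \<tau>) (U \<tau>) (W \<tau>) p)"
      using \<rho>_comp[OF assms a(1)] action[OF assms(1) \<rho>_closed[OF assms(2) a(1)]]
        action[OF assms(2) a(1)] a(2) by simp
    finally show ?thesis using d8_aut_comp[OF p] by simp
  qed
  then have "V (\<sigma> \<circ> \<tau>) = (V \<sigma> \<noteq> V \<tau>) \<and> U (\<sigma> \<circ> \<tau>) = (U \<sigma> \<noteq> U \<tau>) \<and>
      W (\<sigma> \<circ> \<tau>) = ((W \<sigma> \<noteq> W \<tau>) \<noteq> (U \<tau> \<and> (U \<sigma> \<noteq> V \<sigma>)))"
    unfolding d8_aut_eq_iff[symmetric] by blast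
  then show "V (\<sigma> \<circ> \<tau>) \<longleftrightarrow> V \<sigma> \<noteq> V \<tau>" "U (\<sigma> \<circ> \<tau>) \<longleftrightarrow> U \<sigma> \<noteq> U \<tau>"
    "W (\<sigma> \<circ> \<tau>) \<longleftrightarrow> (W \<sigma> \<noteq> W \<tau>) \<noteq> (U \<tau> \<and> (U \<sigma> \<noteq> V \<sigma>))" by blast+
qed

lemma id_gal: "id \<in> carrier abs_gal"
  by (simp add: abs_gal_iff)

lemma id_digits: "\<not> V id" "\<not> U id" "\<not> W id"
  using V_comp[OF id_gal id_gal] U_comp[OF id_gal id_gal] W_comp[OF id_gal id_gal] by auto

text \<open>Where \<open>U\<close> fails the carry vanishes; this case of \<open>W\<close> serves
  the closure of the kernel under inverses.\<close>

lemma inv_digits: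
  assumes "\<sigma> \<in> carrier abs_gal"
  shows "V (inv_into UNIV \<sigma>) = V \<sigma>" "U (inv_into UNIV \<sigma>) = U \<sigma>"
    "\<not> U \<sigma> \<Longrightarrow> W (inv_into UNIV \<sigma>) = W \<sigma>"
proof -
  have "\<sigma> \<circ> inv_into UNIV \<sigma> = id"
    using gal_bij[OF assms] by (auto simp: fun_eq_iff bij_is_surj surj_f_inv_f)
  with comp[OF assms gal_inv[OF assms]] id_digits
  show "V (inv_into UNIV \<sigma>) = V \<sigma>" "U (inv_into UNIV \<sigma>) = U \<sigma>"
    "\<not> U \<sigma> \<Longrightarrow> W (inv_into UNIV \<sigma>) = W \<sigma>" by auto
qed

lemma digits_trivial_iff:
  assumes "\<sigma> \<in> carrier abs_gal" "a \<in> carrier A"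
  shows "\<rho> \<sigma> a = a \<longleftrightarrow> d8_aut (V \<sigma>) (U \<sigma>) (W \<sigma>) (\<theta> a) = \<theta> a"
  using action[OF assms] \<theta>_inj[OF _ \<rho>_closed[OF assms] assms(2)] by metis

lemma kernel_action:
  "kernel abs_gal (AutoGroup A) \<rho> = {\<sigma> \<in> carrier abs_gal. \<not> V \<sigma> \<and> \<not> U \<sigma> \<and> \<not> W \<sigma>}"
proof -
  have "\<rho> \<sigma> = (\<lambda>x\<in>carrier A. x) \<longleftrightarrow> \<not> V \<sigma> \<and> \<not> U \<sigma> \<and> \<not> W \<sigma>" if s: "\<sigma> \<in> carrier abs_gal" for \<sigma>
  proof -
    have "\<rho> \<sigma> = (\<lambda>x\<in>carrier A. x) \<longleftrightarrow> (\<forall>a\<in>carrier A. \<rho> \<sigma> a = a)"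
      using \<rho>_auto(2)[OF s] by (auto simp: extensional_def restrict_def fun_eq_iff)
    also have "\<dots> \<longleftrightarrow> (\<forall>p\<in>carrier D8. d8_aut (V \<sigma>) (U \<sigma>) (W \<sigma>) p = d8_aut False False False p)"
      unfolding bij_betw_imp_surj_on[OF \<theta>_bij, symmetric] ball_simps(9)
      using digits_trivial_iff[OF s] d8_aut_id by auto
    finally show ?thesis by (simp add: d8_aut_eq_iff)
  qed
  then show ?thesis by (auto simp: mem_kernel_AutoGroup)
qed

lemma \<theta>_center: "c \<in> center A \<longleftrightarrow> c \<in> carrier A \<and> \<theta> c \<in> {(0, 0), (2, 0)}"
proof -
  have "c \<in> center A \<longleftrightarrow> c \<in> carrier A \<and> (\<forall>p\<in>carrier D8. \<theta> c \<otimes>\<^bsub>D8\<^esub> p = p \<otimes>\<^bsub>D8\<^esub> \<theta> c)"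
    unfolding bij_betw_imp_surj_on[OF \<theta>_bij, symmetric] ball_simps(9) center_def
    using \<theta>_inj by (force simp flip: \<theta>.hom_mult)
  moreover have "(\<forall>p\<in>carrier D8. q \<otimes>\<^bsub>D8\<^esub> p = p \<otimes>\<^bsub>D8\<^esub> q) \<longleftrightarrow> q \<in> {(0, 0), (2, 0)}"
    if "q \<in> carrier D8" for q
    using that by (auto simp: carrier_D8 D8_mult)
  ultimately show ?thesis using \<theta>.hom_closed by blast
qed

text \<open>Modulo r^2, r and its inverse coincide, and r^m s lies in the coset of s exactly if m is
  even.\<close>

lemma kernel_quotient_action:
  "kernel abs_gal (AutoGroup (A Mod center A)) (quotient_action A (center A) \<rho>)
     = {\<sigma> \<in> carrier abs_gal. \<not> U \<sigma>}"
proof -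
  define coset where "coset p = {p, (2, 0) \<otimes>\<^bsub>D8\<^esub> p}" for p
  have coset: "\<theta> ` (center A #>\<^bsub>A\<^esub> a) = coset (\<theta> a)" if "a \<in> carrier A" for a
  proof -
    have "\<theta> ` (center A #>\<^bsub>A\<^esub> a) = (\<lambda>q. q \<otimes>\<^bsub>D8\<^esub> \<theta> a) ` \<theta> ` center A"
      using that by (force simp: r_coset_def \<theta>_center)
    also have "\<theta> ` center A = {(0, 0), (2, 0)}"
    proof -
      obtain a b where "a \<in> carrier A" "\<theta> a = (0, 0)" "b \<in> carrier A" "\<theta> b = (2, 0)"
        using \<theta>_surj[of "(0, 0)"] \<theta>_surj[of "(2, 0)"] by (auto simp: carrier_D8)
      then show ?thesis using \<theta>_center by (force simp: image_iff)
    qed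
    also have "(0, 0) \<otimes>\<^bsub>D8\<^esub> \<theta> a = \<theta> a" using D.l_one[of "\<theta> a"] that by (simp add: D8_one)
    ultimately show ?thesis by (simp add: coset_def)
  qed
  have "quotient_action A (center A) \<rho> \<sigma> = (\<lambda>C\<in>carrier (A Mod center A). C) \<longleftrightarrow> \<not> U \<sigma>"
    if s: "\<sigma> \<in> carrier abs_gal" for \<sigma>
  proof -
    let ?d = "d8_aut (V \<sigma>) (U \<sigma>) (W \<sigma>)"
    have sub: "center A #>\<^bsub>A\<^esub> a \<subseteq> carrier A" if "a \<in> carrier A" for a
      using that by (auto simp: r_coset_def \<theta>_center)
    have img: "\<rho> \<sigma> ` C = C \<longleftrightarrow> ?d ` \<theta> ` C = \<theta> ` C" if "C \<subseteq> carrier A" for C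
    proof -
      have "?d ` \<theta> ` C = \<theta> ` (\<rho> \<sigma> ` C)" unfolding image_image using action[OF s] that by (intro image_cong) auto
      moreover have "\<rho> \<sigma> ` C \<subseteq> carrier A" using \<rho>_closed[OF s] that by auto
      ultimately show ?thesis
        using inj_on_image_eq_iff[OF bij_betw_imp_inj_on[OF \<theta>_bij]] that by metis
    qed
    have "quotient_action A (center A) \<rho> \<sigma> = (\<lambda>C\<in>carrier (A Mod center A). C) \<longleftrightarrow>
        (\<forall>C\<in>carrier (A Mod center A). \<rho> \<sigma> ` C = C)"
      by (auto simp: quotient_action_def restrict_def fun_eq_iff)
    also have "\<dots> \<longleftrightarrow> (\<forall>a\<in>carrier A. ?d ` coset (\<theta> a) = coset (\<theta> a))"
      unfolding carrier_FactGroup ball_simps(9) using img[OF sub] coset by simp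
    also have "\<dots> \<longleftrightarrow> (\<forall>p\<in>carrier D8. ?d ` coset p = coset p)"
      unfolding bij_betw_imp_surj_on[OF \<theta>_bij, symmetric] ball_simps(9) ..
    also have "\<dots> \<longleftrightarrow> \<not> U \<sigma>"
    proof
      assume "\<forall>p\<in>carrier D8. ?d ` coset p = coset p"
      then have "?d ` coset (0, 1) = coset (0, 1)" by (simp add: carrier_D8)
      then have "?d (0, 1) \<in> coset (0, 1)" by (auto simp: coset_def)
      then show "\<not> U \<sigma>" 
        by (cases "V \<sigma>"; cases "W \<sigma>") (auto simp: coset_def d8_aut_def D8_mult)
    next
      assume "\<not> U \<sigma>"
      then show "\<forall>p\<in>carrier D8. ?d ` coset p = coset p"
        by (cases "V \<sigma>"; cases "W \<sigma>") (auto simp: coset_def d8_aut_def carrier_D8 D8_mult)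
    qed
    finally show ?thesis .
  qed
  then show ?thesis by (auto simp: mem_kernel_AutoGroup)
qed

text \<open>A generator of the cyclic subgroup has a nontrivial square, and in \<open>D8\<close>
  only r and its inverse have one. On these, \<sigma> acts through the digit \<open>V\<close>
  alone.\<close>

lemma kernel_cyclic4_action:
  "kernel abs_gal (AutoGroup (A\<lparr>carrier := cyclic4 A\<rparr>)) (restrict_action (cyclic4 A) \<rho>)
     = {\<sigma> \<in> carrier abs_gal. \<not> V \<sigma>}"
proof -
  define C where "C = cyclic4 A"
  have "A \<cong> D8" using \<theta> by (auto simp: is_iso_def)
  have C0: "subgroup C A \<and> cyclic_group (A\<lparr>carrier := C\<rparr>) \<and> card C = 4"
    unfolding C_def cyclic4_def by (rule theI'[OF ex1_cyclic4[OF group_A \<open>A \<cong> D8\<close>]])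
  note C = conjunct1[OF C0] conjunct1[OF conjunct2[OF C0]] conjunct2[OF conjunct2[OF C0]]
  obtain x where x: "x \<in> C" "C = range (\<lambda>n::int. x [^]\<^bsub>A\<^esub> n)"
    using cyclic_subgroup_generator[OF group_A C(1,2)] by (elim bexE)
  have xA: "x \<in> carrier A" using x C(1) by (meson subgroup.mem_carrier)
  have xx: "x \<otimes>\<^bsub>A\<^esub> x \<noteq> \<one>\<^bsub>A\<^esub>"
  proof
    assume xx: "x \<otimes>\<^bsub>A\<^esub> x = \<one>\<^bsub>A\<^esub>"
    have "x [^]\<^bsub>A\<^esub> n \<in> {\<one>\<^bsub>A\<^esub>, x}" for n :: int
    proof -
      have two: "x [^]\<^bsub>A\<^esub> (2::int) = \<one>\<^bsub>A\<^esub>"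
        using xx xA by (metis A.int_pow_mult A.int_pow_1 one_add_one)
      have "x [^]\<^bsub>A\<^esub> n = x [^]\<^bsub>A\<^esub> (2 * (n div 2) + n mod 2)" by simp
      also have "\<dots> = (x [^]\<^bsub>A\<^esub> (2::int)) [^]\<^bsub>A\<^esub> (n div 2) \<otimes>\<^bsub>A\<^esub> x [^]\<^bsub>A\<^esub> (n mod 2)"
        using xA by (simp only: A.int_pow_mult A.int_pow_pow)
      also have "\<dots> = x [^]\<^bsub>A\<^esub> (n mod 2)" using xA by (simp add: two)
      finally have e: "x [^]\<^bsub>A\<^esub> n = x [^]\<^bsub>A\<^esub> (n mod 2)" .
      have "n mod 2 = 0 \<or> n mod 2 = 1" by auto
      with e show ?thesis using xA by (auto simp: A.int_pow_1)
    qed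
    then have "C \<subseteq> {\<one>\<^bsub>A\<^esub>, x}" using x by auto
    then have "card C \<le> card {\<one>\<^bsub>A\<^esub>, x}" by (intro card_mono) auto
    also have "\<dots> \<le> 2" by (simp add: card_insert_if)
    finally show False using C(3) by simp
  qed
  have "\<theta> x \<otimes>\<^bsub>D8\<^esub> \<theta> x \<noteq> (0, 0)"
  proof
    assume "\<theta> x \<otimes>\<^bsub>D8\<^esub> \<theta> x = (0, 0)"
    then have "\<theta> (x \<otimes>\<^bsub>A\<^esub> x) = \<theta> \<one>\<^bsub>A\<^esub>" using xA by (simp add: D8_one)
    then show False using xx \<theta>_inj xA by blast
  qed
  then have \<theta>x: "\<theta> x \<in> {(1, 0), (3, 0)}"
    using \<theta>.hom_closed[OF xA] by (auto simp: carrier_D8 D8_mult)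
  have "restrict (\<rho> \<sigma>) C = (\<lambda>c\<in>C. c) \<longleftrightarrow> \<not> V \<sigma>" if s: "\<sigma> \<in> carrier abs_gal" for \<sigma>
  proof -
    interpret \<rho>: group_hom A A "\<rho> \<sigma>" by unfold_locales (rule \<rho>_auto(1)[OF s])
    have "restrict (\<rho> \<sigma>) C = (\<lambda>c\<in>C. c) \<longleftrightarrow> (\<forall>c\<in>C. \<rho> \<sigma> c = c)"
      by (auto simp: restrict_def fun_eq_iff)
    also have "\<dots> \<longleftrightarrow> \<rho> \<sigma> x = x"
    proof
      assume "\<rho> \<sigma> x = x"
      then show "\<forall>c\<in>C. \<rho> \<sigma> c = c" unfolding x(2) using xA by (auto simp: \<rho>.hom_int_pow)
    qed (use x in blast)
    also have "\<dots> \<longleftrightarrow> \<not> V \<sigma>"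
      unfolding digits_trivial_iff[OF s xA] using \<theta>x by (auto simp: d8_aut_def)
    finally show ?thesis .
  qed
  then show ?thesis by (auto simp: mem_kernel_AutoGroup restrict_action_def simp flip: C_def)
qed

text \<open>A subgroup above the kernel contains the stabilizer of the finite extension supplied by
  \<open>gal_group\<close>, so \<open>gal_closed\<close> applies. An equality of fixed fields
  thereby becomes a membership test on the generators \<open>S\<close>; it is applied to the three
  fields of the theorem.\<close>

lemma fixes_iff:
  assumes closed: "N \<subseteq> carrier abs_gal" "id \<in> N" "\<And>\<tau> \<tau>'. \<tau> \<in> N \<Longrightarrow> \<tau>' \<in> N \<Longrightarrow> \<tau> \<circ> \<tau>' \<in> N"
      "\<And>\<tau>. \<tau> \<in> N \<Longrightarrow> inv_into UNIV \<tau> \<in> N"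
    and ker: "kernel abs_gal (AutoGroup A) \<rho> \<subseteq> N"
    and field: "fixed_field N = adjoin S"
    and s: "\<sigma> \<in> carrier abs_gal"
  shows "(\<forall>x\<in>S. \<sigma> x = x) \<longleftrightarrow> \<sigma> \<in> N"
proof
  assume "\<forall>x\<in>S. \<sigma> x = x"
  then have fixed: "\<sigma> x = x" if "x \<in> fixed_field N" for x
    using that gal_fixes_adjoin_iff[OF s, of S] by (simp add: field)
  obtain L where "finite_normal_ext L"
    "\<And>\<tau>. \<tau> \<in> carrier abs_gal \<Longrightarrow> \<forall>x\<in>L. \<tau> x = x \<Longrightarrow> \<tau> \<in> kernel abs_gal (AutoGroup A) \<rho>"
    using gal_group unfolding gal_group_def by blast
  then show "\<sigma> \<in> N" using gal_closed[OF _ closed _ s fixed] ker by blast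
next
  assume "\<sigma> \<in> N"
  then have "\<forall>x\<in>adjoin S. \<sigma> x = x" unfolding field[symmetric] by (simp add: fixed_field_def)
  then show "\<forall>x\<in>S. \<sigma> x = x" using gal_fixes_adjoin_iff[OF s] by blast
qed

lemma U_iff:
  assumes "action_field (A Mod center A) (quotient_action A (center A) \<rho>) = adjoin S" "\<sigma> \<in> carrier abs_gal"
  shows "(\<forall>x\<in>S. \<sigma> x = x) \<longleftrightarrow> \<not> U \<sigma>"
proof -
  have "(\<forall>x\<in>S. \<sigma> x = x) \<longleftrightarrow> \<sigma> \<in> {\<sigma> \<in> carrier abs_gal. \<not> U \<sigma>}"
    using assms id_digits
    by (intro fixes_iff) (simp_all add: subset_iff id_gal gal_comp gal_inv U_comp inv_digits kernel_action
        action_field_def kernel_quotient_action)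
  then show ?thesis using assms by simp
qed

lemma V_iff:
  assumes "action_field (A\<lparr>carrier := cyclic4 A\<rparr>) (restrict_action (cyclic4 A) \<rho>) = adjoin S"
    "\<sigma> \<in> carrier abs_gal"
  shows "(\<forall>x\<in>S. \<sigma> x = x) \<longleftrightarrow> \<not> V \<sigma>"
proof -
  have "(\<forall>x\<in>S. \<sigma> x = x) \<longleftrightarrow> \<sigma> \<in> {\<sigma> \<in> carrier abs_gal. \<not> V \<sigma>}"
    using assms id_digits
    by (intro fixes_iff) (simp_all add: subset_iff id_gal gal_comp gal_inv V_comp inv_digits kernel_action
        action_field_def kernel_cyclic4_action)
  then show ?thesis using assms by simp
qed

lemma kernel_iff:
  assumes "action_field A \<rho> = adjoin S" "\<sigma> \<in> carrier abs_gal"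
  shows "(\<forall>x\<in>S. \<sigma> x = x) \<longleftrightarrow> \<not> V \<sigma> \<and> \<not> U \<sigma> \<and> \<not> W \<sigma>"
proof -
  have "(\<forall>x\<in>S. \<sigma> x = x) \<longleftrightarrow> \<sigma> \<in> {\<sigma> \<in> carrier abs_gal. \<not> V \<sigma> \<and> \<not> U \<sigma> \<and> \<not> W \<sigma>}"
    using assms id_digits
    by (intro fixes_iff) (simp_all add: subset_iff id_gal gal_comp gal_inv comp inv_digits kernel_action
        action_field_def)
  then show ?thesis using assms by simp
qed

end

lemma d8_action_exists:
  assumes gal: "gal_group A (\<rho> :: ('a::field, 'g) gal_action)" and \<theta>: "\<theta> \<in> iso A D8"
  shows "\<exists>U V W. d8_action A \<rho> \<theta> U V W"
proof -
  have bij: "bij_betw \<theta> (carrier A) (carrier D8)" using \<theta> by (simp add: iso_def)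
  interpret A: group A using gal by (simp add: gal_group_def)
  have inv: "inv_into (carrier A) \<theta> \<in> iso D8 A" using A.iso_set_sym[OF \<theta>] .
  have "\<exists>V U W. \<forall>a\<in>carrier A. \<theta> (\<rho> \<sigma> a) = d8_aut V U W (\<theta> a)" if "\<sigma> \<in> carrier abs_gal" for \<sigma>
  proof -
    have "\<rho> \<in> hom abs_gal (AutoGroup A)" using gal by (simp add: gal_group_def)
    then have "\<rho> \<sigma> \<in> carrier (AutoGroup A)" using that by (rule hom_in_carrier)
    then have \<rho>: "\<rho> \<sigma> \<in> hom A A" "bij_betw (\<rho> \<sigma>) (carrier A) (carrier A)"
      by (auto simp: AutoGroup_def auto_def Bij_def)
    define g where "g = \<theta> \<circ> (\<rho> \<sigma> \<circ> inv_into (carrier A) \<theta>)"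
    have "g \<in> hom D8 D8" unfolding g_def
      using \<theta> inv \<rho>(1) by (intro hom_compose) (auto simp: iso_def)
    moreover have "bij_betw g (carrier D8) (carrier D8)" unfolding g_def
      using bij \<rho>(2) bij_betw_inv_into[OF bij] by (meson bij_betw_trans)
    ultimately obtain V U W where *: "\<forall>p\<in>carrier D8. g p = d8_aut V U W p"
      using d8_automorphism bij_betw_imp_inj_on by blast
    have "\<theta> (\<rho> \<sigma> a) = d8_aut V U W (\<theta> a)" if "a \<in> carrier A" for a
    proof -
      have "g (\<theta> a) = \<theta> (\<rho> \<sigma> a)" using bij_betw_inv_into_left[OF bij that] by (simp add: g_def)
      moreover have "\<theta> a \<in> carrier D8" using bij that by (auto simp: bij_betw_def)
      ultimately show ?thesis using * by simp
    qed
    then show ?thesis by blast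
  qed
  then obtain V U W where "\<And>\<sigma>. \<sigma> \<in> carrier abs_gal \<Longrightarrow>
      \<forall>a\<in>carrier A. \<theta> (\<rho> \<sigma> a) = d8_aut (V \<sigma>) (U \<sigma>) (W \<sigma>) (\<theta> a)"
    by metis
  then have "d8_action A \<rho> \<theta> U V W"
    using gal \<theta> by unfold_locales auto
  then show ?thesis by blast
qed

section \<open>Normal form of the action on the square roots\<close>

lemma ac_sqrt_power2: "(ac_sqrt x)\<^sup>2 = x"
proof -
  have "\<exists>y. poly [:- x, 0, 1:] y = 0"
    by (rule alg_closed_imp_poly_has_root) simp
  then have "\<exists>y. y\<^sup>2 = x" by (auto simp: power2_eq_square)
  then show ?thesis unfolding ac_sqrt_def by (rule someI_ex)
qed

text \<open>Signs are indexed by booleans so that they multiply by \<open>\<noteq>\<close>, like the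
  digits.\<close>

definition flip :: "bool \<Rightarrow> 'b::ring_1 \<Rightarrow> 'b" where
  "flip b x = (if b then - x else x)"

text \<open>Over the field with two elements, a nonempty \<open>T\<close> is closed under addition
  and avoids (0, 0, 1), so it is the graph of a linear form on a subspace of the plane, and such a
  form extends to the plane. A subspace is allowed because not all pairs of values of
  \<open>U\<close> and \<open>V\<close> need occur.\<close>

lemma xor_closed_graph:
  assumes "\<And>x y c x' y' c'. T x y c \<Longrightarrow> T x' y' c' \<Longrightarrow> T (x \<noteq> x') (y \<noteq> y') (c \<noteq> c')"
    and "\<not> T False False True"
  shows "\<exists>a b. \<forall>x y c. T x y c \<longrightarrow> c = ((a \<and> x) \<noteq> (b \<and> y))"
proof -
  have single: "\<not> (T x y True \<and> T x y False)" for x y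
    using assms(1)[of x y True x y False] assms(2) by auto
  have sum: "T x y c \<Longrightarrow> T x' y' c' \<Longrightarrow> \<not> T (x \<noteq> x') (y \<noteq> y') (c = c')" for x y c x' y' c'
    using assms(1)[of x y c x' y' c'] single[of "x \<noteq> x'" "y \<noteq> y'"] by (cases "c = c'") auto
  have s: "\<not> (T True False c \<and> T False True c' \<and> T True True (c = c'))" for c c'
    using sum[of True False c False True c'] by auto
  show ?thesis
    using single[of True False] single[of False True] single[of True True] assms(2)
      s[of True True] s[of True False] s[of False True] s[of False False]
    by (simp add: ex_bool_eq all_bool_eq) blast
qed

context
  fixes A :: "('g, 'm) monoid_scheme" and \<rho> :: "('a::field, 'g) gal_action"
    and u v w z c :: 'a and p q \<alpha> \<beta> :: "'a alg_closure"
  assumes char2: "CHAR('a) \<noteq> 2"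
    and gal: "gal_group A \<rho>" and D8: "A \<cong> D8"
    and nz: "p \<noteq> 0" "q \<noteq> 0" "\<alpha> \<noteq> 0" "\<beta> \<noteq> 0"
    and squares: "p\<^sup>2 = to_ac u" "q\<^sup>2 = to_ac v"
      "\<alpha>\<^sup>2 = to_ac w * (1 + to_ac z * p) / 2" "\<beta>\<^sup>2 = to_ac w * (1 - to_ac z * p) / 2"
    and prod: "\<alpha> * \<beta> = to_ac c * p * q"
    and fields: "action_field (A Mod center A) (quotient_action A (center A) \<rho>) = adjoin {p}"
      "action_field (A\<lparr>carrier := cyclic4 A\<rparr>) (restrict_action (cyclic4 A) \<rho>) = adjoin {q}"
      "action_field A \<rho> = adjoin {q, \<alpha>, \<beta>}"
begin

lemma neg_neq: "(x :: 'a alg_closure) \<noteq> 0 \<Longrightarrow> - x \<noteq> x"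
proof
  assume "x \<noteq> 0" "- x = x"
  then have "2 * x = 0" by (metis add.right_inverse mult_2)
  then show False using \<open>x \<noteq> 0\<close> two_neq_0[where 'a = "'a alg_closure"] char2 by simp
qed

lemma flip_inject: "(x :: 'a alg_closure) \<noteq> 0 \<Longrightarrow> flip b x = flip b' x \<longleftrightarrow> b = b'"
  using neg_neq[of x] not_sym[OF neg_neq[of x]] by (cases b; cases b') (simp_all add: flip_def)

text \<open>The signs with which the Galois group acts on \<open>\<alpha>\<close> satisfy the same cocycle relation as the
  digit \<open>W\<close>. Their quotient is a character that is trivial on the elements fixing \<open>p\<close> and \<open>q\<close>, and
  a change of the isomorphism with the dihedral group removes it.\<close>
lemma d8_normal_form:
  "\<exists>\<theta> U V W. d8_action A \<rho> \<theta> U V W \<and> (\<forall>\<sigma>\<in>carrier abs_gal.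
     \<sigma> q = flip (V \<sigma>) q \<and> \<sigma> \<alpha> = flip (W \<sigma>) (if U \<sigma> then \<beta> else \<alpha>) \<and>
     \<sigma> \<beta> = flip ((W \<sigma> \<noteq> U \<sigma>) \<noteq> V \<sigma>) (if U \<sigma> then \<alpha> else \<beta>))"
proof -
  obtain \<theta> where \<theta>: "\<theta> \<in> iso A D8" using D8 by (auto simp: is_iso_def)
  obtain U V W where d8: "d8_action A \<rho> \<theta> U V W" using d8_action_exists[OF gal \<theta>] by blast
  interpret d8_action A \<rho> \<theta> U V W by (rule d8)
  \<comment> \<open>The sign of \<sigma> \<alpha>, measured against \<beta> if \<sigma> moves
    \<open>p\<close>.\<close>
  define C where "C \<sigma> \<longleftrightarrow> \<sigma> \<alpha> \<noteq> (if U \<sigma> then \<beta> else \<alpha>)"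
    for \<sigma> :: "'a alg_closure \<Rightarrow> 'a alg_closure"
  have square: "\<sigma> x ^ 2 = \<sigma> (x ^ 2)" if "\<sigma> \<in> carrier abs_gal"
    for \<sigma> :: "'a alg_closure \<Rightarrow> 'a alg_closure" and x
    using gal_mult[OF that] by (simp add: power2_eq_square)
  have gp: "\<sigma> p = flip (U \<sigma>) p" if s: "\<sigma> \<in> carrier abs_gal" for \<sigma>
  proof -
    have "\<sigma> p = p \<or> \<sigma> p = - p"
      unfolding power2_eq_iff[symmetric] square[OF s] squares(1) by (rule gal_to_ac[OF s])
    then show ?thesis using U_iff[OF fields(1) s] by (auto simp: flip_def)
  qed
  have gq: "\<sigma> q = flip (V \<sigma>) q" if s: "\<sigma> \<in> carrier abs_gal" for \<sigma>
  proof -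
    have "\<sigma> q = q \<or> \<sigma> q = - q"
      unfolding power2_eq_iff[symmetric] square[OF s] squares(2) by (rule gal_to_ac[OF s])
    then show ?thesis using V_iff[OF fields(2) s] by (auto simp: flip_def)
  qed
  have g\<alpha>: "\<sigma> \<alpha> = flip (C \<sigma>) (if U \<sigma> then \<beta> else \<alpha>)" if s: "\<sigma> \<in> carrier abs_gal" for \<sigma>
  proof -
    have "\<sigma> 2 = 2" using gal_to_ac[OF s, of 2] by simp
    then have "(\<sigma> \<alpha>)\<^sup>2 = to_ac w * (1 + to_ac z * flip (U \<sigma>) p) / 2"
      by (simp add: square[OF s] squares gal_divide[OF s] gal_mult[OF s] gal_add[OF s] gal_1[OF s]
          gal_to_ac[OF s] gp[OF s])
    also have "\<dots> = (if U \<sigma> then \<beta> else \<alpha>)\<^sup>2"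
      using two_neq_0[where 'a = "'a alg_closure"] char2 by (simp add: squares flip_def)
    finally show ?thesis by (auto simp: power2_eq_iff C_def flip_def)
  qed
  \<comment> \<open>The sign of \<sigma> \<beta> is forced by that of \<sigma> \<alpha>, as \<alpha>
    \<beta> = c p q picks up the signs of \<open>p\<close> and \<open>q\<close>.\<close>
  have g\<beta>: "\<sigma> \<beta> = flip ((C \<sigma> \<noteq> U \<sigma>) \<noteq> V \<sigma>) (if U \<sigma> then \<alpha> else \<beta>)" if s: "\<sigma> \<in> carrier abs_gal" for \<sigma>
  proof -
    have "\<sigma> \<alpha> * \<sigma> \<beta> = to_ac c * \<sigma> p * \<sigma> q"
      using arg_cong[OF prod, of \<sigma>] by (simp add: gal_mult[OF s] gal_to_ac[OF s])
    also have "\<dots> = flip (U \<sigma> \<noteq> V \<sigma>) (\<alpha> * \<beta>)"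
      by (simp add: gp[OF s] gq[OF s] prod flip_def)
    also have "\<dots> = \<sigma> \<alpha> * flip ((C \<sigma> \<noteq> U \<sigma>) \<noteq> V \<sigma>) (if U \<sigma> then \<alpha> else \<beta>)"
      by (cases "C \<sigma>"; cases "U \<sigma>"; cases "V \<sigma>") (simp_all add: g\<alpha>[OF s] flip_def mult.commute)
    finally show ?thesis using nz(3) gal_eq_0_iff[OF s] by (simp only: mult_cancel_left) blast
  qed
  \<comment> \<open>The carry is the same as in \<open>W_comp\<close>, so it cancels in the sum of
    \<open>C\<close> and \<open>W\<close> modulo 2.\<close>
  have C_comp: "C (\<sigma> \<circ> \<tau>) \<longleftrightarrow> (C \<sigma> \<noteq> C \<tau>) \<noteq> (U \<tau> \<and> (U \<sigma> \<noteq> V \<sigma>))"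
    if s: "\<sigma> \<in> carrier abs_gal" and t: "\<tau> \<in> carrier abs_gal" for \<sigma> \<tau>
  proof -
    have fl: "\<sigma> (flip b x) = flip b (\<sigma> x)" for b x by (simp add: flip_def gal_uminus[OF s])
    have "flip (C (\<sigma> \<circ> \<tau>)) (if U \<sigma> \<noteq> U \<tau> then \<beta> else \<alpha>) = \<sigma> (\<tau> \<alpha>)"
      using g\<alpha>[OF gal_comp[OF s t]] U_comp[OF s t] by simp
    also have "\<dots> = flip (C \<tau>) (if U \<tau> then \<sigma> \<beta> else \<sigma> \<alpha>)" by (simp add: g\<alpha>[OF t] fl)
    also have "\<dots> = flip ((C \<sigma> \<noteq> C \<tau>) \<noteq> (U \<tau> \<and> (U \<sigma> \<noteq> V \<sigma>))) (if U \<sigma> \<noteq> U \<tau> then \<beta> else \<alpha>)"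
      by (cases "C \<sigma>"; cases "C \<tau>"; cases "U \<sigma>"; cases "U \<tau>"; cases "V \<sigma>")
        (simp_all add: g\<alpha>[OF s] g\<beta>[OF s] flip_def)
    finally show ?thesis using flip_inject nz by (cases "U \<sigma> \<noteq> U \<tau>") auto
  qed
  define T where "T x y e \<longleftrightarrow> (\<exists>\<sigma>\<in>carrier abs_gal. U \<sigma> = x \<and> V \<sigma> = y \<and> (C \<sigma> \<noteq> W \<sigma>) = e)" for x y e
  have "\<exists>a b. \<forall>x y e. T x y e \<longrightarrow> e = ((a \<and> x) \<noteq> (b \<and> y))"
  proof (rule xor_closed_graph)
    fix x y e x' y' e' assume "T x y e" "T x' y' e'"
    then obtain \<sigma> \<tau> where st: "\<sigma> \<in> carrier abs_gal" "\<tau> \<in> carrier abs_gal"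
      "U \<sigma> = x" "V \<sigma> = y" "(C \<sigma> \<noteq> W \<sigma>) = e" "U \<tau> = x'" "V \<tau> = y'" "(C \<tau> \<noteq> W \<tau>) = e'"
      unfolding T_def by blast
    show "T (x \<noteq> x') (y \<noteq> y') (e \<noteq> e')"
      unfolding T_def using st(3-)
      by (intro bexI[OF _ gal_comp[OF st(1,2)]]) (auto simp: comp[OF st(1,2)] C_comp[OF st(1,2)])
  next
    show "\<not> T False False True"
    proof
      assume "T False False True"
      then obtain \<sigma> where s: "\<sigma> \<in> carrier abs_gal" "\<not> U \<sigma>" "\<not> V \<sigma>" "C \<sigma> \<noteq> W \<sigma>"
        unfolding T_def by blast
      \<comment> \<open>If \<open>U\<close> and \<open>V\<close> fail, \<open>C\<close> decides
        whether \<sigma> fixes the generators of K, hence whether \<rho> \<sigma> is trivial, which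
        \<open>W\<close> decides too.\<close>
      have "(\<forall>x\<in>{q, \<alpha>, \<beta>}. \<sigma> x = x) \<longleftrightarrow> \<not> C \<sigma>"
        using s(2,3) neg_neq nz by (simp add: gq[OF s(1)] g\<alpha>[OF s(1)] g\<beta>[OF s(1)] flip_def)
      then show False using kernel_iff[OF fields(3) s(1)] s by blast
    qed
  qed
  then obtain a b where ab: "\<And>x y e. T x y e \<Longrightarrow> e = ((a \<and> x) \<noteq> (b \<and> y))" by blast
  have C_eq: "C \<sigma> \<longleftrightarrow> (W \<sigma> \<noteq> ((a \<and> U \<sigma>) \<noteq> (b \<and> V \<sigma>)))" if "\<sigma> \<in> carrier abs_gal" for \<sigma> :: "'a alg_closure \<Rightarrow> 'a alg_closure"
    using ab[of "U \<sigma>" "V \<sigma>" "C \<sigma> \<noteq> W \<sigma>"] that unfolding T_def by blast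
  \<comment> \<open>Conjugation by \<open>d8_aut a b False\<close>, which inverts r if
    \<open>a\<close> holds and sends s to r s if \<open>b\<close> holds, adds a U + b V to
    \<open>W\<close> modulo 2.\<close>
  have "d8_action A \<rho> (d8_aut a b False \<circ> \<theta>) U V C"
  proof unfold_locales
    show "d8_aut a b False \<circ> \<theta> \<in> iso A D8"
      using \<theta> d8_aut_iso by (rule iso_set_trans)
    fix \<sigma> :: "'a alg_closure \<Rightarrow> 'a alg_closure" and x
    assume s: "\<sigma> \<in> carrier abs_gal" and x: "x \<in> carrier A"
    have \<theta>x: "\<theta> x \<in> carrier D8" using x by simp
    have "((False \<noteq> W \<sigma>) \<noteq> (U \<sigma> \<and> (b \<noteq> a))) = ((C \<sigma> \<noteq> False) \<noteq> (b \<and> (U \<sigma> \<noteq> V \<sigma>)))"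
      "(a \<noteq> V \<sigma>) = (V \<sigma> \<noteq> a)" "(b \<noteq> U \<sigma>) = (U \<sigma> \<noteq> b)"
      using C_eq[OF s] by auto
    then show "(d8_aut a b False \<circ> \<theta>) (\<rho> \<sigma> x) = d8_aut (V \<sigma>) (U \<sigma>) (C \<sigma>) ((d8_aut a b False \<circ> \<theta>) x)"
      unfolding comp_apply action[OF s x] d8_aut_comp[OF \<theta>x] by simp
  qed (rule gal)
  then show ?thesis using gq g\<alpha> g\<beta> by blast
qed

end

subsection \<open>Dihedral matrix groups\<close>

definition to_mat :: "'b mat2 \<Rightarrow> 'b ^ 2 ^ 2" where
  "to_mat M = (\<chi> i j. if i = 1 then if j = 1 then m11 M else m12 M
                      else if j = 1 then m21 M else m22 M)"

definition of_mat :: "'b ^ 2 ^ 2 \<Rightarrow> 'b mat2" where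
  "of_mat M = Mat2 (M $ 1 $ 1) (M $ 1 $ 2) (M $ 2 $ 1) (M $ 2 $ 2)"

lemma of_mat_to_mat: "of_mat (to_mat M) = M"
  by (cases M) (simp add: of_mat_def to_mat_def)

lemma to_mat_of_mat: "to_mat (of_mat M) = M"
  by (simp add: of_mat_def to_mat_def vec_eq_iff forall_2)

lemma to_mat_mult: "to_mat (M * N) = to_mat M ** to_mat N"
  by (simp add: to_mat_def times_mat2_def matrix_matrix_mult_def vec_eq_iff forall_2 sum_2)

lemma of_mat_mult: "of_mat (M ** N) = of_mat M * of_mat N"
  by (metis of_mat_to_mat to_mat_mult to_mat_of_mat)

lemma to_mat_1: "to_mat 1 = mat 1"
  by (simp add: to_mat_def one_mat2_def mat_def vec_eq_iff forall_2)

lemma map_matrix_to_mat: "map_matrix f (to_mat M) = to_mat (map_mat2 f M)"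
  by (cases M) (simp add: to_mat_def map_matrix_def vec_eq_iff forall_2)

lemma group_GL2: "group (GL2 :: ('b::field ^ 2 ^ 2) monoid)"
proof (rule groupI)
  fix M :: "'b ^ 2 ^ 2" assume "M \<in> carrier GL2"
  then obtain N where "M ** N = mat 1" "N ** M = mat 1" by (auto simp: GL2_def invertible_def)
  then show "\<exists>N\<in>carrier GL2. N \<otimes>\<^bsub>GL2\<^esub> M = \<one>\<^bsub>GL2\<^esub>"
    by (intro bexI[of _ N]) (auto simp: GL2_def invertible_def)
next
  have "invertible (mat 1 :: 'b ^ 2 ^ 2)" unfolding invertible_def by (rule exI[of _ "mat 1"]) simp
  then show "\<one>\<^bsub>GL2\<^esub> \<in> carrier (GL2 :: ('b ^ 2 ^ 2) monoid)" by (simp add: GL2_def)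
qed (auto simp: GL2_def matrix_mul_assoc intro: invertible_mult)

context
  fixes \<sigma> :: "'a::field alg_closure \<Rightarrow> 'a alg_closure"
  assumes \<sigma>: "\<sigma> \<in> carrier abs_gal"
begin

lemma gal_mat2:
  "map_mat2 \<sigma> (M * N) = map_mat2 \<sigma> M * map_mat2 \<sigma> N"
  "map_mat2 \<sigma> (M + N) = map_mat2 \<sigma> M + map_mat2 \<sigma> N"
  "map_mat2 \<sigma> (M - N) = map_mat2 \<sigma> M - map_mat2 \<sigma> N"
  "map_mat2 \<sigma> (- M) = - map_mat2 \<sigma> M"
  "map_mat2 \<sigma> (scal x) = scal (\<sigma> x)"
  "map_mat2 \<sigma> 1 = 1"
  by (cases M; cases N; simp add: mat2_defs scal_def gal_mult[OF \<sigma>] gal_add[OF \<sigma>] gal_diff[OF \<sigma>]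
      gal_uminus[OF \<sigma>] gal_0[OF \<sigma>] gal_1[OF \<sigma>])+

lemma gal_mat2_to_ac: "map_mat2 \<sigma> (map_mat2 to_ac M) = map_mat2 to_ac M"
  by (cases M) (simp add: gal_to_ac[OF \<sigma>])

end

lemma map_mat2_to_ac:
  "map_mat2 to_ac (M * N) = map_mat2 to_ac M * map_mat2 to_ac N"
  "map_mat2 to_ac (- M) = - map_mat2 to_ac M"
  "map_mat2 to_ac (scal x) = scal (to_ac x)"
  by (cases M; cases N; simp add: mat2_defs scal_def)+

lemma map_mat2_to_ac_inject: "map_mat2 to_ac M = map_mat2 to_ac N \<longleftrightarrow> M = N"
  by (cases M; cases N) simp

lemma quat_pair_to_ac:
  "quat_pair (to_ac a) (to_ac b) (map_mat2 to_ac I) (map_mat2 to_ac J) \<longleftrightarrow> quat_pair a b I J"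
  unfolding quat_pair_def by (simp flip: map_mat2_to_ac add: map_mat2_to_ac_inject)

text \<open>The equations say that the vectors (b, c, a - d) and (f, g, e - h), which represent the
  matrices modulo scalars, are parallel.\<close>

lemma mat2_commuteD:
  fixes a :: "'b::field"
  assumes "Mat2 a b c d * Mat2 e f g h = Mat2 e f g h * Mat2 a b c d"
  shows "b * g = c * f" and "(a - d) * f = b * (e - h)" and "(a - d) * g = c * (e - h)"
proof -
  have e: "a * e + b * g = e * a + f * c" "a * f + b * h = e * b + f * d" "c * e + d * g = g * a + h * c"
    using assms by (simp_all only: times_mat2_def mat2.sel mat2.inject)
  show "b * g = c * f" using e(1) by Groebner_Basis.algebra
  show "(a - d) * f = b * (e - h)" using e(2) by Groebner_Basis.algebra
  show "(a - d) * g = c * (e - h)" using e(3) by Groebner_Basis.algebra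
qed

text \<open>A nonscalar \<open>Z\<close> has a nonzero vector (b, c, a - d). The vectors of
  \<open>R\<close> and \<open>S\<close> are parallel to it, hence to each other, so \<open>R\<close>
  and \<open>S\<close> would commute. \<open>k1\<close>, \<open>k2\<close> and \<open>k3\<close> are
  the minors expressing this.\<close>

lemma commutant_scal:
  assumes "Z * R = R * Z" "Z * S = S * Z" "R * S \<noteq> S * R"
  shows "\<exists>c. Z = scal c"
proof (rule ccontr)
  assume ns: "\<nexists>c. Z = scal c"
  obtain a b c d where Z: "Z = Mat2 a b c d" by (cases Z)
  obtain e f g h where R: "R = Mat2 e f g h" by (cases R)
  obtain e' f' g' h' where S: "S = Mat2 e' f' g' h'" by (cases S)
  have ns': "b \<noteq> 0 \<or> c \<noteq> 0 \<or> a \<noteq> d" using ns by (auto simp: Z scal_def)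
  note r = mat2_commuteD[OF assms(1)[unfolded Z R]] and s = mat2_commuteD[OF assms(2)[unfolded Z S]]
  have k1: "f * g' - g * f' = 0"
  proof -
    have x1: "b * (f * g' - g * f') = 0" using r s by Groebner_Basis.algebra
    have x2: "c * (f * g' - g * f') = 0" using r s by Groebner_Basis.algebra
    have x3: "(a - d) * (f * g' - g * f') = 0" using r s by Groebner_Basis.algebra
    show ?thesis using ns' x1 x2 x3 by auto
  qed
  have k2: "f * (e' - h') - f' * (e - h) = 0"
  proof -
    have x1: "b * (f * (e' - h') - f' * (e - h)) = 0" using r s by Groebner_Basis.algebra
    have x2: "c * (f * (e' - h') - f' * (e - h)) = 0" using r s by Groebner_Basis.algebra
    have x3: "(a - d) * (f * (e' - h') - f' * (e - h)) = 0" using r s by Groebner_Basis.algebra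
    show ?thesis using ns' x1 x2 x3 by auto
  qed
  have k3: "g * (e' - h') - g' * (e - h) = 0"
  proof -
    have x1: "b * (g * (e' - h') - g' * (e - h)) = 0" using r s by Groebner_Basis.algebra
    have x2: "c * (g * (e' - h') - g' * (e - h)) = 0" using r s by Groebner_Basis.algebra
    have x3: "(a - d) * (g * (e' - h') - g' * (e - h)) = 0" using r s by Groebner_Basis.algebra
    show ?thesis using ns' x1 x2 x3 by auto
  qed
  have "R * S = S * R"
  proof -
    have "e * e' + f * g' = e' * e + f' * g" using k1 by Groebner_Basis.algebra
    moreover have "e * f' + f * h' = e' * f + f' * h" using k2 by Groebner_Basis.algebra
    moreover have "g * e' + h * g' = g' * e + h' * g" using k3 by Groebner_Basis.algebra
    moreover have "g * f' + h * h' = g' * f + h' * h" using k1 by Groebner_Basis.algebra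
    ultimately show ?thesis by (simp only: R S times_mat2_def mat2.sel)
  qed
  with assms(3) show False by simp
qed

lemma anticommuting_rules:
  fixes R S :: "'b::field mat2"
  assumes "R * R = - 1" "S * S = 1" "S * R = - (R * S)"
  shows "R * (R * M) = - M" "S * (S * M) = M" "S * (R * M) = - (R * (S * M))"
    "R * scal c = scal c * R" "S * scal c = scal c * S"
    "R * (scal c * M) = scal c * (R * M)" "S * (scal c * M) = scal c * (S * M)"
  using assms by (simp_all flip: mult.assoc add: scal_commute[of _ c])

text \<open>\<open>R\<^sup>i S\<^sup>e\<close>, written for matrices with \<open>R\<^sup>2 = - 1\<close>.\<close>
definition d8_rep :: "'b::field mat2 \<Rightarrow> 'b mat2 \<Rightarrow> int \<times> int \<Rightarrow> 'b mat2" where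
  "d8_rep R S = (\<lambda>(i, e). (if i = 0 then 1 else if i = 1 then R else if i = 2 then - 1 else - R) *
                          (if e = 0 then 1 else S))"

lemma d8_rep_mult:
  assumes "R * R = - 1" "S * S = 1" "S * R = - (R * S)" "x \<in> carrier D8" "y \<in> carrier D8"
  shows "d8_rep R S (x \<otimes>\<^bsub>D8\<^esub> y) = d8_rep R S x * d8_rep R S y"
  using assms(4,5) anticommuting_rules(1-3)[OF assms(1-3)] assms(1-3)
  by (auto simp: carrier_D8 d8_rep_def D8_mult mult.assoc)

text \<open>The relations alone give faithfulness where 2 is invertible: if M S = 1 for some M
  commuting with R, then R = M S R = - R.\<close>

lemma d8_rep_trivial:
  fixes R S :: "'b::field mat2"
  assumes RS: "R * R = - 1" "S * S = 1" "S * R = - (R * S)" and char2: "CHAR('b) \<noteq> 2"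
    and x: "x \<in> carrier D8" "d8_rep R S x = 1"
  shows "x = (0, 0)"
proof -
  have neg: "M = 0" if "- M = M" for M :: "'b mat2"
  proof -
    have "scal 2 * M = M + M" by (cases M) (simp add: scal_def mat2_defs)
    also have "\<dots> = 0" using that by (metis add.right_inverse)
    finally show ?thesis using two_neq_0[OF char2] by (simp add: scal_mult_eq_0_iff)
  qed
  have ne: "(- 1 :: 'b mat2) \<noteq> 1" using neg[of 1] by force
  have R: "R \<noteq> 1" "- R \<noteq> 1" using RS(1) ne by (auto simp: minus_equation_iff[of R])
  have S: "M * S \<noteq> 1" if M: "M * R = R * M" for M
  proof
    assume MS: "M * S = 1"
    have "R = M * S * R" by (simp add: MS)
    also have "\<dots> = - (R * (M * S))" by (simp add: mult.assoc RS(3)) (simp add: M flip: mult.assoc)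
    also have "\<dots> = - R" by (simp add: MS)
    finally have "R = 0" using neg[of R] by simp
    then show False using RS(1) by simp
  qed
  show ?thesis
    using x R ne S[of 1] S[of R] S[of "- 1"] S[of "- R"] by (auto simp: carrier_D8 d8_rep_def)
qed

lemma scal_mult_self: "(scal c * M) * (scal c * M) = (scal c * scal c) * (M * M)"
proof -
  have "(scal c * M) * (scal c * M) = scal c * (M * scal c) * M" by (simp add: mult.assoc)
  also have "M * scal c = scal c * M" by (rule scal_commute)
  finally show ?thesis by (simp add: mult.assoc)
qed

text \<open>The congruence turns (\<alpha> \<beta>)^2 = w^2 (1 - z^2 u) / 4 into (w / (2 t))^2 u v,
  which gives \<alpha> \<beta> up to sign. This product is nonzero, hence so are its
  factors.\<close>

lemma square_roots_of_field:
  fixes u v w z :: "'a::field"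
  assumes char2: "CHAR('a) \<noteq> 2" and nz: "u \<noteq> 0" "v \<noteq> 0" "w \<noteq> 0"
    and cong: "sq_cong (u * v) (1 - z\<^sup>2 * u)"
    and p: "p\<^sup>2 = to_ac u" and q: "q\<^sup>2 = to_ac v"
    and \<alpha>: "\<alpha>\<^sup>2 = to_ac w * (1 + to_ac z * p) / 2" and \<beta>: "\<beta>\<^sup>2 = to_ac w * (1 - to_ac z * p) / 2"
  shows "\<exists>c. \<alpha> * \<beta> = to_ac c * p * q" and "\<alpha> \<noteq> 0" and "\<beta> \<noteq> 0" and "\<alpha>\<^sup>2 + \<beta>\<^sup>2 = to_ac w"
proof -
  have two: "(2 :: 'a) \<noteq> 0" "(2 :: 'a alg_closure) \<noteq> 0"
    using two_neq_0[OF char2] two_neq_0[where 'a = "'a alg_closure"] char2 by simp_all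
  obtain t where t: "t \<noteq> 0" "u * v / (1 - z\<^sup>2 * u) = t\<^sup>2" "1 - z\<^sup>2 * u \<noteq> 0"
    using cong by (auto simp: sq_cong_def)
  then have uv: "1 - z\<^sup>2 * u = u * v / t\<^sup>2" by (simp add: field_simps)
  define c where "c = w / (2 * t)"
  have "(\<alpha> * \<beta>)\<^sup>2 = (to_ac w)\<^sup>2 * ((1 + to_ac z * p) * (1 - to_ac z * p)) / (2 * 2)"
  proof -
    have "(\<alpha> * \<beta>)\<^sup>2 = (to_ac w * (1 + to_ac z * p) / 2) * (to_ac w * (1 - to_ac z * p) / 2)"
      by (simp only: power_mult_distrib \<alpha> \<beta>)
    then show ?thesis by (simp add: power2_eq_square mult.assoc mult.left_commute)
  qed
  also have "(1 + to_ac z * p) * (1 - to_ac z * p) = 1 - to_ac z ^ 2 * p\<^sup>2"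
    by (simp add: power2_eq_square algebra_simps)
  also have "\<dots> = to_ac (1 - z\<^sup>2 * u)" by (simp add: p)
  also have "\<dots> = to_ac u * to_ac v / to_ac t ^ 2" by (simp add: uv)
  also have "to_ac w ^ 2 * (to_ac u * to_ac v / to_ac t ^ 2) / (2 * 2) = (to_ac c * p * q)\<^sup>2"
    by (simp add: c_def power_mult_distrib power_divide p q) (simp add: power2_eq_square ac_simps)
  finally have sq: "(\<alpha> * \<beta>)\<^sup>2 = (to_ac c * p * q)\<^sup>2" .
  then have "\<alpha> * \<beta> = to_ac c * p * q \<or> \<alpha> * \<beta> = to_ac (- c) * p * q"
    by (simp add: power2_eq_iff)
  then show "\<exists>c. \<alpha> * \<beta> = to_ac c * p * q" by blast
  have "p \<noteq> 0" "q \<noteq> 0" using p q nz by auto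
  then have "to_ac c * p * q \<noteq> 0" using t two nz by (simp add: c_def)
  then show "\<alpha> \<noteq> 0" "\<beta> \<noteq> 0" using sq by auto
  show "\<alpha>\<^sup>2 + \<beta>\<^sup>2 = to_ac w"
    using two by (simp add: \<alpha> \<beta> field_simps)
qed

section \<open>Equivariant embeddings and quaternion generators over k\<close>

context d8_action
begin

context
  fixes v w :: 'a and q \<alpha> \<beta> :: "'a alg_closure"
  assumes perfect: "perfect_field TYPE('a)" and char2: "CHAR('a) \<noteq> 2"
    and vw: "v \<noteq> 0" "w \<noteq> 0" and q: "q\<^sup>2 = to_ac v" and \<alpha>\<beta>: "\<alpha>\<^sup>2 + \<beta>\<^sup>2 = to_ac w"
    and gq: "\<And>\<sigma>. \<sigma> \<in> carrier abs_gal \<Longrightarrow> \<sigma> q = flip (V \<sigma>) q"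
    and g\<alpha>: "\<And>\<sigma>. \<sigma> \<in> carrier abs_gal \<Longrightarrow> \<sigma> \<alpha> = flip (W \<sigma>) (if U \<sigma> then \<beta> else \<alpha>)"
    and g\<beta>: "\<And>\<sigma>. \<sigma> \<in> carrier abs_gal \<Longrightarrow>
      \<sigma> \<beta> = flip ((W \<sigma> \<noteq> U \<sigma>) \<noteq> V \<sigma>) (if U \<sigma> then \<alpha> else \<beta>)"
begin

lemma gal_fixed_mat2:
  assumes "\<And>\<sigma>. \<sigma> \<in> carrier abs_gal \<Longrightarrow> map_mat2 \<sigma> M = M"
  shows "\<exists>N. M = map_mat2 to_ac (N :: 'a mat2)"
proof -
  obtain a b c d where M: "M = Mat2 a b c d" by (cases M)
  have "a \<in> base_field" "b \<in> base_field" "c \<in> base_field" "d \<in> base_field"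
    using assms by (auto intro!: gal_fixed_in_base[OF perfect] simp: M)
  then show ?thesis by (auto simp: M intro: exI[of _ "Mat2 _ _ _ _"])
qed

text \<open>The matrices \<open>\<surd>v R\<close> and \<open>\<alpha> S + \<beta> R S\<close> are invariant under the Galois group, hence defined
  over \<open>k\<close>.\<close>
lemma quat_pair_of_rep:
  assumes RS: "R * R = - 1" "S * S = 1" "S * R = - (R * S)"
    and gR: "\<And>\<sigma>. \<sigma> \<in> carrier abs_gal \<Longrightarrow> map_mat2 \<sigma> R = flip (V \<sigma>) R"
    and gS: "\<And>\<sigma>. \<sigma> \<in> carrier abs_gal \<Longrightarrow> map_mat2 \<sigma> S = flip (W \<sigma>) (if U \<sigma> then R * S else S)"
  shows "\<exists>I J. quat_pair (- v) w I J"
proof -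
  note rules = RS anticommuting_rules[OF RS]
  define I where "I = scal q * R"
  define J where "J = scal \<alpha> * S + scal \<beta> * (R * S)"
  have "I * I = - scal (q\<^sup>2)"
    by (simp add: I_def rules mult.assoc scal_mult power2_eq_square)
  then have II: "I * I = scal (to_ac (- v))" by (simp add: q scal_simps)
  have JJ: "J * J = scal (\<alpha>\<^sup>2 + \<beta>\<^sup>2)"
    by (simp add: J_def rules algebra_simps scal_mult scal_simps power2_eq_square
        scal_commute[of "scal c" for c] scal_left_commute)
  have JI: "J * I = - (I * J)"
    by (simp add: I_def J_def rules algebra_simps scal_commute[of "scal c" for c] scal_left_commute)
  have "map_mat2 \<sigma> I = I" if s: "\<sigma> \<in> carrier abs_gal" for \<sigma>
    by (cases "V \<sigma>") (simp_all add: I_def gal_mat2[OF s] gR[OF s] gq[OF s] flip_def scal_simps)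
  then obtain I' where I': "I = map_mat2 to_ac I'" using gal_fixed_mat2 by blast
  \<comment> \<open>If \<open>U\<close> holds, \<sigma> exchanges the two summands; the sign from R
    R S = - S is compensated by \<open>U\<close> in the sign of \<sigma> \<beta>, and the sign of
    \<sigma> R by \<open>V\<close>.\<close>
  have "map_mat2 \<sigma> J = J" if s: "\<sigma> \<in> carrier abs_gal" for \<sigma>
    by (cases "V \<sigma>"; cases "U \<sigma>"; cases "W \<sigma>")
      (simp_all add: J_def gal_mat2[OF s] gR[OF s] gS[OF s] g\<alpha>[OF s] g\<beta>[OF s] flip_def scal_simps rules)
  then obtain J' where J': "J = map_mat2 to_ac J'" using gal_fixed_mat2 by blast
  have "quat_pair (to_ac (- v)) (to_ac w) (map_mat2 to_ac I') (map_mat2 to_ac J')"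
    using II JJ JI by (simp add: quat_pair_def \<alpha>\<beta> flip: I' J')
  then show ?thesis unfolding quat_pair_to_ac by blast
qed

text \<open>The construction of J reads J = (\<alpha> + \<beta> R) S, and (\<alpha> - \<beta> R)
  (\<alpha> + \<beta> R) = \<alpha>^2 + \<beta>^2 = w since R^2 = - 1. Solving for S gives (\<alpha>
  - \<beta> R) J / w.\<close>

lemma rep_of_quat_pair:
  assumes IJ: "quat_pair (- v) w I J"
  shows "\<exists>R S. R * R = - 1 \<and> S * S = 1 \<and> S * R = - (R * S) \<and> (\<forall>\<sigma>\<in>carrier abs_gal.
    map_mat2 \<sigma> R = flip (V \<sigma>) R \<and> map_mat2 \<sigma> S = flip (W \<sigma>) (if U \<sigma> then R * S else S))"
proof -
  define I' where "I' = map_mat2 to_ac I"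
  define J' where "J' = map_mat2 to_ac J"
  have "quat_pair (to_ac (- v)) (to_ac w) I' J'"
    unfolding I'_def J'_def quat_pair_to_ac by (rule IJ)
  then have *: "I' * I' = scal (to_ac (- v))" "J' * J' = scal (to_ac w)" "J' * I' = - (I' * J')"
    by (simp_all only: quat_pair_def)
  have q0: "q \<noteq> 0" using q vw by auto
  define R where "R = scal (inverse q) * I'"
  have RR: "R * R = - 1"
  proof -
    have "R * R = scal (inverse q * inverse q) * (I' * I')"
      unfolding R_def scal_mult_self scal_mult ..
    also have "\<dots> = scal (inverse q * inverse q * to_ac (- v))" by (simp only: * scal_mult mult.assoc)
    also have "inverse q * inverse q * to_ac (- v) = - 1"
      using q0 by (simp add: power2_eq_square field_simps flip: q)
    finally show ?thesis by (simp add: scal_simps)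
  qed
  have JR: "J' * R = - (R * J')"
  proof -
    have "J' * R = scal (inverse q) * (J' * I')"
      by (simp add: R_def scal_commute[of J'] flip: mult.assoc)
    then show ?thesis by (simp add: * R_def mult.assoc)
  qed
  have rules: "R * (R * M) = - M" "J' * (J' * M) = scal (to_ac w) * M" "J' * (R * M) = - (R * (J' * M))"
    "R * scal c = scal c * R" "J' * scal c = scal c * J'"
    "R * (scal c * M) = scal c * (R * M)" "J' * (scal c * M) = scal c * (J' * M)" for M c
    using RR JR *(2) by (simp_all flip: mult.assoc add: scal_commute[of _ c])
  define S where "S = scal (inverse (to_ac w)) * (scal \<alpha> * J' - scal \<beta> * (R * J'))"
  have "(scal \<alpha> * J' - scal \<beta> * (R * J')) * (scal \<alpha> * J' - scal \<beta> * (R * J')) = scal (\<alpha>\<^sup>2 + \<beta>\<^sup>2) * scal (to_ac w)"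
    by (simp add: rules RR JR *(2) algebra_simps scal_simps scal_mult power2_eq_square
        scal_commute[of "scal c" for c] scal_left_commute)
  then have "S * S = scal (inverse (to_ac w)) * scal (inverse (to_ac w)) * (scal (to_ac w) * scal (to_ac w))"
    unfolding S_def scal_mult_self \<alpha>\<beta> by simp
  also have "\<dots> = scal (inverse (to_ac w) * inverse (to_ac w) * (to_ac w * to_ac w))"
    by (simp only: scal_mult)
  also have "inverse (to_ac w) * inverse (to_ac w) * (to_ac w * to_ac w) = 1"
    using vw by (simp add: field_simps)
  finally have SS: "S * S = 1" by (simp add: scal_simps)
  have SR: "S * R = - (R * S)"
    by (simp add: S_def rules RR JR algebra_simps scal_commute[of "scal c" for c] scal_left_commute)
  have gR: "map_mat2 \<sigma> R = flip (V \<sigma>) R" if s: "\<sigma> \<in> carrier abs_gal" for \<sigma>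
    by (cases "V \<sigma>") (simp_all add: R_def I'_def gal_mat2[OF s] gal_mat2_to_ac[OF s] gal_inverse[OF s]
        gq[OF s] flip_def scal_simps)
  have gS: "map_mat2 \<sigma> S = flip (W \<sigma>) (if U \<sigma> then R * S else S)" if s: "\<sigma> \<in> carrier abs_gal" for \<sigma>
  proof -
    have RS: "R * S = scal (inverse (to_ac w)) * (scal \<alpha> * (R * J') + scal \<beta> * J')"
      by (simp add: S_def rules RR algebra_simps)
    have "map_mat2 \<sigma> S = scal (inverse (to_ac w)) * (scal (\<sigma> \<alpha>) * J' - scal (\<sigma> \<beta>) * (flip (V \<sigma>) R * J'))"
      by (simp add: S_def gal_mat2[OF s] gR[OF s] gal_inverse[OF s] gal_to_ac[OF s])
        (simp add: J'_def gal_mat2_to_ac[OF s])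
    then show ?thesis unfolding RS unfolding S_def
      by (cases "V \<sigma>"; cases "U \<sigma>"; cases "W \<sigma>")
        (simp_all add: g\<alpha>[OF s] g\<beta>[OF s] flip_def scal_simps algebra_simps)
  qed
  show ?thesis using RR SS SR gR gS by blast
qed

text \<open>r^2 is central, so its matrix commutes with those of r and s, which do not commute with
  each other, and is a scalar c by \<open>commutant_scal\<close>. Then c^2 = 1, and injectivity
  excludes c = 1.\<close>

lemma GL2_embedding_imp_quat_pair:
  assumes H: "subgroup H GL2" and iso: "\<phi> \<in> iso A (GL2\<lparr>carrier := H\<rparr>)"
    and eq: "\<And>\<sigma> a. \<sigma> \<in> carrier abs_gal \<Longrightarrow> a \<in> carrier A \<Longrightarrow> \<phi> (\<rho> \<sigma> a) = map_matrix \<sigma> (\<phi> a)"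
  shows "\<exists>I J. quat_pair (- v) w I J"
proof -
  define \<psi> where "\<psi> x = of_mat (\<phi> (inv_into (carrier A) \<theta> x))" for x
  have inv: "inv_into (carrier A) \<theta> x \<in> carrier A" "\<theta> (inv_into (carrier A) \<theta> x) = x"
    if "x \<in> carrier D8" for x
    using that bij_betw_inv_into_right[OF \<theta>_bij that] inv_into_into[of x \<theta> "carrier A"]
      bij_betw_imp_surj_on[OF \<theta>_bij] by simp_all
  have inv_\<theta>: "inv_into (carrier A) \<theta> (\<theta> a) = a" if "a \<in> carrier A" for a
    using bij_betw_inv_into_left[OF \<theta>_bij that] .
  have mult: "\<psi> (x \<otimes>\<^bsub>D8\<^esub> y) = \<psi> x * \<psi> y" if "x \<in> carrier D8" "y \<in> carrier D8" for x y
  proof -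
    let ?i = "inv_into (carrier A) \<theta>"
    have "?i (x \<otimes>\<^bsub>D8\<^esub> y) = ?i x \<otimes>\<^bsub>A\<^esub> ?i y"
      using inv[OF that(1)] inv[OF that(2)] inv_\<theta>[of "?i x \<otimes>\<^bsub>A\<^esub> ?i y"] by simp
    moreover have "\<phi> (?i x \<otimes>\<^bsub>A\<^esub> ?i y) = \<phi> (?i x) ** \<phi> (?i y)"
      using iso inv[OF that(1)] inv[OF that(2)] by (simp add: iso_def hom_def GL2_def)
    ultimately show ?thesis by (simp add: \<psi>_def of_mat_mult)
  qed
  have inj: "\<psi> x \<noteq> \<psi> y" if "x \<in> carrier D8" "y \<in> carrier D8" "x \<noteq> y" for x y
  proof
    assume "\<psi> x = \<psi> y"
    then have "\<phi> (inv_into (carrier A) \<theta> x) = \<phi> (inv_into (carrier A) \<theta> y)"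
      unfolding \<psi>_def by (metis to_mat_of_mat)
    then have "inv_into (carrier A) \<theta> x = inv_into (carrier A) \<theta> y"
      using iso inv[OF that(1)] inv[OF that(2)] by (auto simp: iso_def bij_betw_def inj_on_def)
    then show False using inv[OF that(1)] inv[OF that(2)] that(3) by metis
  qed
  have g\<psi>: "map_mat2 \<sigma> (\<psi> x) = \<psi> (d8_aut (V \<sigma>) (U \<sigma>) (W \<sigma>) x)"
    if s: "\<sigma> \<in> carrier abs_gal" and x: "x \<in> carrier D8" for \<sigma> x
  proof -
    let ?a = "inv_into (carrier A) \<theta> x"
    have "\<theta> (\<rho> \<sigma> ?a) = d8_aut (V \<sigma>) (U \<sigma>) (W \<sigma>) x"
      using action[OF s inv(1)[OF x]] inv(2)[OF x] by simp
    then have "inv_into (carrier A) \<theta> (d8_aut (V \<sigma>) (U \<sigma>) (W \<sigma>) x) = \<rho> \<sigma> ?a"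
      using inv_\<theta>[OF \<rho>_closed[OF s inv(1)[OF x]]] by simp
    then have "to_mat (\<psi> (d8_aut (V \<sigma>) (U \<sigma>) (W \<sigma>) x)) = map_matrix \<sigma> (\<phi> ?a)"
      using eq[OF s inv(1)[OF x]] by (simp add: \<psi>_def to_mat_of_mat)
    also have "\<dots> = to_mat (map_mat2 \<sigma> (\<psi> x))"
      by (simp add: \<psi>_def to_mat_of_mat flip: map_matrix_to_mat)
    finally show ?thesis by (metis of_mat_to_mat)
  qed
  define R where "R = \<psi> (1, 0)"
  define S where "S = \<psi> (0, 1)"
  have m: "(0, 0) \<in> carrier D8" "(1, 0) \<in> carrier D8" "(2, 0) \<in> carrier D8" "(3, 0) \<in> carrier D8"
    "(0, 1) \<in> carrier D8" "(1, 1) \<in> carrier D8" "(2, 1) \<in> carrier D8" "(3, 1) \<in> carrier D8"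
    by (simp_all add: carrier_D8)
  note mm = mult[OF m(2) m(2)] mult[OF m(3) m(3)] mult[OF m(3) m(2)] mult[OF m(2) m(3)] mult[OF m(5) m(5)]
    mult[OF m(3) m(5)] mult[OF m(5) m(3)] mult[OF m(2) m(5)] mult[OF m(5) m(2)] mult[OF m(4) m(5)]
  \<comment> \<open>The image of the identity is idempotent and invertible.\<close>
  have one: "\<psi> (0, 0) = 1"
  proof -
    have "\<theta> \<one>\<^bsub>A\<^esub> = (0, 0)" by (simp add: D8_one)
    then have "inv_into (carrier A) \<theta> (0, 0) = \<one>\<^bsub>A\<^esub>" using inv_\<theta>[OF A.one_closed] by simp
    then have \<psi>0: "\<psi> (0, 0) = of_mat (\<phi> \<one>\<^bsub>A\<^esub>)" by (simp add: \<psi>_def)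
    have "\<phi> \<one>\<^bsub>A\<^esub> \<in> H" using iso by (auto simp: iso_def hom_def)
    then have "\<phi> \<one>\<^bsub>A\<^esub> \<in> carrier GL2" using H by (meson subgroup.mem_carrier)
    then obtain N where "\<phi> \<one>\<^bsub>A\<^esub> ** N = mat 1" by (auto simp: GL2_def invertible_def)
    then have N: "\<psi> (0, 0) * of_mat N = 1"
      unfolding \<psi>0 of_mat_mult[symmetric] by (metis of_mat_to_mat to_mat_1)
    have "\<psi> (0, 0) * \<psi> (0, 0) = \<psi> (0, 0)" using mult[OF m(1) m(1)] by (simp add: D8_mult)
    then have "\<psi> (0, 0) * (\<psi> (0, 0) * of_mat N) = \<psi> (0, 0) * of_mat N" by (simp flip: mult.assoc)
    then show ?thesis using N by simp
  qed
  have Z1: "\<psi> (2, 0) * \<psi> (2, 0) = 1" using mm(2) one by (simp add: D8_mult)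
  have "\<exists>c. \<psi> (2, 0) = scal c"
  proof (rule commutant_scal)
    show "\<psi> (2, 0) * R = R * \<psi> (2, 0)" using mm(3,4) by (simp add: R_def D8_mult)
    show "\<psi> (2, 0) * S = S * \<psi> (2, 0)" using mm(6,7) by (simp add: S_def D8_mult)
    show "R * S \<noteq> S * R" using mm(8,9) inj[OF m(6) m(8)] by (simp add: R_def S_def D8_mult)
  qed
  then obtain c where c: "\<psi> (2, 0) = scal c" by blast
  have "c * c = 1" using Z1 unfolding c scal_mult[symmetric] by (simp flip: scal_simps(2))
  moreover have "c \<noteq> 1" using inj[OF m(3) m(1)] by (auto simp: c one scal_simps)
  ultimately have "c = - 1" using square_eq_1_iff[of c] by blast
  then have Z: "\<psi> (2, 0) = - 1" by (simp add: c scal_simps)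
  have RR: "R * R = - 1" using mm(1) Z by (simp add: R_def D8_mult)
  have SS: "S * S = 1" using mm(5) one by (simp add: S_def D8_mult)
  have R3: "\<psi> (3, 0) = - R" using mm(3) Z by (simp add: R_def D8_mult)
  have RS: "\<psi> (1, 1) = R * S" using mm(8) by (simp add: R_def S_def D8_mult)
  have R2S: "\<psi> (2, 1) = - S" using mm(6) Z by (simp add: S_def D8_mult)
  have R3S: "\<psi> (3, 1) = - (R * S)" using mm(10) R3 by (simp add: S_def D8_mult)
  have SR: "S * R = - (R * S)" using mm(9) R3S by (simp add: R_def S_def D8_mult)
  show ?thesis
  proof (rule quat_pair_of_rep[OF RR SS SR])
    fix \<sigma> assume s: "\<sigma> \<in> carrier (abs_gal :: ('a alg_closure \<Rightarrow> 'a alg_closure) monoid)"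
    show "map_mat2 \<sigma> R = flip (V \<sigma>) R"
      using g\<psi>[OF s m(2)] R3 by (cases "V \<sigma>") (simp_all add: R_def d8_aut_def flip_def)
    show "map_mat2 \<sigma> S = flip (W \<sigma>) (if U \<sigma> then R * S else S)"
      using g\<psi>[OF s m(5)] RS R2S R3S
      by (cases "V \<sigma>"; cases "U \<sigma>"; cases "W \<sigma>") (simp_all add: S_def d8_aut_def flip_def)
  qed
qed

lemma GL2_embedding_of_quat_pair:
  assumes "quat_pair (- v) w I J"
  shows "\<exists>H. subgroup H GL2 \<and> gal_stable H \<and>
    gal_isomorphic A \<rho> (GL2\<lparr>carrier := H\<rparr>) (restrict_action H map_matrix)"
proof -
  obtain R S where RS: "R * R = - 1" "S * S = 1" "S * R = - (R * S)"
    and gR: "\<And>\<sigma>. \<sigma> \<in> carrier abs_gal \<Longrightarrow> map_mat2 \<sigma> R = flip (V \<sigma>) R"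
    and gS: "\<And>\<sigma>. \<sigma> \<in> carrier abs_gal \<Longrightarrow> map_mat2 \<sigma> S = flip (W \<sigma>) (if U \<sigma> then R * S else S)"
    using rep_of_quat_pair[OF assms] by blast
  define \<phi> where "\<phi> a = to_mat (d8_rep R S (\<theta> a))" for a
  have one: "d8_rep R S (0, 0) = 1" by (simp add: d8_rep_def)
  have mult: "\<phi> (a \<otimes>\<^bsub>A\<^esub> b) = \<phi> a ** \<phi> b" if "a \<in> carrier A" "b \<in> carrier A" for a b
    using that by (simp add: \<phi>_def d8_rep_mult[OF RS] to_mat_mult)
  have \<phi>1: "\<phi> \<one>\<^bsub>A\<^esub> = mat 1" by (simp add: \<phi>_def D8_one one to_mat_1)
  have inv: "invertible (\<phi> a)" if "a \<in> carrier A" for a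
    unfolding invertible_def using mult[OF that A.inv_closed[OF that]] mult[OF A.inv_closed[OF that] that] \<phi>1 that
    by (intro exI[of _ "\<phi> (inv\<^bsub>A\<^esub> a)"]) simp
  interpret G: group "GL2 :: ('a alg_closure ^ 2 ^ 2) monoid" by (rule group_GL2)
  have hom: "\<phi> \<in> hom A GL2" by (rule homI) (simp_all add: GL2_def inv mult)
  interpret \<phi>: group_hom A GL2 \<phi> by unfold_locales (rule hom)
  define H where "H = \<phi> ` carrier A"
  have H: "subgroup H GL2" unfolding H_def by (rule \<phi>.img_is_subgroup)
  have g\<phi>: "map_matrix \<sigma> (\<phi> a) = \<phi> (\<rho> \<sigma> a)" if s: "\<sigma> \<in> carrier abs_gal" and a: "a \<in> carrier A" for \<sigma> a
  proof -
    have "map_mat2 \<sigma> (d8_rep R S x) = d8_rep R S (d8_aut (V \<sigma>) (U \<sigma>) (W \<sigma>) x)" if "x \<in> carrier D8" for x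
    proof -
      have "x = (0, 0) \<or> x = (1, 0) \<or> x = (2, 0) \<or> x = (3, 0) \<or> x = (0, 1) \<or> x = (1, 1) \<or> x = (2, 1) \<or> x = (3, 1)"
        using that by (auto simp: carrier_D8)
      then show ?thesis
        by (elim disjE; cases "V \<sigma>"; cases "U \<sigma>"; cases "W \<sigma>")
          (simp_all add: d8_rep_def d8_aut_def gal_mat2[OF s] gR[OF s] gS[OF s] flip_def
            anticommuting_rules[OF RS] RS)
    qed
    then show ?thesis
      using a action[OF s a] by (simp add: \<phi>_def map_matrix_to_mat)
  qed
  have inj: "inj_on \<phi> (carrier A)"
    unfolding \<phi>.inj_on_one_iff
  proof (intro allI impI)
    fix a assume a: "a \<in> carrier A" "\<phi> a = \<one>\<^bsub>GL2\<^esub>"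
    then have "to_mat (d8_rep R S (\<theta> a)) = to_mat 1" by (simp add: \<phi>_def to_mat_1 GL2_def)
    then have "d8_rep R S (\<theta> a) = 1" by (metis of_mat_to_mat)
    then have "\<theta> a = (0, 0)"
      using d8_rep_trivial[OF RS _ \<theta>.hom_closed[OF a(1)]] char2 by simp
    then have "\<theta> a = \<theta> \<one>\<^bsub>A\<^esub>" by (simp add: D8_one)
    then show "a = \<one>\<^bsub>A\<^esub>" using \<theta>_inj a(1) by blast
  qed
  have "\<phi> \<in> iso A (GL2\<lparr>carrier := H\<rparr>)"
    using hom inj by (auto simp: iso_def hom_def H_def bij_betw_def)
  moreover have "\<phi> (\<rho> \<sigma> a) = restrict_action H map_matrix \<sigma> (\<phi> a)"
    if "\<sigma> \<in> carrier abs_gal" "a \<in> carrier A" for \<sigma> a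
    using g\<phi>[OF that] that by (simp add: restrict_action_def H_def)
  moreover have "gal_stable H"
    using g\<phi> \<rho>_closed by (auto simp: gal_stable_def H_def)
  ultimately show ?thesis using H unfolding gal_isomorphic_def by blast
qed

end

end

theorem theorem3p4:
  fixes A :: "('g, 'm) monoid_scheme"
    and \<rho> :: "('a::field, 'g) gal_action"
    and u v w z :: 'a
  assumes "perfect_field TYPE('a)"
    and "CHAR('a) \<noteq> 2"
    and "gal_group A \<rho>"
    and "A \<cong> D8"
    and "u \<noteq> 0" and "v \<noteq> 0" and "w \<noteq> 0"
    and "action_field (A Mod center A) (quotient_action A (center A) \<rho>)
           = adjoin {ac_sqrt (to_ac u)}"
    and "action_field (A\<lparr>carrier := cyclic4 A\<rparr>) (restrict_action (cyclic4 A) \<rho>)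
           = adjoin {ac_sqrt (to_ac v)}"
    and "sq_cong (u * v) (1 - z\<^sup>2 * u)"
    and "action_field A \<rho>
           = adjoin {ac_sqrt (to_ac v),
                     ac_sqrt (to_ac w * (1 + to_ac z * ac_sqrt (to_ac u)) / 2),
                     ac_sqrt (to_ac w * (1 - to_ac z * ac_sqrt (to_ac u)) / 2)}"
  shows "(\<exists>H. subgroup H GL2 \<and> gal_stable H \<and>
            gal_isomorphic A \<rho> (GL2\<lparr>carrier := H\<rparr>) (restrict_action H map_matrix))
         \<longleftrightarrow> trivial_brauer_class (quaternion_alg (- v) w)"
proof -
  define p where "p = ac_sqrt (to_ac u)"
  define q where "q = ac_sqrt (to_ac v)"
  define \<alpha> where "\<alpha> = ac_sqrt (to_ac w * (1 + to_ac z * p) / 2)"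
  define \<beta> where "\<beta> = ac_sqrt (to_ac w * (1 - to_ac z * p) / 2)"
  have sq: "p\<^sup>2 = to_ac u" "q\<^sup>2 = to_ac v" "\<alpha>\<^sup>2 = to_ac w * (1 + to_ac z * p) / 2"
    "\<beta>\<^sup>2 = to_ac w * (1 - to_ac z * p) / 2"
    by (simp_all only: p_def q_def \<alpha>_def \<beta>_def ac_sqrt_power2)
  have nz: "p \<noteq> 0" "q \<noteq> 0" using sq(1,2) assms(5,6) by auto
  note roots = square_roots_of_field[OF assms(2,5,6,7,10) sq]
  obtain c where c: "\<alpha> * \<beta> = to_ac c * p * q" using roots(1) by blast
  obtain \<theta> U V W where d8: "d8_action A \<rho> \<theta> U V W"
    and g: "\<forall>\<sigma>\<in>carrier abs_gal. \<sigma> q = flip (V \<sigma>) q \<and> \<sigma> \<alpha> = flip (W \<sigma>) (if U \<sigma> then \<beta> else \<alpha>) \<and>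
     \<sigma> \<beta> = flip ((W \<sigma> \<noteq> U \<sigma>) \<noteq> V \<sigma>) (if U \<sigma> then \<alpha> else \<beta>)"
    using d8_normal_form[OF assms(2,3,4) nz roots(2,3) sq c assms(8,9,11)[folded p_def q_def, folded \<alpha>_def \<beta>_def]]
    by blast
  interpret d8_action A \<rho> \<theta> U V W by (rule d8)
  note ctx = assms(1,2,6,7) sq(2) roots(4)
  have g1: "\<And>\<sigma>. \<sigma> \<in> carrier abs_gal \<Longrightarrow> \<sigma> q = flip (V \<sigma>) q"
    and g2: "\<And>\<sigma>. \<sigma> \<in> carrier abs_gal \<Longrightarrow> \<sigma> \<alpha> = flip (W \<sigma>) (if U \<sigma> then \<beta> else \<alpha>)"
    and g3: "\<And>\<sigma>. \<sigma> \<in> carrier abs_gal \<Longrightarrow>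
      \<sigma> \<beta> = flip ((W \<sigma> \<noteq> U \<sigma>) \<noteq> V \<sigma>) (if U \<sigma> then \<alpha> else \<beta>)"
    using g by blast+
  have "(\<exists>H. subgroup H GL2 \<and> gal_stable H \<and>
            gal_isomorphic A \<rho> (GL2\<lparr>carrier := H\<rparr>) (restrict_action H map_matrix))
         \<longleftrightarrow> (\<exists>I J. quat_pair (- v) w I J)" (is "?L \<longleftrightarrow> ?R")
  proof
    assume ?L
    then obtain H \<phi> where H: "subgroup H GL2" and \<phi>: "\<phi> \<in> iso A (GL2\<lparr>carrier := H\<rparr>)"
      "\<And>\<sigma> a. \<sigma> \<in> carrier abs_gal \<Longrightarrow> a \<in> carrier A \<Longrightarrow> \<phi> (\<rho> \<sigma> a) = restrict_action H map_matrix \<sigma> (\<phi> a)"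
      unfolding gal_isomorphic_def by blast
    show ?R
    proof (rule GL2_embedding_imp_quat_pair[OF ctx g1 g2 g3 H \<phi>(1)])
      fix \<sigma> :: "'a alg_closure \<Rightarrow> 'a alg_closure" and a
      assume s: "\<sigma> \<in> carrier abs_gal" and a: "a \<in> carrier A"
      have "\<phi> a \<in> H" using \<phi>(1) a by (auto simp: iso_def hom_def)
      then show "\<phi> (\<rho> \<sigma> a) = map_matrix \<sigma> (\<phi> a)" using \<phi>(2)[OF s a] by (simp add: restrict_action_def)
    qed
  qed (use GL2_embedding_of_quat_pair[OF ctx g1 g2 g3] in blast)
  also have "\<dots> \<longleftrightarrow> trivial_brauer_class (quaternion_alg (- v) w)"
    using trivial_quaternion_iff[of "- v" w] assms(2,6,7) by simp
  finally show ?thesis .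
qed

end
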